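(* The integer $\tilde s_o(C,D,f)$ of a two-reduced LEO triple $(C,D,f)$ depends only on its class $[(C,D,f)]$ in $\widetilde{\mathcal{C}}^{\,o}_{LEO}$, and $[(C,D,f)]$ is trivial in $\widetilde{\mathcal{C}}^{\,o}_{LEO}$ if and only if $\tilde s_o(C,D,f)=\tilde s_o((C,D,f)^* )=0$, where $(C,D,f)^*$ is the dual of $(C,D,f)$, representing the inverse of $[(C,D,f)]$ in $\widetilde{\mathcal{C}}^{\,o}_{LEO}$. Further, the relation that $[(C,D,f)]\ge 0$ if and only if $\tilde s_o(C,D,f)\ge 0$ makes $\widetilde{\mathcal{C}}^{\,o}_{LEO}$ into a totally ordered abelian group (that is, declaring $x\ge y$ if and only if $x-y\geq 0$ defines a translation-invariant total order).
   Context: Conventions. All complexes are bigraded cochain complexes ($i$ homological, $q$ quantum grading) with differential of bidegree $(1,0)$; "finitely generated free" means free on finitely many homogeneous generators. $\mathbb{F}_2=\mathbb{Z}/2$; $h$ has bidegree $(0,-2)$; $h^{-1}D=D\otimes_{\mathbb{F}_2[h]}\mathbb{F}_2[h,h^{-1}]$; $D_{h=0}=D/hD$. $H^{i,q}$ denotes cohomology in bigrading $(i,q)$. A two-reduced LEO triple $(C,D,f)$ consists of finitely generated free bigraded complexes $C$ over $\mathbb{Z}$ and $D$ over $\mathbb{F}_2[h]$, and a bigraded homotopy equivalence $f\colon C\otimes_{\mathbb{Z}}\mathbb{Z}/(2)\to D\otimes_{\mathbb{F}_2[h]}\mathbb{F}_2[h]/(h)$, such that $h^{-1}D$ is homotopy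 equivalent to a free graded module of rank 1 over $\mathbb{F}_2[h,h^{-1}]$ supported in homological grading $0$ and even quantum gradings. A local map $(C,D,f)\to(C',D',f')$ is a pair of bigrading-preserving chain maps $\alpha\colon C\to C'$, $\beta\colon D\to D'$ (over $\mathbb{Z}$ and $\mathbb{F}_2[h]$) such that $\beta\colon h^{-1}D\to h^{-1}D'$ is a homotopy equivalence and $f'\circ\alpha$ and $\beta\circ f$ are chain homotopic as maps $C\otimes\mathbb{F}_2\to D'_{h=0}$. Two triples are locally equivalent if there are local maps in both directions. $\widetilde{\mathcal{C}}^{\,o}_{LEO}$ is the abelian group of local equivalence classes, with addition $(C\otimes_{\mathbb{Z}}C',D\otimes_{\mathbb{F}_2[h]}D',f\otimes f')$, identity the class of $(\mathbb{Z},\mathbb{F}_2[h],\mathrm{id})$ (generators in bigrading $(0,0)$), and inverse the dual $(C,D,f)^*=(\mathrm{Hom}_{\mathbb{Z}}(C,\mathbb{Z}),\mathrm{Hom}_{\mathbb{F}_2[h]}(D,\mathbb{F}_2[h]),\overline f)$, with gradings negated on dual generators and $\overline f$ the transpose of a homotopy inverse of $f$. An even integer $q$ is oddly reduced-full for $(C,D,f)$ if there exist $\check a\in H^{0,q}(C)$ and $a\in H^{0,q}(D)$ with $f(j(\check a))=p(a)\in H^{0,q}(D_{h=0})$ and $i(a)\neq0\in H^{0,q}(h^{-1}D)$, where $j\colon H^{0,q}(C)\to H^{0,q}(C\otimes\mathbb{F}_2)$, $p\colon H^{0,q}(D)\to H^{0,q}(D_{h=0})$ and $i\colon H^{0,q}(D)\to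 H^{0,q}(h^{-1}D)$ are the natural maps. Define $\tilde s_o(C,D,f)=\max\{q\in2\mathbb{Z}\mid q\text{ is oddly reduced-full}\}$. *)

theory Defs
  imports
    "Jordan_Normal_Form.Matrix"
    "HOL-Library.Z2"
    "HOL-Library.Poly_Mapping"
    "HOL-Computational_Algebra.Polynomial"
    "HOL-Algebra.Group"
begin

section \<open>Graded coefficient rings\<close>

text \<open>
  The field with two elements is \<^typ>\<open>bit\<close>, the ring $F_2[h]$ is \<^typ>\<open>bit poly\<close>, and
  $F_2[h,h^{-1}]$ is the ring of finitely supported functions from \<^typ>\<open>int\<close> to \<^typ>\<open>bit\<close>
  under convolution. All coefficient rings sit in homological degree 0; a grading predicate
  \<open>gr q a\<close> says that \<open>a\<close> is homogeneous of quantum degree \<open>q\<close> (0 is homogeneous of every degree).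
  The element $h$ has quantum degree $-2$.
\<close>

type_synonym laurent = "int \<Rightarrow>\<^sub>0 bit"

type_synonym 'r grading = "int \<Rightarrow> 'r \<Rightarrow> bool"

definition gr_triv :: "'r::zero grading" where
  "gr_triv q a \<longleftrightarrow> a = 0 \<or> q = 0"

definition gr_h :: "bit poly grading" where
  "gr_h q p \<longleftrightarrow> p = 0 \<or> (\<exists>k::nat. p = monom 1 k \<and> q = - 2 * int k)"

definition gr_loc :: "laurent grading" where
  "gr_loc q p \<longleftrightarrow> p = 0 \<or> (\<exists>k::int. p = Poly_Mapping.single k 1 \<and> q = - 2 * k)"

definition mod2 :: "int \<Rightarrow> bit" where
  "mod2 a = of_int a"

text \<open>The quotient map $F_2[h] \to F_2[h]/(h) = F_2$.\<close>

definition at_h0 :: "bit poly \<Rightarrow> bit" where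
  "at_h0 p = coeff p 0"

text \<open>The localization map $F_2[h] \to F_2[h,h^{-1}]$.\<close>

definition to_loc :: "bit poly \<Rightarrow> laurent" where
  "to_loc p = (\<Sum>k\<le>degree p. Poly_Mapping.single (int k) (coeff p k))"

section \<open>Finitely generated free bigraded complexes\<close>

text \<open>
  A free complex on finitely many homogeneous generators $e_0,\dots,e_{n-1}$ is given by the list of
  bidegrees (homological, quantum) of its generators and by the matrix of its differential; column
  \<open>j\<close> holds the coordinates of the image of $e_j$. Linear maps are matrices in the same way.
\<close>

record 'r cpx =
  gens :: "(int \<times> int) list"
  bd :: "'r mat"

definition rk :: "'r cpx \<Rightarrow> nat" where
  "rk C = length (gens C)"

definition hdeg :: "'r cpx \<Rightarrow> nat \<Rightarrow> int" where
  "hdeg C k = fst (gens C ! k)"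

definition qdeg :: "'r cpx \<Rightarrow> nat \<Rightarrow> int" where
  "qdeg C k = snd (gens C ! k)"

text \<open>Linear maps \<open>C \<rightarrow> C'\<close> that are homogeneous of bidegree \<open>(a, b)\<close>.\<close>

definition bihom :: "'r::comm_ring_1 grading \<Rightarrow> int \<Rightarrow> int \<Rightarrow> 'r cpx \<Rightarrow> 'r cpx \<Rightarrow> 'r mat set" where
  "bihom gr a b C C' =
     {M \<in> carrier_mat (rk C') (rk C).
        \<forall>i < rk C'. \<forall>j < rk C. M $$ (i, j) \<noteq> 0 \<longrightarrow>
          hdeg C' i = hdeg C j + a \<and> gr (qdeg C j + b - qdeg C' i) (M $$ (i, j))}"

definition is_cpx :: "'r::comm_ring_1 grading \<Rightarrow> 'r cpx \<Rightarrow> bool" where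
  "is_cpx gr C \<longleftrightarrow> bd C \<in> bihom gr 1 0 C C \<and> bd C * bd C = 0\<^sub>m (rk C) (rk C)"

definition chain_map :: "'r::comm_ring_1 grading \<Rightarrow> 'r cpx \<Rightarrow> 'r cpx \<Rightarrow> 'r mat \<Rightarrow> bool" where
  "chain_map gr C C' M \<longleftrightarrow> M \<in> bihom gr 0 0 C C' \<and> bd C' * M = M * bd C"

definition homotopic :: "'r::comm_ring_1 grading \<Rightarrow> 'r cpx \<Rightarrow> 'r cpx \<Rightarrow> 'r mat \<Rightarrow> 'r mat \<Rightarrow> bool" where
  "homotopic gr C C' M N \<longleftrightarrow> (\<exists>H \<in> bihom gr (- 1) 0 C C'. M - N = bd C' * H + H * bd C)"

definition homotopy_inverse ::
    "'r::comm_ring_1 grading \<Rightarrow> 'r cpx \<Rightarrow> 'r cpx \<Rightarrow> 'r mat \<Rightarrow> 'r mat \<Rightarrow> bool" where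
  "homotopy_inverse gr C C' M N \<longleftrightarrow>
     chain_map gr C' C N \<and>
     homotopic gr C C (N * M) (1\<^sub>m (rk C)) \<and>
     homotopic gr C' C' (M * N) (1\<^sub>m (rk C'))"

definition homotopy_equivalence ::
    "'r::comm_ring_1 grading \<Rightarrow> 'r cpx \<Rightarrow> 'r cpx \<Rightarrow> 'r mat \<Rightarrow> bool" where
  "homotopy_equivalence gr C C' M \<longleftrightarrow> chain_map gr C C' M \<and> (\<exists>N. homotopy_inverse gr C C' M N)"

definition homotopy_equivalent :: "'r::comm_ring_1 grading \<Rightarrow> 'r cpx \<Rightarrow> 'r cpx \<Rightarrow> bool" where
  "homotopy_equivalent gr C C' \<longleftrightarrow> (\<exists>M. homotopy_equivalence gr C C' M)"

definition base_change :: "('r \<Rightarrow> 's) \<Rightarrow> 'r cpx \<Rightarrow> 's cpx" where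
  "base_change \<phi> C = \<lparr>gens = gens C, bd = map_mat \<phi> (bd C)\<rparr>"

text \<open>The free module of rank 1 generated in bidegree \<open>(i, q)\<close>, with zero differential.\<close>

definition rank1 :: "int \<Rightarrow> int \<Rightarrow> 'r::zero cpx" where
  "rank1 i q = \<lparr>gens = [(i, q)], bd = 0\<^sub>m 1 1\<rparr>"

definition ksign :: "int \<Rightarrow> 'r::ring_1" where
  "ksign i = (if even i then 1 else - 1)"

text \<open>Kronecker product; the basis vector $e_a \otimes e'_b$ has index \<open>a * n' + b\<close>.\<close>

definition kron :: "'r::times mat \<Rightarrow> 'r mat \<Rightarrow> 'r mat" where
  "kron A B = mat (dim_row A * dim_row B) (dim_col A * dim_col B)
     (\<lambda>(i, j). A $$ (i div dim_row B, j div dim_col B) * B $$ (i mod dim_row B, j mod dim_col B))"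

text \<open>$d(x \otimes y) = dx \otimes y + (-1)^{|x|} x \otimes dy$.\<close>

definition tensor_cpx :: "'r::comm_ring_1 cpx \<Rightarrow> 'r cpx \<Rightarrow> 'r cpx" where
  "tensor_cpx C C' =
     \<lparr>gens = [(i + i', q + q'). (i, q) \<leftarrow> gens C, (i', q') \<leftarrow> gens C'],
      bd = kron (bd C) (1\<^sub>m (rk C')) +
           kron (mat (rk C) (rk C) (\<lambda>(a, b). if a = b then ksign (hdeg C a) else 0)) (bd C')\<rparr>"

text \<open>
  The dual complex in the dual basis, with the sign convention $d\varphi = -(-1)^{|\varphi|} \varphi
  \circ d$ of the Hom complex; $e_i^*$ has homological degree $-|e_i|$.
\<close>

definition dual_cpx :: "'r::comm_ring_1 cpx \<Rightarrow> 'r cpx" where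
  "dual_cpx C =
     \<lparr>gens = map (\<lambda>(i, q). (- i, - q)) (gens C),
      bd = mat (rk C) (rk C) (\<lambda>(j, i). - ksign (hdeg C i) * bd C $$ (i, j))\<rparr>"

section \<open>Cohomology\<close>

definition elements :: "'r::comm_ring_1 grading \<Rightarrow> 'r cpx \<Rightarrow> int \<Rightarrow> int \<Rightarrow> 'r vec set" where
  "elements gr C i q =
     {v \<in> carrier_vec (rk C).
        \<forall>k < rk C. v $ k \<noteq> 0 \<longrightarrow> hdeg C k = i \<and> gr (q - qdeg C k) (v $ k)}"

definition cocycles :: "'r::comm_ring_1 grading \<Rightarrow> 'r cpx \<Rightarrow> int \<Rightarrow> int \<Rightarrow> 'r vec set" where
  "cocycles gr C i q = {v \<in> elements gr C i q. bd C *\<^sub>v v = 0\<^sub>v (rk C)}"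

definition coboundaries :: "'r::comm_ring_1 grading \<Rightarrow> 'r cpx \<Rightarrow> int \<Rightarrow> int \<Rightarrow> 'r vec set" where
  "coboundaries gr C i q = (\<lambda>w. bd C *\<^sub>v w) ` elements gr C (i - 1) q"

definition coh_class :: "'r::comm_ring_1 grading \<Rightarrow> 'r cpx \<Rightarrow> int \<Rightarrow> int \<Rightarrow> 'r vec \<Rightarrow> 'r vec set" where
  "coh_class gr C i q z = {z + b | b. b \<in> coboundaries gr C i q}"

definition cohomology :: "'r::comm_ring_1 grading \<Rightarrow> 'r cpx \<Rightarrow> int \<Rightarrow> int \<Rightarrow> 'r vec set set" where
  "cohomology gr C i q = coh_class gr C i q ` cocycles gr C i q"

definition coh_zero :: "'r::comm_ring_1 grading \<Rightarrow> 'r cpx \<Rightarrow> int \<Rightarrow> int \<Rightarrow> 'r vec set" where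
  "coh_zero gr C i q = coh_class gr C i q (0\<^sub>v (rk C))"

text \<open>
  The class in the cohomology of the target complex \<open>C'\<close> (with grading \<open>gr'\<close>) induced by a map
  \<open>\<phi>\<close> on cochains. When \<open>\<phi>\<close> is an additive bigrading-preserving cochain map, all members of the
  union coincide.
\<close>

definition coh_map ::
    "'s::comm_ring_1 grading \<Rightarrow> 's cpx \<Rightarrow> int \<Rightarrow> int \<Rightarrow> ('r vec \<Rightarrow> 's vec) \<Rightarrow> 'r vec set \<Rightarrow> 's vec set" where
  "coh_map gr' C' i q \<phi> A = (\<Union>z\<in>A. coh_class gr' C' i q (\<phi> z))"

section \<open>Two-reduced LEO triples\<close>

record leo =
  Cz :: "int cpx"
  Dh :: "bit poly cpx"
  fm :: "bit mat"

definition C2 :: "leo \<Rightarrow> bit cpx" where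
  "C2 T = base_change mod2 (Cz T)"

definition D0 :: "leo \<Rightarrow> bit cpx" where
  "D0 T = base_change at_h0 (Dh T)"

definition Dloc :: "leo \<Rightarrow> laurent cpx" where
  "Dloc T = base_change to_loc (Dh T)"

definition leo_triples :: "leo set" where
  "leo_triples =
     {T. is_cpx gr_triv (Cz T) \<and> is_cpx gr_h (Dh T) \<and>
         homotopy_equivalence gr_triv (C2 T) (D0 T) (fm T) \<and>
         (\<exists>q. even q \<and> homotopy_equivalent gr_loc (Dloc T) (rank1 0 q))}"

definition local_map :: "leo \<Rightarrow> leo \<Rightarrow> int mat \<Rightarrow> bit poly mat \<Rightarrow> bool" where
  "local_map T T' \<alpha> \<beta> \<longleftrightarrow>
     chain_map gr_triv (Cz T) (Cz T') \<alpha> \<and>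
     chain_map gr_h (Dh T) (Dh T') \<beta> \<and>
     homotopy_equivalence gr_loc (Dloc T) (Dloc T') (map_mat to_loc \<beta>) \<and>
     homotopic gr_triv (C2 T) (D0 T') (fm T' * map_mat mod2 \<alpha>) (map_mat at_h0 \<beta> * fm T)"

definition local_equiv :: "(leo \<times> leo) set" where
  "local_equiv =
     {(T, T'). T \<in> leo_triples \<and> T' \<in> leo_triples \<and>
        (\<exists>\<alpha> \<beta>. local_map T T' \<alpha> \<beta>) \<and> (\<exists>\<alpha> \<beta>. local_map T' T \<alpha> \<beta>)}"

definition leo_class :: "leo \<Rightarrow> leo set" where
  "leo_class T = local_equiv `` {T}"

definition tensor_leo :: "leo \<Rightarrow> leo \<Rightarrow> leo" where
  "tensor_leo T T' =
     \<lparr>Cz = tensor_cpx (Cz T) (Cz T'), Dh = tensor_cpx (Dh T) (Dh T'), fm = kron (fm T) (fm T')\<rparr>"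

definition unit_leo :: leo where
  "unit_leo = \<lparr>Cz = rank1 0 0, Dh = rank1 0 0, fm = 1\<^sub>m 1\<rparr>"

text \<open>The dual triple formed with the homotopy inverse \<open>g\<close> of \<open>fm T\<close>.\<close>

definition dual_leo :: "leo \<Rightarrow> bit mat \<Rightarrow> leo" where
  "dual_leo T g = \<lparr>Cz = dual_cpx (Cz T), Dh = dual_cpx (Dh T), fm = transpose_mat g\<rparr>"

text \<open>
  The group of local equivalence classes, written multiplicatively as in HOL-Algebra. The product
  of two classes is the union of the classes of all products of representatives.
\<close>

definition LEO_group :: "leo set monoid" where
  "LEO_group =
     \<lparr>carrier = leo_triples // local_equiv,
      mult = (\<lambda>X Y. \<Union>T\<in>X. \<Union>T'\<in>Y. leo_class (tensor_leo T T')),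
      one = leo_class unit_leo\<rparr>"

section \<open>The invariant and the order\<close>

definition oddly_reduced_full :: "leo \<Rightarrow> int \<Rightarrow> bool" where
  "oddly_reduced_full T q \<longleftrightarrow> even q \<and>
     (\<exists>a' \<in> cohomology gr_triv (Cz T) 0 q. \<exists>a \<in> cohomology gr_h (Dh T) 0 q.
        coh_map gr_triv (D0 T) 0 q (\<lambda>v. fm T *\<^sub>v v)
            (coh_map gr_triv (C2 T) 0 q (map_vec mod2) a')
          = coh_map gr_triv (D0 T) 0 q (map_vec at_h0) a \<and>
        coh_map gr_loc (Dloc T) 0 q (map_vec to_loc) a \<noteq> coh_zero gr_loc (Dloc T) 0 q)"

definition s_o :: "leo \<Rightarrow> int" where
  "s_o T = (GREATEST q. oddly_reduced_full T q)"

definition LEO_nonneg :: "leo set \<Rightarrow> bool" where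
  "LEO_nonneg X \<longleftrightarrow> (\<exists>T\<in>X. s_o T \<ge> 0)"

text \<open>Pairs \<open>(X, Y)\<close> with $X \le Y$, that is, $Y - X \ge 0$.\<close>

definition LEO_le :: "(leo set \<times> leo set) set" where
  "LEO_le =
     {(X, Y). X \<in> carrier LEO_group \<and> Y \<in> carrier LEO_group \<and>
        LEO_nonneg (Y \<otimes>\<^bsub>LEO_group\<^esub> inv\<^bsub>LEO_group\<^esub> X)}"

end

theory Submission
  imports Defs
begin

text \<open>
  The order is governed by one relation: say that \<open>T \<le> T'\<close> if there is a local map from \<open>T\<close> to
  \<open>T'\<close>. A pair of classes that exhibits the even integer \<open>q\<close> as oddly reduced-full is the same as a
  local map to the triple from the unit triple shifted to quantum degree \<open>q\<close>
  (\<open>oddly_reduced_full_iff\<close>). Multiplication by $h$ maps the shifted units to each other in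
  decreasing degree; the integral component 0 is compatible with it because $h$ reduces to 0. Hence
  the invariant is at least 0 exactly if the unit maps to the triple, and it depends only on the
  local equivalence class because local maps compose.

  Local equivalence classes form an abelian group: tensor products are strictly associative and
  unital in the chosen bases, the signed swap is a local map, and evaluation and coevaluation are
  local maps between the tensor product of a triple with its dual and the unit. If the unit maps
  both to \<open>T\<close> and to its dual, then tensoring the second map with \<open>T\<close> and evaluating gives a map
  from \<open>T\<close> to the unit, so \<open>T\<close> is trivial. This gives the characterization of the trivial class
  and the antisymmetry of the order.

  Totality is the dichotomy (\<open>local_dichotomy\<close>): every triple receives a map from the unit or has a
  map to the unit. Setting $h = 1$ turns the complex over $F_2[h]$ into a finite complex over $F_2$
  filtered by quantum degree, in which a single class \<open>x\<close> generates the localized homology. Let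
  \<open>S\<close> be the subspace spanned by the coboundaries, the images of the reductions of the integral
  cocycles of bidegree (0,0), and the basis vectors that have nonzero homological degree, positive
  quantum degree or odd quantum degree. If \<open>x\<close> lies in \<open>S\<close>, then subtracting a coboundary leaves a
  cocycle of filtration at least 0 whose leading part is the image of an integral cocycle, which is
  a map from the unit. If \<open>x\<close> does not lie in \<open>S\<close>, then a functional that vanishes on \<open>S\<close> and is 1
  on \<open>x\<close> lifts to a map from the complex over $F_2[h]$ to $F_2[h]$. Its leading part, pulled back to
  the integral side, vanishes on reductions of cocycles. As the integral cocycles form a direct
  summand, such a functional is the reduction of one that vanishes on all integral cocycles
  (\<open>integral_functional_lift\<close>), in particular on coboundaries, so it defines a map to the unit.
\<close>

section \<open>Kronecker products\<close>

lemma mat_mult_entry: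
  assumes "i < dim_row A" "j < dim_col B" "dim_col A = dim_row B"
  shows "(A * B) $$ (i, j) = (\<Sum>k<dim_row B. A $$ (i, k) * B $$ (k, j))"
  using assms by (simp add: scalar_prod_def atLeast0LessThan)

text \<open>
  The laws of matrix algebra with side conditions on dimensions instead of carriers: the simplifier
  discharges these for composite expressions, where carriers would leave the inner dimension unknown.
\<close>

lemma mat_mult_assoc_dim:
  fixes A :: "'a::semiring_0 mat"
  shows "dim_col A = dim_row B \<Longrightarrow> dim_col B = dim_row C \<Longrightarrow> A * B * C = A * (B * C)"
  by (rule assoc_mult_mat[of A "dim_row A" "dim_col A" B "dim_col B" C "dim_col C"]) auto

lemma mat_distrib_dim:
  fixes A :: "'a::ring mat"
  shows
    "dim_row A = dim_row B \<Longrightarrow> dim_col A = dim_col B \<Longrightarrow> dim_col A = dim_row C \<Longrightarrow>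
       (A + B) * C = A * C + B * C"
    "dim_row B = dim_row C \<Longrightarrow> dim_col B = dim_col C \<Longrightarrow> dim_col A = dim_row B \<Longrightarrow>
       A * (B + C) = A * B + A * C"
    "dim_row A = dim_row B \<Longrightarrow> dim_col A = dim_col B \<Longrightarrow> dim_col A = dim_row C \<Longrightarrow>
       (A - B) * C = A * C - B * C"
    "dim_row B = dim_row C \<Longrightarrow> dim_col B = dim_col C \<Longrightarrow> dim_col A = dim_row B \<Longrightarrow>
       A * (B - C) = A * B - A * C"
     apply (rule add_mult_distrib_mat[of _ "dim_row A" "dim_col A" _ _ "dim_col C"]; auto)
    apply (rule mult_add_distrib_mat[of _ "dim_row A" "dim_col A" _ "dim_col C"]; auto)
   apply (rule minus_mult_distrib_mat[of _ "dim_row A" "dim_col A" _ _ "dim_col C"]; auto)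
  apply (rule mult_minus_distrib_mat[of _ "dim_row A" "dim_col A" _ "dim_col C"]; auto)
  done

lemma sum_div_mod:
  fixes F :: "nat \<Rightarrow> nat \<Rightarrow> 'a::comm_monoid_add"
  shows "(\<Sum>k<m * n. F (k div n) (k mod n)) = (\<Sum>i<m. \<Sum>j<n. F i j)"
proof -
  have "(\<Sum>k<m * n. F (k div n) (k mod n)) = (\<Sum>i<m. \<Sum>k=i*n..<i*n+n. F (k div n) (k mod n))"
    by (simp add: sum.nat_group)
  also have "\<dots> = (\<Sum>i<m. \<Sum>j<n. F i j)"
  proof (rule sum.cong[OF refl])
    fix i
    have "(\<Sum>k=i*n..<i*n+n. F (k div n) (k mod n))
        = (\<Sum>j=0..<n. F ((j + i * n) div n) ((j + i * n) mod n))"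
      using sum.shift_bounds_nat_ivl[of "\<lambda>k. F (k div n) (k mod n)" 0 "i * n" n]
      by (simp add: add.commute)
    also have "\<dots> = (\<Sum>j<n. F i j)"
      by (rule sum.cong) auto
    finally show "(\<Sum>k=i*n..<i*n+n. F (k div n) (k mod n)) = (\<Sum>j<n. F i j)" .
  qed
  finally show ?thesis .
qed

lemma double_sum_single:
  fixes F :: "nat \<Rightarrow> nat \<Rightarrow> 'a::comm_monoid_add"
  assumes "a < m" "b < n" and "\<And>i j. \<not> (i = a \<and> j = b) \<Longrightarrow> F i j = 0"
  shows "(\<Sum>i<m. \<Sum>j<n. F i j) = F a b"
proof -
  have "(\<Sum>j<n. F i j) = (if i = a then F a b else 0)" for i
  proof -
    have "(\<Sum>j<n. F i j) = (\<Sum>j<n. if j = b then F i b else 0)"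
      using assms(3) by (intro sum.cong) auto
    then show ?thesis using assms by auto
  qed
  then show ?thesis using assms(1) by simp
qed

lemma double_sum_diagonal:
  fixes F :: "nat \<Rightarrow> nat \<Rightarrow> 'a::comm_monoid_add"
  assumes "\<And>i j. i \<noteq> j \<Longrightarrow> F i j = 0"
  shows "(\<Sum>i<m. \<Sum>j<m. F i j) = (\<Sum>i<m. F i i)"
proof (rule sum.cong[OF refl])
  fix i assume "i \<in> {..<m}"
  moreover have "(\<Sum>j<m. F i j) = (\<Sum>j<m. if j = i then F i i else 0)"
    using assms by (intro sum.cong) auto
  ultimately show "(\<Sum>j<m. F i j) = F i i" by auto
qed

lemma div_mod_less_mult:
  fixes k m n :: nat
  assumes "k < m * n"
  shows "k div n < m" "k mod n < n"
proof -
  have "n > 0" using assms by (cases n) auto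
  then show "k div n < m" "k mod n < n" using assms by (simp_all add: less_mult_imp_div_less)
qed

lemma div_mod_eqI: "i div n = j div n \<Longrightarrow> i mod n = j mod n \<Longrightarrow> i = (j::nat)"
  by (metis div_mod_decomp)

lemma kron_dim [simp]:
  "dim_row (kron A B) = dim_row A * dim_row B"
  "dim_col (kron A B) = dim_col A * dim_col B"
  by (simp_all add: kron_def)

lemma kron_entry:
  "i < dim_row A * dim_row B \<Longrightarrow> j < dim_col A * dim_col B \<Longrightarrow>
   kron A B $$ (i, j) = A $$ (i div dim_row B, j div dim_col B) * B $$ (i mod dim_row B, j mod dim_col B)"
  by (simp add: kron_def)

text \<open>
  The index of a basis tensor encodes a pair by quotient and remainder, so the sum over the middle
  index is a double sum that factors.
\<close>

lemma kron_mult: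
  fixes A :: "'r::comm_ring_1 mat"
  assumes [simp]: "dim_col A = dim_row C" "dim_col B = dim_row D"
  shows "kron A B * kron C D = kron (A * C) (B * D)"
proof (rule eq_matI)
  fix i j assume "i < dim_row (kron (A * C) (B * D))" "j < dim_col (kron (A * C) (B * D))"
  then have ij: "i < dim_row A * dim_row B" "j < dim_col C * dim_col D" by auto
  note b = div_mod_less_mult[OF ij(1)] div_mod_less_mult[OF ij(2)]
  let ?i1 = "i div dim_row B" and ?i2 = "i mod dim_row B"
  let ?j1 = "j div dim_col D" and ?j2 = "j mod dim_col D"
  have "(kron A B * kron C D) $$ (i, j)
      = (\<Sum>k<dim_row C * dim_row D. kron A B $$ (i, k) * kron C D $$ (k, j))"
    using ij by (subst mat_mult_entry) auto
  also have "\<dots> = (\<Sum>k<dim_row C * dim_row D.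
      (A $$ (?i1, k div dim_row D) * B $$ (?i2, k mod dim_row D)) *
      (C $$ (k div dim_row D, ?j1) * D $$ (k mod dim_row D, ?j2)))"
    using ij by (intro sum.cong) (auto simp: kron_entry)
  also have "\<dots> = (\<Sum>k<dim_row C. \<Sum>l<dim_row D.
      (A $$ (?i1, k) * B $$ (?i2, l)) * (C $$ (k, ?j1) * D $$ (l, ?j2)))"
    by (rule sum_div_mod)
  also have "\<dots> = (\<Sum>k<dim_row C. A $$ (?i1, k) * C $$ (k, ?j1)) *
                  (\<Sum>l<dim_row D. B $$ (?i2, l) * D $$ (l, ?j2))"
    by (simp add: sum_product algebra_simps)
  also have "\<dots> = (A * C) $$ (?i1, ?j1) * (B * D) $$ (?i2, ?j2)"
    using b by (simp add: mat_mult_entry del: index_mult_mat(1))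
  also have "\<dots> = kron (A * C) (B * D) $$ (i, j)"
    using ij by (simp add: kron_entry)
  finally show "(kron A B * kron C D) $$ (i, j) = kron (A * C) (B * D) $$ (i, j)" .
qed auto

lemma kron_zero [simp]:
  "kron (0\<^sub>m a b) (B::'r::comm_ring_1 mat) = 0\<^sub>m (a * dim_row B) (b * dim_col B)"
  "kron (B::'r::comm_ring_1 mat) (0\<^sub>m a b) = 0\<^sub>m (dim_row B * a) (dim_col B * b)"
  by (auto simp: kron_entry div_mod_less_mult intro!: eq_matI)

lemma kron_one: "kron (1\<^sub>m a) (1\<^sub>m b :: 'r::comm_ring_1 mat) = 1\<^sub>m (a * b)"
  by (auto simp: kron_entry div_mod_less_mult dest: div_mod_eqI intro!: eq_matI)

lemma kron_add_left:
  fixes A :: "'r::comm_ring_1 mat"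
  shows "dim_row A = dim_row A' \<Longrightarrow> dim_col A = dim_col A' \<Longrightarrow> kron (A + A') B = kron A B + kron A' B"
  by (auto simp: kron_entry div_mod_less_mult algebra_simps intro!: eq_matI)

lemma kron_add_right:
  fixes A :: "'r::comm_ring_1 mat"
  shows "dim_row B = dim_row B' \<Longrightarrow> dim_col B = dim_col B' \<Longrightarrow> kron A (B + B') = kron A B + kron A B'"
  by (auto simp: kron_entry div_mod_less_mult algebra_simps intro!: eq_matI)

lemma kron_minus_left:
  fixes A :: "'r::comm_ring_1 mat"
  shows "dim_row A = dim_row A' \<Longrightarrow> dim_col A = dim_col A' \<Longrightarrow> kron (A - A') B = kron A B - kron A' B"
  by (auto simp: kron_entry div_mod_less_mult algebra_simps intro!: eq_matI)

lemma kron_minus_right: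
  fixes A :: "'r::comm_ring_1 mat"
  shows "dim_row B = dim_row B' \<Longrightarrow> dim_col B = dim_col B' \<Longrightarrow> kron A (B - B') = kron A B - kron A B'"
  by (auto simp: kron_entry div_mod_less_mult algebra_simps intro!: eq_matI)

text \<open>
  Equality on the nose, not up to reindexing: both sides number $e_a \otimes e_b \otimes e_c$ by the
  mixed radix expansion with digits \<open>a\<close>, \<open>b\<close>, \<open>c\<close>.
\<close>

lemma kron_assoc:
  fixes A :: "'r::comm_ring_1 mat"
  shows "kron (kron A B) C = kron A (kron B C)"
proof (rule eq_matI)
  fix i j assume "i < dim_row (kron A (kron B C))" "j < dim_col (kron A (kron B C))"
  then have i: "i < dim_row A * dim_row B * dim_row C" "i < dim_row A * (dim_row B * dim_row C)"
    and j: "j < dim_col A * dim_col B * dim_col C" "j < dim_col A * (dim_col B * dim_col C)"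
    by (auto simp: mult.assoc)
  note b = div_mod_less_mult[OF i(1)] div_mod_less_mult[OF i(2)]
    div_mod_less_mult[OF j(1)] div_mod_less_mult[OF j(2)]
  have dm: "(k div c) div b = k div (b * c)" "(k div c) mod b = (k mod (b * c)) div c"
    "k mod c = (k mod (b * c)) mod c" for k b c :: nat
  proof -
    show "(k div c) div b = k div (b * c)" by (simp add: div_mult2_eq mult.commute[of b c])
    show "k mod c = (k mod (b * c)) mod c" by (simp add: mod_mod_cancel)
    show "(k div c) mod b = (k mod (b * c)) div c"
      by (cases "c = 0") (simp_all add: mult.commute[of b c] mod_mult2_eq)
  qed
  have "kron (kron A B) C $$ (i, j) =
    A $$ (i div dim_row C div dim_row B, j div dim_col C div dim_col B) *
    B $$ (i div dim_row C mod dim_row B, j div dim_col C mod dim_col B) *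
    C $$ (i mod dim_row C, j mod dim_col C)"
    using i j b by (simp add: kron_entry)
  also have "\<dots> = kron A (kron B C) $$ (i, j)"
    unfolding dm(1,2) dm(3)[of i "dim_row C" "dim_row B"] dm(3)[of j "dim_col C" "dim_col B"]
    using i(2) j(2) b by (simp only: kron_entry kron_dim mult.assoc)
  finally show "kron (kron A B) C $$ (i, j) = kron A (kron B C) $$ (i, j)" .
qed (auto simp: mult.assoc)

lemma kron_one1 [simp]: "kron (1\<^sub>m 1) B = (B :: 'r::comm_ring_1 mat)"
  by (rule eq_matI) (auto simp: kron_entry)

lemma kron_one1_right [simp]: "kron B (1\<^sub>m 1) = (B :: 'r::comm_ring_1 mat)"
  by (rule eq_matI) (auto simp: kron_entry)

lemma (in comm_ring_hom) map_mat_kron: "map_mat hom (kron A B) = kron (map_mat hom A) (map_mat hom B)"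
  by (auto simp: kron_entry div_mod_less_mult hom_distribs intro!: eq_matI)

section \<open>Graded rings and graded matrices\<close>

text \<open>
  Axioms for the predicate of homogeneity that make composition, sums, tensor products and duals of
  homogeneous matrices homogeneous.
\<close>

locale graded_ring =
  fixes gr :: "'r::comm_ring_1 grading"
  assumes gr_zero [simp]: "gr q 0"
    and gr_one: "gr 0 1"
    and gr_add: "gr q a \<Longrightarrow> gr q b \<Longrightarrow> gr q (a + b)"
    and gr_uminus: "gr q a \<Longrightarrow> gr q (- a)"
    and gr_mult: "gr q a \<Longrightarrow> gr r b \<Longrightarrow> gr (q + r) (a * b)"

lemma bihom_carrier: "M \<in> bihom gr a b C C' \<Longrightarrow> M \<in> carrier_mat (rk C') (rk C)"
  by (simp add: bihom_def)

lemma bihom_dim: "M \<in> bihom gr a b C C' \<Longrightarrow> dim_row M = rk C'" "M \<in> bihom gr a b C C' \<Longrightarrow> dim_col M = rk C"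
  by (auto simp: bihom_def)

lemma bihom_hdeg:
  "M \<in> bihom gr a b C C' \<Longrightarrow> i < rk C' \<Longrightarrow> j < rk C \<Longrightarrow> M $$ (i, j) \<noteq> 0 \<Longrightarrow> hdeg C' i = hdeg C j + a"
  by (simp add: bihom_def)

lemma bihom_qdeg:
  "M \<in> bihom gr a b C C' \<Longrightarrow> i < rk C' \<Longrightarrow> j < rk C \<Longrightarrow> M $$ (i, j) \<noteq> 0 \<Longrightarrow>
   gr (qdeg C j + b - qdeg C' i) (M $$ (i, j))"
  by (simp add: bihom_def)

lemma bihomI:
  assumes "M \<in> carrier_mat (rk C') (rk C)"
    and "\<And>i j. i < rk C' \<Longrightarrow> j < rk C \<Longrightarrow> M $$ (i, j) \<noteq> 0 \<Longrightarrow>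
      hdeg C' i = hdeg C j + a \<and> gr (qdeg C j + b - qdeg C' i) (M $$ (i, j))"
  shows "M \<in> bihom gr a b C C'"
  using assms by (simp add: bihom_def)

lemma is_cpx_bihom: "is_cpx gr C \<Longrightarrow> bd C \<in> bihom gr 1 0 C C"
  by (simp add: is_cpx_def)

lemma is_cpx_sq: "is_cpx gr C \<Longrightarrow> bd C * bd C = 0\<^sub>m (rk C) (rk C)"
  by (simp add: is_cpx_def)

lemma is_cpx_dim: "is_cpx gr C \<Longrightarrow> dim_row (bd C) = rk C" "is_cpx gr C \<Longrightarrow> dim_col (bd C) = rk C"
  using is_cpx_bihom bihom_dim by metis+

lemma chain_map_bihom: "chain_map gr C C' M \<Longrightarrow> M \<in> bihom gr 0 0 C C'"
  by (simp add: chain_map_def)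

lemma chain_map_comm: "chain_map gr C C' M \<Longrightarrow> bd C' * M = M * bd C"
  by (simp add: chain_map_def)

lemma chain_map_dim: "chain_map gr C C' M \<Longrightarrow> dim_row M = rk C'" "chain_map gr C C' M \<Longrightarrow> dim_col M = rk C"
  using chain_map_bihom bihom_dim by metis+

context graded_ring
begin

lemma gr_sum: "(\<And>k. k \<in> A \<Longrightarrow> gr q (f k)) \<Longrightarrow> gr q (\<Sum>k\<in>A. f k)"
  by (induction A rule: infinite_finite_induct) (auto intro: gr_add)

lemma bihom_qdeg': 
  "M \<in> bihom gr a b C C' \<Longrightarrow> i < rk C' \<Longrightarrow> j < rk C \<Longrightarrow> gr (qdeg C j + b - qdeg C' i) (M $$ (i, j))"
  by (cases "M $$ (i, j) = 0") (auto simp: bihom_def)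

lemma bihom_zero: "0\<^sub>m (rk C') (rk C) \<in> bihom gr a b C C'"
  by (rule bihomI) auto

lemma bihom_one: "1\<^sub>m (rk C) \<in> bihom gr 0 0 C C"
  by (rule bihomI) (auto simp: gr_one split: if_splits)

lemma bihom_add:
  assumes "M \<in> bihom gr a b C C'" "N \<in> bihom gr a b C C'"
  shows "M + N \<in> bihom gr a b C C'"
proof (rule bihomI)
  fix i j assume ij: "i < rk C'" "j < rk C" and "(M + N) $$ (i, j) \<noteq> 0"
  moreover have "(M + N) $$ (i, j) = M $$ (i, j) + N $$ (i, j)"
    using assms ij by (simp add: bihom_dim)
  ultimately show "hdeg C' i = hdeg C j + a \<and> gr (qdeg C j + b - qdeg C' i) ((M + N) $$ (i, j))"
    using assms bihom_hdeg by (metis add_0 bihom_qdeg' gr_add)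
qed (use assms in \<open>simp add: bihom_def\<close>)

lemma bihom_uminus:
  assumes "M \<in> bihom gr a b C C'"
  shows "- M \<in> bihom gr a b C C'"
  using assms by (auto simp: bihom_def gr_uminus)

lemma bihom_mult:
  assumes A: "A \<in> bihom gr a b C' C''" and B: "B \<in> bihom gr a' b' C C'"
  shows "A * B \<in> bihom gr (a + a') (b + b') C C''"
proof (rule bihomI)
  show "A * B \<in> carrier_mat (rk C'') (rk C)"
    using A B by (auto simp: bihom_dim)
  fix i k assume i: "i < rk C''" and k: "k < rk C" and nz: "(A * B) $$ (i, k) \<noteq> 0"
  have e: "(A * B) $$ (i, k) = (\<Sum>j<rk C'. A $$ (i, j) * B $$ (j, k))"
    using A B i k by (subst mat_mult_entry) (auto simp: bihom_dim)
  then obtain j where j: "j < rk C'" "A $$ (i, j) * B $$ (j, k) \<noteq> 0"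
    using nz sum.not_neutral_contains_not_neutral
    by (metis (no_types, lifting) lessThan_iff)
  then have "A $$ (i, j) \<noteq> 0" "B $$ (j, k) \<noteq> 0" by auto
  then have "hdeg C'' i = hdeg C k + (a + a')"
    using bihom_hdeg[OF A i j(1)] bihom_hdeg[OF B j(1) k] by simp
  moreover have "gr (qdeg C k + (b + b') - qdeg C'' i) ((A * B) $$ (i, k))"
    unfolding e
  proof (rule gr_sum)
    fix j assume "j \<in> {..<rk C'}"
    then have "gr ((qdeg C' j + b - qdeg C'' i) + (qdeg C k + b' - qdeg C' j)) (A $$ (i, j) * B $$ (j, k))"
      using A B i k by (intro gr_mult bihom_qdeg') auto
    then show "gr (qdeg C k + (b + b') - qdeg C'' i) (A $$ (i, j) * B $$ (j, k))"
      by (simp add: algebra_simps)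
  qed
  ultimately show "hdeg C'' i = hdeg C k + (a + a') \<and>
    gr (qdeg C k + (b + b') - qdeg C'' i) ((A * B) $$ (i, k))" by blast
qed

lemma bihom_mult00:
  "A \<in> bihom gr a 0 C' C'' \<Longrightarrow> B \<in> bihom gr 0 0 C C' \<Longrightarrow> A * B \<in> bihom gr a 0 C C''"
  "A \<in> bihom gr 0 0 C' C'' \<Longrightarrow> B \<in> bihom gr a 0 C C' \<Longrightarrow> A * B \<in> bihom gr a 0 C C''"
  using bihom_mult[of A a 0 C' C'' B 0 0 C] bihom_mult[of A 0 0 C' C'' B a 0 C] by auto

lemma chain_map_one: "is_cpx gr C \<Longrightarrow> chain_map gr C C (1\<^sub>m (rk C))"
  by (simp add: chain_map_def bihom_one is_cpx_dim)

lemma chain_map_comp: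
  assumes C: "is_cpx gr C" "is_cpx gr C'" "is_cpx gr C''"
    and M: "chain_map gr C' C'' M" and N: "chain_map gr C C' N"
  shows "chain_map gr C C'' (M * N)"
  unfolding chain_map_def
proof
  show "M * N \<in> bihom gr 0 0 C C''" using M N by (blast intro: bihom_mult00 chain_map_bihom)
  note [simp] = is_cpx_dim[OF C(1)] is_cpx_dim[OF C(2)] is_cpx_dim[OF C(3)]
    chain_map_dim[OF M] chain_map_dim[OF N]
  have "bd C'' * (M * N) = (bd C'' * M) * N" by (simp add: mat_mult_assoc_dim)
  also have "\<dots> = M * (bd C' * N)" by (simp add: chain_map_comm[OF M] mat_mult_assoc_dim)
  also have "\<dots> = M * N * bd C" by (simp add: chain_map_comm[OF N] mat_mult_assoc_dim)
  finally show "bd C'' * (M * N) = M * N * bd C" .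
qed

section \<open>Homotopies\<close>

lemma homotopic_refl:
  assumes "is_cpx gr C" "is_cpx gr C'" "chain_map gr C C' M"
  shows "homotopic gr C C' M M"
  unfolding homotopic_def
proof (rule bexI)
  show "M - M = bd C' * 0\<^sub>m (rk C') (rk C) + 0\<^sub>m (rk C') (rk C) * bd C"
    using assms by (auto simp: is_cpx_dim chain_map_dim intro!: eq_matI)
qed (rule bihom_zero)

lemma homotopic_sym:
  assumes C: "is_cpx gr C" "is_cpx gr C'" and M: "dim_row M = rk C'" "dim_col M = rk C"
    and N: "dim_row N = rk C'" "dim_col N = rk C"
    and h: "homotopic gr C C' M N"
  shows "homotopic gr C C' N M"
proof -
  obtain H where H: "H \<in> bihom gr (- 1) 0 C C'" "M - N = bd C' * H + H * bd C"
    using h unfolding homotopic_def by blast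
  note [simp] = is_cpx_dim[OF C(1)] is_cpx_dim[OF C(2)] M N bihom_dim[OF H(1)]
  have "N - M = - (M - N)" by (intro eq_matI) auto
  also have "\<dots> = bd C' * (- H) + (- H) * bd C"
    unfolding H(2) by (intro eq_matI) auto
  finally show ?thesis using H(1) bihom_uminus unfolding homotopic_def by blast
qed

lemma homotopic_trans:
  assumes C: "is_cpx gr C" "is_cpx gr C'" and M: "dim_row M = rk C'" "dim_col M = rk C"
    and N: "dim_row N = rk C'" "dim_col N = rk C" and P: "dim_row P = rk C'" "dim_col P = rk C"
    and h: "homotopic gr C C' M N" "homotopic gr C C' N P"
  shows "homotopic gr C C' M P"
proof -
  obtain H where H: "H \<in> bihom gr (- 1) 0 C C'" "M - N = bd C' * H + H * bd C"
    using h unfolding homotopic_def by blast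
  obtain K where K: "K \<in> bihom gr (- 1) 0 C C'" "N - P = bd C' * K + K * bd C"
    using h unfolding homotopic_def by blast
  note [simp] = is_cpx_dim[OF C(1)] is_cpx_dim[OF C(2)] M N P bihom_dim[OF H(1)] bihom_dim[OF K(1)]
  have "M - P = (M - N) + (N - P)" by (intro eq_matI) auto
  also have "\<dots> = bd C' * (H + K) + (H + K) * bd C"
    unfolding H(2) K(2) by (intro eq_matI) (auto simp: mat_distrib_dim)
  finally show ?thesis using H(1) K(1) bihom_add unfolding homotopic_def by blast
qed

text \<open>
  Composing a homotopy with a chain map on either side is again a homotopy, so homotopy classes of
  chain maps can be composed.
\<close>

lemma homotopic_comp_left:
  assumes C: "is_cpx gr C" "is_cpx gr C'" "is_cpx gr C''"
    and M: "dim_row M = rk C'" "dim_col M = rk C" and N: "dim_row N = rk C'" "dim_col N = rk C"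
    and A: "chain_map gr C' C'' A" and h: "homotopic gr C C' M N"
  shows "homotopic gr C C'' (A * M) (A * N)"
proof -
  obtain H where H: "H \<in> bihom gr (- 1) 0 C C'" "M - N = bd C' * H + H * bd C"
    using h unfolding homotopic_def by blast
  note [simp] = is_cpx_dim[OF C(1)] is_cpx_dim[OF C(2)] is_cpx_dim[OF C(3)] M N bihom_dim[OF H(1)]
    chain_map_dim[OF A]
  have "A * M - A * N = A * (M - N)" by (simp add: mat_distrib_dim)
  also have "\<dots> = (A * bd C') * H + A * H * bd C"
    unfolding H(2) by (simp add: mat_distrib_dim mat_mult_assoc_dim)
  also have "\<dots> = bd C'' * (A * H) + A * H * bd C"
    by (simp add: chain_map_comm[OF A, symmetric] mat_mult_assoc_dim)
  finally show ?thesis using H(1) chain_map_bihom[OF A] bihom_mult00 unfolding homotopic_def by blast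
qed

lemma homotopic_comp_right:
  assumes C: "is_cpx gr C" "is_cpx gr C'" "is_cpx gr B"
    and M: "dim_row M = rk C'" "dim_col M = rk C" and N: "dim_row N = rk C'" "dim_col N = rk C"
    and A: "chain_map gr B C A" and h: "homotopic gr C C' M N"
  shows "homotopic gr B C' (M * A) (N * A)"
proof -
  obtain H where H: "H \<in> bihom gr (- 1) 0 C C'" "M - N = bd C' * H + H * bd C"
    using h unfolding homotopic_def by blast
  note [simp] = is_cpx_dim[OF C(1)] is_cpx_dim[OF C(2)] is_cpx_dim[OF C(3)] M N bihom_dim[OF H(1)]
    chain_map_dim[OF A]
  have "M * A - N * A = (M - N) * A" by (simp add: mat_distrib_dim)
  also have "\<dots> = bd C' * (H * A) + H * (bd C * A)"
    unfolding H(2) by (simp add: mat_distrib_dim mat_mult_assoc_dim)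
  also have "\<dots> = bd C' * (H * A) + (H * A) * bd B"
    by (simp add: chain_map_comm[OF A] mat_mult_assoc_dim)
  finally show ?thesis using H(1) chain_map_bihom[OF A] bihom_mult00 unfolding homotopic_def by blast
qed

lemma homotopy_inverse_comp:
  assumes C: "is_cpx gr C" "is_cpx gr C'" "is_cpx gr C''"
    and M: "chain_map gr C C' M" and N: "chain_map gr C' C'' N"
    and M': "homotopy_inverse gr C C' M M'" and N': "homotopy_inverse gr C' C'' N N'"
  shows "homotopy_inverse gr C C'' (N * M) (M' * N')"
proof -
  have cM': "chain_map gr C' C M'" and cN': "chain_map gr C'' C' N'"
    using M' N' by (auto simp: homotopy_inverse_def)
  note d [simp] = is_cpx_dim[OF C(1)] is_cpx_dim[OF C(2)] is_cpx_dim[OF C(3)] 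
    chain_map_dim[OF M] chain_map_dim[OF N] chain_map_dim[OF cM'] chain_map_dim[OF cN']
  have "homotopic gr C C (M' * ((N' * N) * M)) (M' * (1\<^sub>m (rk C') * M))"
    using N' by (intro homotopic_comp_left[OF C(1,2,1)] homotopic_comp_right[OF C(2,2,1)])
      (auto simp: homotopy_inverse_def M cM')
  then have 1: "homotopic gr C C ((M' * N') * (N * M)) (M' * M)"
    by (simp add: mat_mult_assoc_dim)
  have "homotopic gr C'' C'' (N * ((M * M') * N')) (N * (1\<^sub>m (rk C') * N'))"
    using M' by (intro homotopic_comp_left[OF C(3,2,3)] homotopic_comp_right[OF C(2,2,3)])
      (auto simp: homotopy_inverse_def N cN')
  then have 2: "homotopic gr C'' C'' ((N * M) * (M' * N')) (N * N')"
    by (simp add: mat_mult_assoc_dim)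
  show ?thesis
    unfolding homotopy_inverse_def
    using chain_map_comp[OF C(3,2,1) cM' cN']
      homotopic_trans[OF C(1) C(1) _ _ _ _ _ _ 1, of "1\<^sub>m (rk C)"]
      homotopic_trans[OF C(3) C(3) _ _ _ _ _ _ 2, of "1\<^sub>m (rk C'')"] M' N'
    by (simp add: homotopy_inverse_def)
qed

lemma homotopy_equivalence_comp:
  assumes C: "is_cpx gr C" "is_cpx gr C'" "is_cpx gr C''"
    and M: "homotopy_equivalence gr C C' M" and N: "homotopy_equivalence gr C' C'' N"
  shows "homotopy_equivalence gr C C'' (N * M)"
  using homotopy_inverse_comp[OF C] chain_map_comp[OF C] M N
  unfolding homotopy_equivalence_def by blast

lemma homotopy_equivalence_cong:
  assumes C: "is_cpx gr C" "is_cpx gr C'"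
    and M: "homotopy_equivalence gr C C' M" and N: "chain_map gr C C' N"
    and h: "homotopic gr C C' M N"
  shows "homotopy_equivalence gr C C' N"
proof -
  obtain P where P: "chain_map gr C' C P" "homotopic gr C C (P * M) (1\<^sub>m (rk C))"
    "homotopic gr C' C' (M * P) (1\<^sub>m (rk C'))" and cM: "chain_map gr C C' M"
    using M unfolding homotopy_equivalence_def homotopy_inverse_def by blast
  note [simp] = is_cpx_dim[OF C(1)] is_cpx_dim[OF C(2)] chain_map_dim[OF cM] chain_map_dim[OF N]
    chain_map_dim[OF P(1)]
  have h': "homotopic gr C C' N M"
    by (rule homotopic_sym[OF C]) (auto simp: h)
  have "homotopic gr C C (P * N) (P * M)"
    by (rule homotopic_comp_left[OF C(1,2,1)]) (auto simp: h' P)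
  from homotopic_trans[OF C(1,1) _ _ _ _ _ _ this P(2)]
  have 1: "homotopic gr C C (P * N) (1\<^sub>m (rk C))" by simp
  have "homotopic gr C' C' (N * P) (M * P)"
    by (rule homotopic_comp_right[OF C(1,2,2)]) (auto simp: h' P)
  from homotopic_trans[OF C(2,2) _ _ _ _ _ _ this P(3)]
  have 2: "homotopic gr C' C' (N * P) (1\<^sub>m (rk C'))" by simp
  show ?thesis using 1 2 N P(1) unfolding homotopy_equivalence_def homotopy_inverse_def by blast
qed

lemma homotopy_equivalence_iso:
  assumes C: "is_cpx gr C" "is_cpx gr C'" and M: "chain_map gr C C' M" and N: "chain_map gr C' C N"
    and NM: "N * M = 1\<^sub>m (rk C)" and MN: "M * N = 1\<^sub>m (rk C')"
  shows "homotopy_equivalence gr C C' M"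
  unfolding homotopy_equivalence_def homotopy_inverse_def
  using M N homotopic_refl[OF C(1,1) chain_map_one[OF C(1)]]
    homotopic_refl[OF C(2,2) chain_map_one[OF C(2)]] by (auto simp: NM MN)

end

section \<open>Base change\<close>

locale graded_hom = src: graded_ring gr + tgt: graded_ring gr' + comm_ring_hom hom
  for gr :: "'r::comm_ring_1 grading" and gr' :: "'s::comm_ring_1 grading" and hom :: "'r \<Rightarrow> 's" +
  assumes gr_hom: "gr q a \<Longrightarrow> gr' q (hom a)"

lemma base_change_simps [simp]:
  "rk (base_change \<phi> C) = rk C" "hdeg (base_change \<phi> C) = hdeg C" "qdeg (base_change \<phi> C) = qdeg C"
  "bd (base_change \<phi> C) = map_mat \<phi> (bd C)" "gens (base_change \<phi> C) = gens C"
  by (auto simp: base_change_def rk_def hdeg_def qdeg_def fun_eq_iff)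

context graded_hom
begin

lemma bihom_base_change:
  assumes "M \<in> bihom gr a b C C'"
  shows "map_mat hom M \<in> bihom gr' a b (base_change hom C) (base_change hom C')"
proof (rule bihomI)
  fix i j assume "i < rk (base_change hom C')" "j < rk (base_change hom C)"
    and nz: "map_mat hom M $$ (i, j) \<noteq> 0"
  then have ij: "i < rk C'" "j < rk C" by auto
  then have e: "map_mat hom M $$ (i, j) = hom (M $$ (i, j))" using assms by (simp add: bihom_dim)
  then have "M $$ (i, j) \<noteq> 0" using nz by auto
  then show "hdeg (base_change hom C') i = hdeg (base_change hom C) j + a \<and>
    gr' (qdeg (base_change hom C) j + b - qdeg (base_change hom C') i) (map_mat hom M $$ (i, j))"
    unfolding e using bihom_hdeg[OF assms ij] bihom_qdeg[OF assms ij] by (auto intro: gr_hom)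
qed (use bihom_carrier[OF assms] in auto)

lemma map_mat_mult: "dim_col A = dim_row B \<Longrightarrow> map_mat hom (A * B) = map_mat hom A * map_mat hom B"
  by (rule mat_hom_mult[of A "dim_row A" "dim_col A" B "dim_col B"]) auto

lemma map_mat_add:
  "dim_row A = dim_row B \<Longrightarrow> dim_col A = dim_col B \<Longrightarrow> map_mat hom (A + B) = map_mat hom A + map_mat hom B"
  by (rule eq_matI) (auto simp: hom_distribs)

lemma map_mat_zero: "map_mat hom (0\<^sub>m a b) = 0\<^sub>m a b"
  by (rule eq_matI) auto

lemma is_cpx_base_change: "is_cpx gr C \<Longrightarrow> is_cpx gr' (base_change hom C)"
  using bihom_base_change[of "bd C" 1 0 C C] map_mat_mult[of "bd C" "bd C"]
  by (auto simp: is_cpx_def bihom_dim map_mat_zero)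

lemma chain_map_base_change:
  assumes "is_cpx gr C" "is_cpx gr C'" "chain_map gr C C' M"
  shows "chain_map gr' (base_change hom C) (base_change hom C') (map_mat hom M)"
proof -
  have "map_mat hom (bd C' * M) = map_mat hom (M * bd C)"
    using assms by (simp add: chain_map_def)
  moreover have "M \<in> bihom gr 0 0 C C'" using assms by (simp add: chain_map_def)
  ultimately show ?thesis
    using assms bihom_base_change map_mat_mult[of "bd C'" M] map_mat_mult[of M "bd C"]
    by (simp add: chain_map_def is_cpx_dim bihom_dim)
qed

end

section \<open>Tensor products\<close>

text \<open>
  The operator $x \mapsto (-1)^{|x|} x$. It carries all signs of the tensor differential: it commutes
  with maps of degree 0 and anticommutes with maps of degree 1.
\<close>

definition sign_mat :: "'r::comm_ring_1 cpx \<Rightarrow> 'r mat" where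
  "sign_mat C = mat (rk C) (rk C) (\<lambda>(a, b). if a = b then ksign (hdeg C a) else 0)"

lemma ksign_sq [simp]: "ksign a * ksign a = (1 :: 'r::comm_ring_1)"
  by (simp add: ksign_def)

lemma ksign_sq' [simp]: "ksign a * (ksign a * x) = (x :: 'r::comm_ring_1)"
  by (simp add: ksign_def)

lemma ksign_zero [simp]: "ksign 0 = (1 :: 'r::comm_ring_1)"
  by (simp add: ksign_def)

lemma ksign_add: "ksign (a + b) = ksign a * (ksign b :: 'r::comm_ring_1)"
  by (simp add: ksign_def)

lemma ksign_succ: "ksign (a + 1) = - (ksign a :: 'r::comm_ring_1)"
  by (simp add: ksign_def)

lemma ksign_uminus [simp]: "ksign (- a) = (ksign a :: 'r::comm_ring_1)"
  by (simp add: ksign_def)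

lemma sign_mat_dim [simp]: "dim_row (sign_mat C) = rk C" "dim_col (sign_mat C) = rk C"
  by (simp_all add: sign_mat_def)

lemma sign_mat_entry:
  "a < rk C \<Longrightarrow> b < rk C \<Longrightarrow> sign_mat C $$ (a, b) = (if a = b then ksign (hdeg C a) else 0)"
  by (simp add: sign_mat_def)

lemma sign_mat_mult_entry:
  assumes "i < rk C" "j < dim_col M" "dim_row M = rk C"
  shows "(sign_mat C * M) $$ (i, j) = ksign (hdeg C i) * M $$ (i, j)"
proof -
  have "(sign_mat C * M) $$ (i, j) = (\<Sum>k<rk C. sign_mat C $$ (i, k) * M $$ (k, j))"
    using assms by (subst mat_mult_entry) auto
  also have "\<dots> = (\<Sum>k<rk C. if k = i then ksign (hdeg C i) * M $$ (i, j) else 0)"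
    using assms by (intro sum.cong) (auto simp: sign_mat_entry)
  finally show ?thesis using assms by simp
qed

lemma mult_sign_mat_entry:
  assumes "i < dim_row M" "j < rk C" "dim_col M = rk C"
  shows "(M * sign_mat C) $$ (i, j) = M $$ (i, j) * ksign (hdeg C j)"
proof -
  have "(M * sign_mat C) $$ (i, j) = (\<Sum>k<rk C. M $$ (i, k) * sign_mat C $$ (k, j))"
    using assms by (subst mat_mult_entry) auto
  also have "\<dots> = (\<Sum>k<rk C. if k = j then M $$ (i, j) * ksign (hdeg C j) else 0)"
    using assms by (intro sum.cong) (auto simp: sign_mat_entry)
  finally show ?thesis using assms by simp
qed

lemma sign_mat_comm:
  assumes "M \<in> bihom gr 0 b C C'"
  shows "sign_mat C' * M = M * sign_mat C"
proof (rule eq_matI)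
  fix i j assume "i < dim_row (M * sign_mat C)" "j < dim_col (M * sign_mat C)"
  then have "i < rk C'" "j < rk C" using assms by (auto simp: bihom_dim)
  then show "(sign_mat C' * M) $$ (i, j) = (M * sign_mat C) $$ (i, j)"
    using assms bihom_hdeg[OF assms, of i j]
    by (cases "M $$ (i, j) = 0")
      (auto simp: sign_mat_mult_entry mult_sign_mat_entry bihom_dim simp del: index_mult_mat(1))
qed (use assms in \<open>auto simp: bihom_dim\<close>)

lemma sign_mat_anticomm:
  assumes "M \<in> bihom gr 1 b C C'"
  shows "M * sign_mat C + sign_mat C' * M = 0\<^sub>m (rk C') (rk C)"
proof (rule eq_matI)
  fix i j assume "i < dim_row (0\<^sub>m (rk C') (rk C))" "j < dim_col (0\<^sub>m (rk C') (rk C))"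
  then have ij: "i < rk C'" "j < rk C" by auto
  then have "(M * sign_mat C + sign_mat C' * M) $$ (i, j)
    = (M * sign_mat C) $$ (i, j) + (sign_mat C' * M) $$ (i, j)"
    using assms by (simp add: bihom_dim del: index_mult_mat(1))
  also have "\<dots> = 0"
    using ij assms bihom_hdeg[OF assms, of i j]
    by (cases "M $$ (i, j) = 0")
      (auto simp: sign_mat_mult_entry mult_sign_mat_entry bihom_dim ksign_succ simp del: index_mult_mat(1))
  finally show "(M * sign_mat C + sign_mat C' * M) $$ (i, j) = 0\<^sub>m (rk C') (rk C) $$ (i, j)"
    using ij by simp
qed (use assms in \<open>auto simp: bihom_dim\<close>)

abbreviation product_gens :: "(int \<times> int) list \<Rightarrow> (int \<times> int) list \<Rightarrow> (int \<times> int) list" where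
  "product_gens xs ys \<equiv> [(i + i', q + q'). (i, q) \<leftarrow> xs, (i', q') \<leftarrow> ys]"

lemma nth_product_gens:
  assumes "k < length xs * length ys"
  shows "product_gens xs ys ! k =
    (fst (xs ! (k div length ys)) + fst (ys ! (k mod length ys)),
     snd (xs ! (k div length ys)) + snd (ys ! (k mod length ys)))"
  using assms
proof (induction xs arbitrary: k)
  case (Cons x xs)
  have "length ys > 0" using Cons.prems by (cases ys) auto
  then show ?case
    using Cons.IH[of "k - length ys"] Cons.prems
    by (cases "k < length ys")
      (auto simp: nth_append case_prod_unfold le_div_geq le_mod_geq not_less)
qed auto

lemma length_product_gens:
  "length (product_gens xs ys) = length xs * length ys"
  by (induction xs) (auto simp: case_prod_unfold)

lemma rk_tensor [simp]: "rk (tensor_cpx C C') = rk C * rk C'"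
  using length_product_gens by (simp add: rk_def tensor_cpx_def)

lemma hdeg_tensor:
  "k < rk C * rk C' \<Longrightarrow> hdeg (tensor_cpx C C') k = hdeg C (k div rk C') + hdeg C' (k mod rk C')"
  using nth_product_gens[of k "gens C" "gens C'"] by (simp add: rk_def hdeg_def tensor_cpx_def)

lemma qdeg_tensor:
  "k < rk C * rk C' \<Longrightarrow> qdeg (tensor_cpx C C') k = qdeg C (k div rk C') + qdeg C' (k mod rk C')"
  using nth_product_gens[of k "gens C" "gens C'"] by (simp add: rk_def qdeg_def tensor_cpx_def)

lemma bd_tensor:
  "bd (tensor_cpx C C') = kron (bd C) (1\<^sub>m (rk C')) + kron (sign_mat C) (bd C')"
  by (simp add: tensor_cpx_def sign_mat_def)

lemma sign_mat_tensor:
  "sign_mat (tensor_cpx C C') = kron (sign_mat C) (sign_mat C' :: 'r::comm_ring_1 mat)"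
  by (rule eq_matI)
    (auto simp: sign_mat_entry kron_entry hdeg_tensor div_mod_less_mult ksign_add dest: div_mod_eqI)

text \<open>
  Bidegrees add associatively along the mixed radix numbering, as for \<open>kron_assoc\<close>.
\<close>

lemma product_gens_assoc: "product_gens (product_gens xs ys) zs = product_gens xs (product_gens ys zs)"
proof (rule nth_equalityI)
  let ?n = "length ys" and ?p = "length zs"
  have L: "length (product_gens (product_gens xs ys) zs) = length xs * ?n * ?p"
    unfolding length_product_gens by simp
  have R: "length (product_gens xs (product_gens ys zs)) = length xs * (?n * ?p)"
    unfolding length_product_gens by simp
  show "length (product_gens (product_gens xs ys) zs) = length (product_gens xs (product_gens ys zs))"
    unfolding L R by simp
  fix k assume "k < length (product_gens (product_gens xs ys) zs)"
  then have k: "k < length xs * ?n * ?p" "k < length xs * (?n * ?p)"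
    unfolding L by (auto simp: mult.assoc)
  note b = div_mod_less_mult[OF k(1)] div_mod_less_mult[OF k(2)]
  have d: "(k div ?p) div ?n = k div (?n * ?p)" "(k div ?p) mod ?n = (k mod (?n * ?p)) div ?p"
    "(k mod (?n * ?p)) mod ?p = k mod ?p"
    by (simp_all add: div_mult2_eq mult.commute[of ?n ?p] mod_mod_cancel)
      (cases "?p = 0"; simp add: mod_mult2_eq)
  show "product_gens (product_gens xs ys) zs ! k = product_gens xs (product_gens ys zs) ! k"
    using b k
    by (simp only: nth_product_gens length_product_gens fst_conv snd_conv d add.assoc)
qed

text \<open>
  With strict associativity and strict units, the group of classes needs no associator maps.
\<close>

lemma tensor_cpx_assoc:
  assumes "is_cpx gr A" "is_cpx gr B" "is_cpx gr C"
  shows "tensor_cpx (tensor_cpx A B) C = tensor_cpx A (tensor_cpx B C)"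
proof -
  note [simp] = is_cpx_dim[OF assms(1)] is_cpx_dim[OF assms(2)] is_cpx_dim[OF assms(3)]
  have g: "gens (tensor_cpx (tensor_cpx A B) C) = gens (tensor_cpx A (tensor_cpx B C))"
    using product_gens_assoc[where xs = "gens A" and ys = "gens B" and zs = "gens C"]
    by (simp add: tensor_cpx_def)
  have "bd (tensor_cpx (tensor_cpx A B) C) =
      kron (bd A) (1\<^sub>m (rk B * rk C)) + kron (sign_mat A) (kron (bd B) (1\<^sub>m (rk C)))
      + kron (sign_mat A) (kron (sign_mat B) (bd C))"
    unfolding bd_tensor sign_mat_tensor by (simp add: kron_add_left kron_assoc kron_one)
  also have "\<dots> = bd (tensor_cpx A (tensor_cpx B C))"
    unfolding bd_tensor
    by (subst assoc_add_mat[of _ "rk A * (rk B * rk C)" "rk A * (rk B * rk C)"])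
      (auto simp: kron_add_right)
  finally show ?thesis using g by simp
qed

lemma rank1_simps [simp]:
  "rk (rank1 i q) = 1" "bd (rank1 i q) = 0\<^sub>m 1 1" "gens (rank1 i q) = [(i, q)]"
  "hdeg (rank1 i q) 0 = i" "qdeg (rank1 i q) 0 = q"
  by (simp_all add: rank1_def rk_def hdeg_def qdeg_def)

lemma sign_mat_rank1 [simp]: "sign_mat (rank1 0 q) = 1\<^sub>m 1"
  by (rule eq_matI) (auto simp: sign_mat_entry)

lemma tensor_rank1_left:
  assumes "is_cpx gr C"
  shows "tensor_cpx (rank1 0 0) C = C"
proof -
  have "bd (tensor_cpx (rank1 0 0) C) = bd C"
    unfolding bd_tensor sign_mat_rank1 kron_one1
    using is_cpx_dim[OF assms] by (intro eq_matI) auto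
  moreover have "gens (tensor_cpx (rank1 0 0) C) = gens C"
    by (simp add: tensor_cpx_def)
  ultimately show ?thesis by simp
qed

lemma tensor_rank1_right:
  assumes "is_cpx gr C"
  shows "tensor_cpx C (rank1 0 0) = C"
proof -
  have "bd (tensor_cpx C (rank1 0 0)) = bd C"
    unfolding bd_tensor rank1_simps(1) kron_one1_right
    using is_cpx_dim[OF assms] by (intro eq_matI) auto
  moreover have "concat (map (\<lambda>x. [x]) xs) = xs" for xs :: "(int \<times> int) list" by (induction xs) auto
  then have "gens (tensor_cpx C (rank1 0 0)) = gens C"
    by (simp add: tensor_cpx_def case_prod_unfold)
  ultimately show ?thesis by simp
qed

lemma tensor_rank1_rank1: "tensor_cpx (rank1 0 q) (rank1 0 q') = rank1 0 (q + q')"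
  using kron_one1[of "0\<^sub>m 1 1"] by (simp add: tensor_cpx_def rank1_def rk_def)

context graded_ring
begin

lemma gr_ksign: "gr 0 (ksign a)"
  by (simp add: ksign_def gr_one gr_uminus)

lemma bihom_sign_mat: "sign_mat C \<in> bihom gr 0 0 C C"
  by (rule bihomI) (auto simp: sign_mat_entry gr_ksign split: if_splits)

lemma bihom_kron:
  assumes A: "A \<in> bihom gr a b X X'" and B: "B \<in> bihom gr a' b' Y Y'"
  shows "kron A B \<in> bihom gr (a + a') (b + b') (tensor_cpx X Y) (tensor_cpx X' Y')"
proof (rule bihomI)
  fix i j assume "i < rk (tensor_cpx X' Y')" "j < rk (tensor_cpx X Y)"
    and nz: "kron A B $$ (i, j) \<noteq> 0"
  then have ij: "i < rk X' * rk Y'" "j < rk X * rk Y" by auto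
  note b = div_mod_less_mult[OF ij(1)] div_mod_less_mult[OF ij(2)]
  have e: "kron A B $$ (i, j) =
      A $$ (i div rk Y', j div rk Y) * B $$ (i mod rk Y', j mod rk Y)"
    using A B ij by (simp add: kron_entry bihom_dim)
  then have nz': "A $$ (i div rk Y', j div rk Y) \<noteq> 0" "B $$ (i mod rk Y', j mod rk Y) \<noteq> 0"
    using nz by auto
  from gr_mult[OF bihom_qdeg[OF A b(1) b(3) nz'(1)] bihom_qdeg[OF B b(2) b(4) nz'(2)]]
  show "hdeg (tensor_cpx X' Y') i = hdeg (tensor_cpx X Y) j + (a + a') \<and>
    gr (qdeg (tensor_cpx X Y) j + (b + b') - qdeg (tensor_cpx X' Y') i) (kron A B $$ (i, j))"
    using bihom_hdeg[OF A b(1) b(3) nz'(1)] bihom_hdeg[OF B b(2) b(4) nz'(2)] ij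
    by (simp add: hdeg_tensor qdeg_tensor e algebra_simps)
qed (use A B in \<open>auto simp: bihom_dim\<close>)

lemma bihom_kron00:
  "A \<in> bihom gr a 0 X X' \<Longrightarrow> B \<in> bihom gr 0 0 Y Y' \<Longrightarrow>
     kron A B \<in> bihom gr a 0 (tensor_cpx X Y) (tensor_cpx X' Y')"
  "A \<in> bihom gr 0 0 X X' \<Longrightarrow> B \<in> bihom gr a 0 Y Y' \<Longrightarrow>
     kron A B \<in> bihom gr a 0 (tensor_cpx X Y) (tensor_cpx X' Y')"
  using bihom_kron[of A a 0 X X' B 0 0] bihom_kron[of A 0 0 X X' B a 0] by auto

text \<open>
  In the square of the differential the two mixed terms cancel because the sign operator
  anticommutes with the differential of the first factor.
\<close>

lemma is_cpx_tensor:
  assumes C: "is_cpx gr C" and C': "is_cpx gr C'"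
  shows "is_cpx gr (tensor_cpx C C')"
  unfolding is_cpx_def
proof
  show "bd (tensor_cpx C C') \<in> bihom gr 1 0 (tensor_cpx C C') (tensor_cpx C C')"
    unfolding bd_tensor using C C'
    by (intro bihom_add bihom_kron00 bihom_one bihom_sign_mat is_cpx_bihom)
  note [simp] = is_cpx_dim[OF C] is_cpx_dim[OF C']
  let ?I = "1\<^sub>m (rk C')"
  have "bd (tensor_cpx C C') * bd (tensor_cpx C C') =
      (kron (bd C * bd C) ?I + kron (sign_mat C * bd C) (bd C')) +
      (kron (bd C * sign_mat C) (bd C') + kron (sign_mat C * sign_mat C) (bd C' * bd C'))"
    unfolding bd_tensor by (simp add: mat_distrib_dim kron_mult)
  also have "\<dots> = kron (bd C * sign_mat C) (bd C') + kron (sign_mat C * bd C) (bd C')"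
    unfolding is_cpx_sq[OF C] is_cpx_sq[OF C'] by (intro eq_matI) (auto simp: add.commute)
  also have "\<dots> = kron (bd C * sign_mat C + sign_mat C * bd C) (bd C')"
    by (rule kron_add_left[symmetric]) auto
  also have "\<dots> = 0\<^sub>m (rk (tensor_cpx C C')) (rk (tensor_cpx C C'))"
    unfolding sign_mat_anticomm[OF is_cpx_bihom[OF C]] by simp
  finally show "bd (tensor_cpx C C') * bd (tensor_cpx C C') =
    0\<^sub>m (rk (tensor_cpx C C')) (rk (tensor_cpx C C'))" .
qed

lemma chain_map_kron:
  assumes C: "is_cpx gr X" "is_cpx gr Y" "is_cpx gr X'" "is_cpx gr Y'"
    and A: "chain_map gr X X' A" and B: "chain_map gr Y Y' B"
  shows "chain_map gr (tensor_cpx X Y) (tensor_cpx X' Y') (kron A B)"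
  unfolding chain_map_def
proof
  show "kron A B \<in> bihom gr 0 0 (tensor_cpx X Y) (tensor_cpx X' Y')"
    using A B by (intro bihom_kron00 chain_map_bihom)
  note [simp] = C[THEN is_cpx_dim(1)] C[THEN is_cpx_dim(2)] chain_map_dim[OF A] chain_map_dim[OF B]
  have "bd (tensor_cpx X' Y') * kron A B =
      kron (bd X' * A) B + kron (sign_mat X' * A) (bd Y' * B)"
    unfolding bd_tensor by (simp add: mat_distrib_dim kron_mult)
  also have "\<dots> = kron (A * bd X) B + kron (A * sign_mat X) (B * bd Y)"
    by (simp only: sign_mat_comm[OF chain_map_bihom[OF A]] chain_map_comm[OF A] chain_map_comm[OF B])
  also have "\<dots> = kron A B * bd (tensor_cpx X Y)"
    unfolding bd_tensor by (simp add: mat_distrib_dim kron_mult)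
  finally show "bd (tensor_cpx X' Y') * kron A B = kron A B * bd (tensor_cpx X Y)" .
qed

end

section \<open>Dual complexes\<close>

lemma dual_cpx_simps [simp]:
  "rk (dual_cpx C) = rk C"
  "i < rk C \<Longrightarrow> hdeg (dual_cpx C) i = - hdeg C i"
  "i < rk C \<Longrightarrow> qdeg (dual_cpx C) i = - qdeg C i"
  by (auto simp: dual_cpx_def rk_def hdeg_def qdeg_def case_prod_unfold)

lemma bd_dual_dim [simp]: "dim_row (bd (dual_cpx C)) = rk C" "dim_col (bd (dual_cpx C)) = rk C"
  by (auto simp: dual_cpx_def)

lemma bd_dual_entry:
  "j < rk C \<Longrightarrow> i < rk C \<Longrightarrow> bd (dual_cpx C) $$ (j, i) = - ksign (hdeg C i) * bd C $$ (i, j)"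
  by (auto simp: dual_cpx_def)

lemma dual_rank1: "dual_cpx (rank1 0 q) = (rank1 0 (- q) :: 'r::comm_ring_1 cpx)"
proof -
  have "bd (dual_cpx (rank1 0 q)) = (0\<^sub>m 1 1 :: 'r mat)"
    by (rule eq_matI) (auto simp: bd_dual_entry)
  then show ?thesis by (simp add: dual_cpx_def rank1_def)
qed

context graded_ring
begin

lemma bihom_transpose:
  assumes "M \<in> bihom gr a b C C'"
  shows "transpose_mat M \<in> bihom gr a b (dual_cpx C') (dual_cpx C)"
proof (rule bihomI)
  fix i j assume ij: "i < rk (dual_cpx C)" "j < rk (dual_cpx C')" and nz: "transpose_mat M $$ (i, j) \<noteq> 0"
  then have "M $$ (j, i) \<noteq> 0" "transpose_mat M $$ (i, j) = M $$ (j, i)"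
    using assms by (auto simp: bihom_dim)
  then show "hdeg (dual_cpx C) i = hdeg (dual_cpx C') j + a \<and>
      gr (qdeg (dual_cpx C') j + b - qdeg (dual_cpx C) i) (transpose_mat M $$ (i, j))"
    using assms bihom_hdeg[of M gr a b C C' j i] bihom_qdeg[of M gr a b C C' j i] ij
    by (auto simp: algebra_simps)
qed (use assms in \<open>auto simp: bihom_dim\<close>)

text \<open>
  Each nonzero term of a composite passes through generators of adjacent degree, so the product of the
  two signs is constant and the square is minus the transpose of $d^2$.
\<close>

lemma is_cpx_dual:
  assumes C: "is_cpx gr C"
  shows "is_cpx gr (dual_cpx C)"
  unfolding is_cpx_def
proof
  note d = is_cpx_bihom[OF C]
  show "bd (dual_cpx C) \<in> bihom gr 1 0 (dual_cpx C) (dual_cpx C)"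
  proof (rule bihomI)
    fix j i assume "j < rk (dual_cpx C)" "i < rk (dual_cpx C)" and nz: "bd (dual_cpx C) $$ (j, i) \<noteq> 0"
    then have ij: "i < rk C" "j < rk C" by auto
    then have "bd C $$ (i, j) \<noteq> 0" using nz by (auto simp: bd_dual_entry)
    from bihom_hdeg[OF d ij this]
      gr_mult[OF gr_uminus[OF gr_ksign[of "hdeg C i"]] bihom_qdeg[OF d ij this]]
    show "hdeg (dual_cpx C) j = hdeg (dual_cpx C) i + 1 \<and>
      gr (qdeg (dual_cpx C) i + 0 - qdeg (dual_cpx C) j) (bd (dual_cpx C) $$ (j, i))"
      using ij by (simp add: bd_dual_entry algebra_simps)
  qed auto
  show "bd (dual_cpx C) * bd (dual_cpx C) = 0\<^sub>m (rk (dual_cpx C)) (rk (dual_cpx C))"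
  proof (rule eq_matI)
    fix k i assume "k < dim_row (0\<^sub>m (rk (dual_cpx C)) (rk (dual_cpx C)))"
      "i < dim_col (0\<^sub>m (rk (dual_cpx C)) (rk (dual_cpx C)))"
    then have ki: "k < rk C" "i < rk C" by auto
    have "(bd (dual_cpx C) * bd (dual_cpx C)) $$ (k, i)
        = (\<Sum>j<rk C. bd (dual_cpx C) $$ (k, j) * bd (dual_cpx C) $$ (j, i))"
      using ki by (subst mat_mult_entry) auto
    also have "\<dots> = (\<Sum>j<rk C. - (bd C $$ (i, j) * bd C $$ (j, k)))"
    proof (rule sum.cong[OF refl])
      fix j assume "j \<in> {..<rk C}"
      then have j: "j < rk C" by simp
      show "bd (dual_cpx C) $$ (k, j) * bd (dual_cpx C) $$ (j, i) = - (bd C $$ (i, j) * bd C $$ (j, k))"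
        using bihom_hdeg[OF d ki(2) j] j ki
        by (cases "bd C $$ (i, j) = 0") (auto simp: bd_dual_entry ksign_add ksign_def)
    qed
    also have "\<dots> = - ((bd C * bd C) $$ (i, k))"
      using ki is_cpx_dim[OF C] by (subst mat_mult_entry) (auto simp: sum_negf)
    also have "\<dots> = 0" using ki by (simp add: is_cpx_sq[OF C])
    finally show "(bd (dual_cpx C) * bd (dual_cpx C)) $$ (k, i) =
      0\<^sub>m (rk (dual_cpx C)) (rk (dual_cpx C)) $$ (k, i)" using ki by simp
  qed auto
qed

end

section \<open>Symmetry, evaluation and coevaluation\<close>

text \<open>
  The symmetry $x \otimes y \mapsto (-1)^{|x||y|} y \otimes x$.
\<close>

definition swap_mat :: "'r::comm_ring_1 cpx \<Rightarrow> 'r cpx \<Rightarrow> 'r mat" where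
  "swap_mat C C' = mat (rk C' * rk C) (rk C * rk C')
     (\<lambda>(k, l). if k div rk C = l mod rk C' \<and> k mod rk C = l div rk C'
               then ksign (hdeg C (l div rk C') * hdeg C' (l mod rk C')) else 0)"

text \<open>
  The pairing $x \otimes \varphi \mapsto (-1)^{|x||\varphi|} \varphi(x)$. With the sign convention of the
  dual differential, $\varphi \otimes x \mapsto \varphi(x)$ is a chain map; moving $\varphi$ past $x$ costs
  the sign.
\<close>

definition ev_mat :: "'r::comm_ring_1 cpx \<Rightarrow> 'r mat" where
  "ev_mat C = mat 1 (rk C * rk C)
     (\<lambda>(_, k). if k div rk C = k mod rk C then ksign (hdeg C (k div rk C)) else 0)"

text \<open>
  The element $\sum_i e_i \otimes e_i^*$, as a map from the ground ring. No element is moved past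
  another, so there are no signs.
\<close>

definition coev_mat :: "'r::comm_ring_1 cpx \<Rightarrow> 'r mat" where
  "coev_mat C = mat (rk C * rk C) 1 (\<lambda>(k, _). if k div rk C = k mod rk C then 1 else 0)"

lemma swap_mat_dim [simp]:
  "dim_row (swap_mat C C') = rk C' * rk C" "dim_col (swap_mat C C') = rk C * rk C'"
  by (simp_all add: swap_mat_def)

lemma ev_mat_dim [simp]: "dim_row (ev_mat C) = 1" "dim_col (ev_mat C) = rk C * rk C"
  by (simp_all add: ev_mat_def)

lemma coev_mat_dim [simp]: "dim_row (coev_mat C) = rk C * rk C" "dim_col (coev_mat C) = 1"
  by (simp_all add: coev_mat_def)

lemma kron_swap_entry:
  assumes A: "dim_col A = rk C'" and B: "dim_col B = rk C"
    and k: "k < dim_row A * dim_row B" and l: "l < rk C * rk C'"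
  shows "(kron A B * swap_mat C C') $$ (k, l) =
    A $$ (k div dim_row B, l mod rk C') * B $$ (k mod dim_row B, l div rk C') *
    ksign (hdeg C (l div rk C') * hdeg C' (l mod rk C'))"
proof -
  note b = div_mod_less_mult[OF l]
  let ?s = "ksign (hdeg C (l div rk C') * hdeg C' (l mod rk C')) :: 'a"
  have "(kron A B * swap_mat C C') $$ (k, l)
      = (\<Sum>j<rk C' * rk C. kron A B $$ (k, j) * swap_mat C C' $$ (j, l))"
    using assms by (subst mat_mult_entry) auto
  also have "\<dots> = (\<Sum>j<rk C' * rk C. A $$ (k div dim_row B, j div rk C) * B $$ (k mod dim_row B, j mod rk C) *
      (if j div rk C = l mod rk C' \<and> j mod rk C = l div rk C' then ?s else 0))"
    using assms by (intro sum.cong) (auto simp: kron_entry swap_mat_def)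
  also have "\<dots> = (\<Sum>x<rk C'. \<Sum>y<rk C. A $$ (k div dim_row B, x) * B $$ (k mod dim_row B, y) *
      (if x = l mod rk C' \<and> y = l div rk C' then ?s else 0))"
    by (rule sum_div_mod)
  also have "\<dots> = A $$ (k div dim_row B, l mod rk C') * B $$ (k mod dim_row B, l div rk C') * ?s"
    by (subst double_sum_single[OF b(2) b(1)]) auto
  finally show ?thesis .
qed

lemma swap_kron_entry:
  assumes A: "dim_row A = rk C" and B: "dim_row B = rk C'"
    and k: "k < rk C' * rk C" and l: "l < dim_col A * dim_col B"
  shows "(swap_mat C C' * kron A B) $$ (k, l) =
    ksign (hdeg C (k mod rk C) * hdeg C' (k div rk C)) *
    (A $$ (k mod rk C, l div dim_col B) * B $$ (k div rk C, l mod dim_col B))"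
proof -
  note b = div_mod_less_mult[OF k]
  have "(swap_mat C C' * kron A B) $$ (k, l)
      = (\<Sum>j<rk C * rk C'. swap_mat C C' $$ (k, j) * kron A B $$ (j, l))"
    using assms by (subst mat_mult_entry) auto
  also have "\<dots> = (\<Sum>j<rk C * rk C'. 
      (if k div rk C = j mod rk C' \<and> k mod rk C = j div rk C' then ksign (hdeg C (j div rk C') * hdeg C' (j mod rk C')) else 0) *
      (A $$ (j div rk C', l div dim_col B) * B $$ (j mod rk C', l mod dim_col B)))"
    using assms by (intro sum.cong) (auto simp: kron_entry swap_mat_def)
  also have "\<dots> = (\<Sum>x<rk C. \<Sum>y<rk C'. 
      (if k div rk C = y \<and> k mod rk C = x then ksign (hdeg C x * hdeg C' y) else 0) *
      (A $$ (x, l div dim_col B) * B $$ (y, l mod dim_col B)))"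
    by (rule sum_div_mod)
  also have "\<dots> = ksign (hdeg C (k mod rk C) * hdeg C' (k div rk C)) *
    (A $$ (k mod rk C, l div dim_col B) * B $$ (k div rk C, l mod dim_col B))"
    by (subst double_sum_single[OF b(2) b(1)]) auto
  finally show ?thesis .
qed

text \<open>
  Precomposing the pairing with two linear maps yields the sum over one index, since the pairing
  vanishes off the diagonal.
\<close>

lemma ev_kron_entry:
  assumes A: "dim_row A = rk C" and B: "dim_row B = rk C" and l: "l < dim_col A * dim_col B"
  shows "(ev_mat C * kron A B) $$ (0, l) =
    (\<Sum>a<rk C. ksign (hdeg C a) * (A $$ (a, l div dim_col B) * B $$ (a, l mod dim_col B)))"
proof -
  have "(ev_mat C * kron A B) $$ (0, l) = (\<Sum>j<rk C * rk C. ev_mat C $$ (0, j) * kron A B $$ (j, l))"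
    using assms by (subst mat_mult_entry) auto
  also have "\<dots> = (\<Sum>j<rk C * rk C. (if j div rk C = j mod rk C then ksign (hdeg C (j div rk C)) else 0) *
      (A $$ (j div rk C, l div dim_col B) * B $$ (j mod rk C, l mod dim_col B)))"
    using assms by (intro sum.cong) (auto simp: kron_entry ev_mat_def)
  also have "\<dots> = (\<Sum>x<rk C. \<Sum>y<rk C. (if x = y then ksign (hdeg C x) else 0) *
      (A $$ (x, l div dim_col B) * B $$ (y, l mod dim_col B)))"
    by (rule sum_div_mod)
  finally show ?thesis by (subst (asm) double_sum_diagonal) auto
qed

lemma kron_coev_entry:
  assumes A: "dim_col A = rk C" and B: "dim_col B = rk C" and k: "k < dim_row A * dim_row B"
  shows "(kron A B * coev_mat C) $$ (k, 0) =
    (\<Sum>a<rk C. A $$ (k div dim_row B, a) * B $$ (k mod dim_row B, a))"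
proof -
  have "(kron A B * coev_mat C) $$ (k, 0) = (\<Sum>j<rk C * rk C. kron A B $$ (k, j) * coev_mat C $$ (j, 0))"
    using assms by (subst mat_mult_entry) auto
  also have "\<dots> = (\<Sum>j<rk C * rk C. (A $$ (k div dim_row B, j div rk C) * B $$ (k mod dim_row B, j mod rk C)) *
      (if j div rk C = j mod rk C then 1 else 0))"
    using assms by (intro sum.cong) (auto simp: kron_entry coev_mat_def)
  also have "\<dots> = (\<Sum>x<rk C. \<Sum>y<rk C. (A $$ (k div dim_row B, x) * B $$ (k mod dim_row B, y)) *
      (if x = y then 1 else 0))"
    by (rule sum_div_mod)
  finally show ?thesis by (subst (asm) double_sum_diagonal) auto
qed

lemma swap_swap: "swap_mat C' C * swap_mat C C' = (1\<^sub>m (rk C * rk C') :: 'r::comm_ring_1 mat)"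
proof (rule eq_matI)
  fix k l assume "k < dim_row (1\<^sub>m (rk C * rk C'))" "l < dim_col (1\<^sub>m (rk C * rk C'))"
  then have kl: "k < rk C * rk C'" "l < rk C * rk C'" by auto
  note b = div_mod_less_mult[OF kl(1)] div_mod_less_mult[OF kl(2)]
  have "(swap_mat C' C * swap_mat C C') $$ (k, l) = (\<Sum>j<rk C' * rk C. swap_mat C' C $$ (k, j) * swap_mat C C' $$ (j, l))"
    using kl by (subst mat_mult_entry) auto
  also have "\<dots> = (\<Sum>j<rk C' * rk C.
      (if k div rk C' = j mod rk C \<and> k mod rk C' = j div rk C then ksign (hdeg C' (j div rk C) * hdeg C (j mod rk C)) else 0) *
      (if j div rk C = l mod rk C' \<and> j mod rk C = l div rk C' then ksign (hdeg C (l div rk C') * hdeg C' (l mod rk C')) else 0))"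
    using kl by (intro sum.cong) (auto simp: swap_mat_def)
  also have "\<dots> = (\<Sum>x<rk C'. \<Sum>y<rk C. 
      (if k div rk C' = y \<and> k mod rk C' = x then ksign (hdeg C' x * hdeg C y) else 0) *
      (if x = l mod rk C' \<and> y = l div rk C' then ksign (hdeg C (l div rk C') * hdeg C' (l mod rk C')) else 0))"
    by (rule sum_div_mod)
  also have "\<dots> = (if k = l then 1 else 0)"
    by (subst double_sum_single[OF b(2) b(1)]) (auto simp: mult.commute dest: div_mod_eqI)
  also have "\<dots> = 1\<^sub>m (rk C * rk C') $$ (k, l)"
    using kl by simp
  finally show "(swap_mat C' C * swap_mat C C') $$ (k, l) = (1\<^sub>m (rk C * rk C') :: 'r mat) $$ (k, l)" .
qed auto

lemma mult_if: "x * (if P then y else 0) = (if P then x * y else (0::'a::mult_zero))"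
  by simp

lemma is_cpx_rank1:
  assumes "graded_ring gr"
  shows "is_cpx gr (rank1 i q)"
  unfolding is_cpx_def by (auto intro!: bihomI)

context graded_ring
begin

text \<open>
  Each of the two summands of the differential is matched with one summand on the other side. The
  signs agree because the degree of one factor changes by one where the differential is nonzero.
\<close>

lemma chain_map_swap:
  assumes C: "is_cpx gr C" "is_cpx gr C'"
  shows "chain_map gr (tensor_cpx C C') (tensor_cpx C' C) (swap_mat C C')"
  unfolding chain_map_def
proof
  note [simp] = is_cpx_dim[OF C(1)] is_cpx_dim[OF C(2)]
  show "swap_mat C C' \<in> bihom gr 0 0 (tensor_cpx C C') (tensor_cpx C' C)"
    by (rule bihomI) (auto simp: swap_mat_def hdeg_tensor qdeg_tensor gr_ksign mult.commute[of "rk C'"] split: if_splits)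
  show "bd (tensor_cpx C' C) * swap_mat C C' = swap_mat C C' * bd (tensor_cpx C C')"
  proof (rule eq_matI)
    fix k l assume "k < dim_row (swap_mat C C' * bd (tensor_cpx C C'))"
      "l < dim_col (swap_mat C C' * bd (tensor_cpx C C'))"
    then have k: "k < rk C' * rk C" and l: "l < rk C * rk C'"
      using is_cpx_dim[OF is_cpx_tensor[OF C]] by auto
    note b = div_mod_less_mult[OF k] div_mod_less_mult[OF l]
    let ?k1 = "k div rk C" and ?k2 = "k mod rk C" and ?l1 = "l div rk C'" and ?l2 = "l mod rk C'"
    let ?s = "\<lambda>a b. ksign (hdeg C a * hdeg C' b)"
    have 1: "bd C' $$ (?k1, ?l2) * 1\<^sub>m (rk C) $$ (?k2, ?l1) * ?s ?l1 ?l2 =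
      ?s ?k2 ?k1 * (sign_mat C $$ (?k2, ?l1) * bd C' $$ (?k1, ?l2))"
      using b bihom_hdeg[OF is_cpx_bihom[OF C(2)] b(1) b(4)]
      by (cases "bd C' $$ (?k1, ?l2) = 0") (auto simp: sign_mat_entry ksign_def algebra_simps)
    have 2: "sign_mat C' $$ (?k1, ?l2) * bd C $$ (?k2, ?l1) * ?s ?l1 ?l2 =
      ?s ?k2 ?k1 * (bd C $$ (?k2, ?l1) * 1\<^sub>m (rk C') $$ (?k1, ?l2))"
      using b bihom_hdeg[OF is_cpx_bihom[OF C(1)] b(2) b(3)]
      by (cases "bd C $$ (?k2, ?l1) = 0") (auto simp: sign_mat_entry ksign_def algebra_simps)
    have "(bd (tensor_cpx C' C) * swap_mat C C') $$ (k, l) =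
      (kron (bd C') (1\<^sub>m (rk C)) * swap_mat C C') $$ (k, l) + (kron (sign_mat C') (bd C) * swap_mat C C') $$ (k, l)"
      unfolding bd_tensor using k l by (simp add: mat_distrib_dim del: index_mult_mat(1))
    also have "\<dots> = bd C' $$ (?k1, ?l2) * 1\<^sub>m (rk C) $$ (?k2, ?l1) * ?s ?l1 ?l2 +
      sign_mat C' $$ (?k1, ?l2) * bd C $$ (?k2, ?l1) * ?s ?l1 ?l2"
      using k l by (simp add: kron_swap_entry del: index_mult_mat(1) index_one_mat(1))
    also have "\<dots> = ?s ?k2 ?k1 * (bd C $$ (?k2, ?l1) * 1\<^sub>m (rk C') $$ (?k1, ?l2)) +
      ?s ?k2 ?k1 * (sign_mat C $$ (?k2, ?l1) * bd C' $$ (?k1, ?l2))"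
      unfolding 1 2 by (rule add.commute)
    also have "\<dots> = (swap_mat C C' * kron (bd C) (1\<^sub>m (rk C'))) $$ (k, l) +
        (swap_mat C C' * kron (sign_mat C) (bd C')) $$ (k, l)"
      using k l by (simp add: swap_kron_entry del: index_mult_mat(1) index_one_mat(1))
    also have "\<dots> = (swap_mat C C' * bd (tensor_cpx C C')) $$ (k, l)"
      unfolding bd_tensor using k l by (simp add: mat_distrib_dim del: index_mult_mat(1))
    finally show "(bd (tensor_cpx C' C) * swap_mat C C') $$ (k, l) =
      (swap_mat C C' * bd (tensor_cpx C C')) $$ (k, l)" .
  qed (auto simp: is_cpx_dim[OF is_cpx_tensor[OF C]] is_cpx_dim[OF is_cpx_tensor[OF C(2,1)]])
qed

text \<open>
  The differentials of the two factors contribute the same entry of $d$ with opposite signs.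
\<close>

lemma chain_map_ev:
  assumes C: "is_cpx gr C"
  shows "chain_map gr (tensor_cpx C (dual_cpx C)) (rank1 0 0) (ev_mat C)"
  unfolding chain_map_def
proof
  note [simp] = is_cpx_dim[OF C]
  have b: "k div rk C < rk C" if "k < rk C * rk C" for k using div_mod_less_mult[OF that] by auto
  show "ev_mat C \<in> bihom gr 0 0 (tensor_cpx C (dual_cpx C)) (rank1 0 0)"
    by (rule bihomI) (auto simp: ev_mat_def hdeg_tensor qdeg_tensor gr_ksign div_mod_less_mult split: if_splits)
  have "ev_mat C * bd (tensor_cpx C (dual_cpx C)) = 0\<^sub>m 1 (rk C * rk C)"
  proof (rule eq_matI)
    fix i l assume "i < dim_row (0\<^sub>m 1 (rk C * rk C))" "l < dim_col (0\<^sub>m 1 (rk C * rk C))"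
    then have i: "i = 0" and l: "l < rk C * rk C" by auto
    note b = div_mod_less_mult[OF l]
    let ?l1 = "l div rk C" and ?l2 = "l mod rk C"
    have "(ev_mat C * bd (tensor_cpx C (dual_cpx C))) $$ (0, l) =
      (ev_mat C * kron (bd C) (1\<^sub>m (rk C))) $$ (0, l) + (ev_mat C * kron (sign_mat C) (bd (dual_cpx C))) $$ (0, l)"
      unfolding bd_tensor using l by (simp add: mat_distrib_dim del: index_mult_mat(1))
    also have "(ev_mat C * kron (bd C) (1\<^sub>m (rk C))) $$ (0, l) =
      ksign (hdeg C ?l2) * bd C $$ (?l2, ?l1)"
      using l b by (subst ev_kron_entry) (auto simp: mult_if)
    also have "(ev_mat C * kron (sign_mat C) (bd (dual_cpx C))) $$ (0, l) =
      (\<Sum>a<rk C. if a = ?l1 then - (ksign (hdeg C ?l2) * bd C $$ (?l2, ?l1)) else 0)"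
      using l b by (subst ev_kron_entry, simp, simp, simp, intro sum.cong)
        (auto simp: sign_mat_entry bd_dual_entry)
    also have "\<dots> = - (ksign (hdeg C ?l2) * bd C $$ (?l2, ?l1))"
      using b by simp
    finally show "(ev_mat C * bd (tensor_cpx C (dual_cpx C))) $$ (i, l) = 0\<^sub>m 1 (rk C * rk C) $$ (i, l)"
      using i l by simp
  qed (use is_cpx_dim[OF is_cpx_tensor[OF C is_cpx_dual[OF C]]] in auto)
  then show "bd (rank1 0 0) * ev_mat C = ev_mat C * bd (tensor_cpx C (dual_cpx C))"
    by simp
qed

text \<open>
  The entry of $d$ at $e_a \otimes e_b^*$ arises once from each factor, with opposite signs.
\<close>

lemma chain_map_coev:
  assumes C: "is_cpx gr C"
  shows "chain_map gr (rank1 0 0) (tensor_cpx C (dual_cpx C)) (coev_mat C)"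
  unfolding chain_map_def
proof
  note [simp] = is_cpx_dim[OF C]
  show "coev_mat C \<in> bihom gr 0 0 (rank1 0 0) (tensor_cpx C (dual_cpx C))"
    by (rule bihomI) (auto simp: coev_mat_def hdeg_tensor qdeg_tensor gr_one div_mod_less_mult split: if_splits)
  have "bd (tensor_cpx C (dual_cpx C)) * coev_mat C = 0\<^sub>m (rk C * rk C) 1"
  proof (rule eq_matI)
    fix k j assume "k < dim_row (0\<^sub>m (rk C * rk C) 1)" "j < dim_col (0\<^sub>m (rk C * rk C) 1)"
    then have j: "j = 0" and k: "k < rk C * rk C" by auto
    note b = div_mod_less_mult[OF k]
    let ?k1 = "k div rk C" and ?k2 = "k mod rk C"
    have "(bd (tensor_cpx C (dual_cpx C)) * coev_mat C) $$ (k, 0) =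
      (kron (bd C) (1\<^sub>m (rk C)) * coev_mat C) $$ (k, 0) + (kron (sign_mat C) (bd (dual_cpx C)) * coev_mat C) $$ (k, 0)"
      unfolding bd_tensor using k by (simp add: mat_distrib_dim del: index_mult_mat(1))
    also have "(kron (bd C) (1\<^sub>m (rk C)) * coev_mat C) $$ (k, 0) = bd C $$ (?k1, ?k2)"
      using k b by (subst kron_coev_entry) (auto simp: mult_if)
    also have "(kron (sign_mat C) (bd (dual_cpx C)) * coev_mat C) $$ (k, 0) =
      (\<Sum>a<rk C. if a = ?k1 then - bd C $$ (?k1, ?k2) else 0)"
      using k b by (subst kron_coev_entry, simp, simp, simp, intro sum.cong)
        (auto simp: sign_mat_entry bd_dual_entry)
    also have "\<dots> = - bd C $$ (?k1, ?k2)"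
      using b by simp
    finally show "(bd (tensor_cpx C (dual_cpx C)) * coev_mat C) $$ (k, j) = 0\<^sub>m (rk C * rk C) 1 $$ (k, j)"
      using j k by simp
  qed (use is_cpx_dim[OF is_cpx_tensor[OF C is_cpx_dual[OF C]]] in auto)
  then show "bd (tensor_cpx C (dual_cpx C)) * coev_mat C = coev_mat C * bd (rank1 0 0)"
    by simp
qed

end

section \<open>Characteristic two\<close>

text \<open>
  All homotopies in question live over $F_2$ or over the Laurent ring. There the signs disappear:
  the tensor differential is the plain sum of the two differentials, and the dual differential is the
  transpose.
\<close>

locale graded_ring2 = graded_ring gr for gr :: "'r::comm_ring_1 grading" +
  assumes char2: "1 + 1 = (0::'r)"
begin

lemma double_zero: "x + x = (0::'r)"
  using char2 by (metis mult_2 mult_zero_left one_add_one)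

lemma uminus_char2 [simp]: "- x = (x::'r)"
  using double_zero by (metis minus_unique)

lemma mat_add_twice:
  fixes P :: "'r mat"
  assumes "dim_row P = dim_row Q" "dim_row R = dim_row Q" "dim_col P = dim_col Q" "dim_col R = dim_col Q"
  shows "(P + Q) + (R + Q) = P + R"
proof (rule eq_matI)
  fix i j assume "i < dim_row (P + R)" "j < dim_col (P + R)"
  moreover have "(p + q) + (r + q) = (p + r) + (q + q)" for p q r :: 'r by (simp add: algebra_simps)
  ultimately show "((P + Q) + (R + Q)) $$ (i, j) = (P + R) $$ (i, j)"
    using assms by (simp add: double_zero)
qed (use assms in auto)

lemma ksign_char2 [simp]: "ksign a = (1::'r)"
  by (simp add: ksign_def)

lemma sign_mat_char2: "sign_mat C = (1\<^sub>m (rk C) :: 'r mat)"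
  by (rule eq_matI) (auto simp: sign_mat_entry)

lemma bd_tensor_char2: "bd (tensor_cpx C C') = kron (bd C) (1\<^sub>m (rk C')) + kron (1\<^sub>m (rk C)) (bd C' :: 'r mat)"
  by (simp add: bd_tensor sign_mat_char2)

lemma bd_dual_char2: "is_cpx gr C \<Longrightarrow> bd (dual_cpx C) = transpose_mat (bd C :: 'r mat)"
  by (rule eq_matI) (auto simp: bd_dual_entry is_cpx_dim)

text \<open>
  If \<open>H\<close> is a homotopy and \<open>A\<close> a chain map, then $H \otimes A$ is a homotopy: its two mixed terms
  coincide because \<open>A\<close> commutes with the differentials, and hence cancel.
\<close>

lemma homotopic_kron_left:
  assumes C: "is_cpx gr X" "is_cpx gr Y" "is_cpx gr X'" "is_cpx gr Y'"
    and M: "dim_row M = rk X'" "dim_col M = rk X" and N: "dim_row N = rk X'" "dim_col N = rk X"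
    and A: "chain_map gr Y Y' A" and h: "homotopic gr X X' M N"
  shows "homotopic gr (tensor_cpx X Y) (tensor_cpx X' Y') (kron M A) (kron N A)"
proof -
  obtain H where H: "H \<in> bihom gr (- 1) 0 X X'" "M - N = bd X' * H + H * bd X"
    using h unfolding homotopic_def by blast
  note [simp] = C[THEN is_cpx_dim(1)] C[THEN is_cpx_dim(2)] M N bihom_dim[OF H(1)] chain_map_dim[OF A]
  have "kron M A - kron N A = kron (M - N) A" by (simp add: kron_minus_left)
  also have "\<dots> = (kron (bd X' * H) A + kron H (bd Y' * A)) + (kron (H * bd X) A + kron H (A * bd Y))"
    unfolding H(2) chain_map_comm[OF A]
    by (simp add: kron_add_left mat_add_twice)
  also have "\<dots> = bd (tensor_cpx X' Y') * kron H A + kron H A * bd (tensor_cpx X Y)"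
    unfolding bd_tensor_char2 by (simp add: mat_distrib_dim kron_mult)
  finally show ?thesis
    unfolding homotopic_def using bihom_kron00(1)[OF H(1) chain_map_bihom[OF A]] by blast
qed

lemma homotopic_kron_right:
  assumes C: "is_cpx gr X" "is_cpx gr Y" "is_cpx gr X'" "is_cpx gr Y'"
    and M: "dim_row M = rk Y'" "dim_col M = rk Y" and N: "dim_row N = rk Y'" "dim_col N = rk Y"
    and A: "chain_map gr X X' A" and h: "homotopic gr Y Y' M N"
  shows "homotopic gr (tensor_cpx X Y) (tensor_cpx X' Y') (kron A M) (kron A N)"
proof -
  obtain H where H: "H \<in> bihom gr (- 1) 0 Y Y'" "M - N = bd Y' * H + H * bd Y"
    using h unfolding homotopic_def by blast
  note [simp] = C[THEN is_cpx_dim(1)] C[THEN is_cpx_dim(2)] M N bihom_dim[OF H(1)] chain_map_dim[OF A]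
  have "kron A M - kron A N = kron A (M - N)" by (simp add: kron_minus_right)
  also have "\<dots> = (kron (bd X' * A) H + kron A (bd Y' * H)) + (kron (A * bd X) H + kron A (H * bd Y))"
    unfolding H(2) chain_map_comm[OF A]
    by (subst comm_add_mat[of "kron (A * bd X) H" "rk X' * rk Y'" "rk X * rk Y"], auto simp: kron_add_right)
      (subst comm_add_mat[of "kron (A * bd X) H" "rk X' * rk Y'" "rk X * rk Y"], auto simp: mat_add_twice)
  also have "\<dots> = bd (tensor_cpx X' Y') * kron A H + kron A H * bd (tensor_cpx X Y)"
    unfolding bd_tensor_char2 by (simp add: mat_distrib_dim kron_mult)
  finally show ?thesis
    unfolding homotopic_def using bihom_kron00(2)[OF chain_map_bihom[OF A] H(1)] by blast
qed

lemma homotopic_kron: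
  assumes C: "is_cpx gr X" "is_cpx gr Y" "is_cpx gr X'" "is_cpx gr Y'"
    and M: "chain_map gr X X' M" and N: "chain_map gr X X' N"
    and P: "chain_map gr Y Y' P" and Q: "chain_map gr Y Y' Q"
    and h: "homotopic gr X X' M N" "homotopic gr Y Y' P Q"
  shows "homotopic gr (tensor_cpx X Y) (tensor_cpx X' Y') (kron M P) (kron N Q)"
proof -
  note d = chain_map_dim[OF M] chain_map_dim[OF N] chain_map_dim[OF P] chain_map_dim[OF Q]
  show ?thesis
    using homotopic_trans[OF is_cpx_tensor[OF C(1,2)] is_cpx_tensor[OF C(3,4)] _ _ _ _ _ _
        homotopic_kron_left[OF C _ _ _ _ P h(1)] homotopic_kron_right[OF C _ _ _ _ N h(2)]]
    by (simp add: d)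
qed

lemma homotopy_inverse_kron:
  assumes C: "is_cpx gr X" "is_cpx gr Y" "is_cpx gr X'" "is_cpx gr Y'"
    and M: "chain_map gr X X' M" and N: "chain_map gr Y Y' N"
    and M': "homotopy_inverse gr X X' M M'" and N': "homotopy_inverse gr Y Y' N N'"
  shows "homotopy_inverse gr (tensor_cpx X Y) (tensor_cpx X' Y') (kron M N) (kron M' N')"
proof -
  have c: "chain_map gr X' X M'" "chain_map gr Y' Y N'"
    and h: "homotopic gr X X (M' * M) (1\<^sub>m (rk X))" "homotopic gr X' X' (M * M') (1\<^sub>m (rk X'))"
      "homotopic gr Y Y (N' * N) (1\<^sub>m (rk Y))" "homotopic gr Y' Y' (N * N') (1\<^sub>m (rk Y'))"
    using M' N' by (auto simp: homotopy_inverse_def)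
  note [simp] = chain_map_dim[OF M] chain_map_dim[OF N] chain_map_dim[OF c(1)] chain_map_dim[OF c(2)]
  show ?thesis
    unfolding homotopy_inverse_def
    using chain_map_kron[OF C(3,4,1,2) c]
      homotopic_kron[OF C(1,2,1,2) chain_map_comp[OF C(1,3,1) c(1) M] chain_map_one[OF C(1)]
        chain_map_comp[OF C(2,4,2) c(2) N] chain_map_one[OF C(2)] h(1,3)]
      homotopic_kron[OF C(3,4,3,4) chain_map_comp[OF C(3,1,3) M c(1)] chain_map_one[OF C(3)]
        chain_map_comp[OF C(4,2,4) N c(2)] chain_map_one[OF C(4)] h(2,4)]
    by (simp add: kron_mult kron_one)
qed

lemma homotopy_equivalence_kron:
  assumes C: "is_cpx gr X" "is_cpx gr Y" "is_cpx gr X'" "is_cpx gr Y'"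
    and M: "homotopy_equivalence gr X X' M" and N: "homotopy_equivalence gr Y Y' N"
  shows "homotopy_equivalence gr (tensor_cpx X Y) (tensor_cpx X' Y') (kron M N)"
  using homotopy_inverse_kron[OF C] chain_map_kron[OF C] M N
  unfolding homotopy_equivalence_def by blast

lemma homotopic_transpose:
  assumes C: "is_cpx gr C" "is_cpx gr C'"
    and M: "dim_row M = rk C'" "dim_col M = rk C" and N: "dim_row N = rk C'" "dim_col N = rk C"
    and h: "homotopic gr C C' M N"
  shows "homotopic gr (dual_cpx C') (dual_cpx C) (transpose_mat M) (transpose_mat N)"
proof -
  obtain H where H: "H \<in> bihom gr (- 1) 0 C C'" "M - N = bd C' * H + H * bd C"
    using h unfolding homotopic_def by blast
  note [simp] = C[THEN is_cpx_dim(1)] C[THEN is_cpx_dim(2)] M N bihom_dim[OF H(1)]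
  have [simp]: "bd C \<in> carrier_mat (rk C) (rk C)" "bd C' \<in> carrier_mat (rk C') (rk C')"
    "H \<in> carrier_mat (rk C') (rk C)" by auto
  have "transpose_mat M - transpose_mat N = transpose_mat (M - N)"
    by (intro eq_matI) auto
  also have "\<dots> = transpose_mat H * transpose_mat (bd C') + transpose_mat (bd C) * transpose_mat H"
  proof -
    have "bd C' * H \<in> carrier_mat (rk C') (rk C)" "H * bd C \<in> carrier_mat (rk C') (rk C)" by auto
    from transpose_add[OF this] show ?thesis
      unfolding H(2)
      by (simp add: transpose_mult[of _ "rk C'" "rk C'" _ "rk C"] transpose_mult[of _ "rk C'" "rk C" _ "rk C"])
  qed
  also have "\<dots> = bd (dual_cpx C) * transpose_mat H + transpose_mat H * bd (dual_cpx C')"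
    unfolding bd_dual_char2[OF C(1)] bd_dual_char2[OF C(2)]
    by (rule comm_add_mat[of _ "rk C" "rk C'"]) auto
  finally show ?thesis unfolding homotopic_def using bihom_transpose[OF H(1)] by blast
qed

lemma chain_map_transpose:
  assumes C: "is_cpx gr C" "is_cpx gr C'" and M: "chain_map gr C C' M"
  shows "chain_map gr (dual_cpx C') (dual_cpx C) (transpose_mat M)"
proof -
  note [simp] = C[THEN is_cpx_dim(1)] C[THEN is_cpx_dim(2)] chain_map_dim[OF M]
  have [simp]: "bd C \<in> carrier_mat (rk C) (rk C)" "bd C' \<in> carrier_mat (rk C') (rk C')"
    "M \<in> carrier_mat (rk C') (rk C)" by auto
  have "transpose_mat (bd C' * M) = transpose_mat (M * bd C)" by (simp add: chain_map_comm[OF M])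
  then have "transpose_mat M * transpose_mat (bd C') = transpose_mat (bd C) * transpose_mat M"
    by (simp add: transpose_mult[of _ "rk C'" "rk C'" _ "rk C"] transpose_mult[of _ "rk C'" "rk C" _ "rk C"])
  then show ?thesis
    unfolding chain_map_def using bihom_transpose[OF chain_map_bihom[OF M]]
    by (simp add: bd_dual_char2[OF C(1)] bd_dual_char2[OF C(2)])
qed

lemma homotopy_inverse_transpose:
  assumes C: "is_cpx gr C" "is_cpx gr C'" and M: "chain_map gr C C' M"
    and N: "homotopy_inverse gr C C' M N"
  shows "homotopy_inverse gr (dual_cpx C) (dual_cpx C') (transpose_mat N) (transpose_mat M)"
proof -
  have c: "chain_map gr C' C N" and h: "homotopic gr C C (N * M) (1\<^sub>m (rk C))"
      "homotopic gr C' C' (M * N) (1\<^sub>m (rk C'))"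
    using N by (auto simp: homotopy_inverse_def)
  note [simp] = chain_map_dim[OF M] chain_map_dim[OF c]
  have [simp]: "M \<in> carrier_mat (rk C') (rk C)" "N \<in> carrier_mat (rk C) (rk C')" by auto
  show ?thesis
    unfolding homotopy_inverse_def
    using chain_map_transpose[OF C M] homotopic_transpose[OF C(1,1) _ _ _ _ h(1)]
      homotopic_transpose[OF C(2,2) _ _ _ _ h(2)]
    by (simp add: transpose_mult[of _ "rk C'" "rk C" _ "rk C'"] transpose_mult[of _ "rk C" "rk C'" _ "rk C"])
qed

text \<open>
  Transposition moves a map from the dual factor to the other one: both sides pair $x \otimes \varphi$
  to $\varphi(B A x)$. This reduces statements about evaluation to the composite of a map with its
  homotopy inverse.
\<close>

lemma ev_dinatural:
  assumes A: "A \<in> carrier_mat (rk C') (rk C)" and B: "B \<in> carrier_mat (rk C) (rk C')"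
  shows "ev_mat C' * kron A (transpose_mat B) = ev_mat C * (kron (B * A) (1\<^sub>m (rk C)) :: 'r mat)"
proof (rule eq_matI)
  fix i l assume "i < dim_row (ev_mat C * kron (B * A) (1\<^sub>m (rk C)))"
    "l < dim_col (ev_mat C * (kron (B * A) (1\<^sub>m (rk C))))"
  then have i: "i = 0" and l: "l < rk C * rk C" using A by auto
  note b = div_mod_less_mult[OF l]
  have "(ev_mat C' * kron A (transpose_mat B)) $$ (0, l) =
    (\<Sum>a<rk C'. B $$ (l mod rk C, a) * A $$ (a, l div rk C))"
    using A B l b by (subst ev_kron_entry) (auto simp: mult.commute intro!: sum.cong)
  also have "\<dots> = (B * A) $$ (l mod rk C, l div rk C)"
    using A B l b by (subst mat_mult_entry) auto
  also have "\<dots> = (\<Sum>a<rk C. if a = l mod rk C then (B * A) $$ (a, l div rk C) else 0)"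
    using b by simp
  also have "\<dots> = (ev_mat C * kron (B * A) (1\<^sub>m (rk C))) $$ (0, l)"
    using A B l b by (subst ev_kron_entry) (auto simp: mult_if simp del: index_mult_mat(1))
  finally show "(ev_mat C' * kron A (transpose_mat B)) $$ (i, l) = (ev_mat C * kron (B * A) (1\<^sub>m (rk C))) $$ (i, l)"
    using i by simp
qed (use A B in auto)

lemma coev_dinatural:
  assumes A: "A \<in> carrier_mat (rk C') (rk C)" and B: "B \<in> carrier_mat (rk C) (rk C')"
  shows "kron A (transpose_mat B) * coev_mat C = (kron (A * B) (1\<^sub>m (rk C')) :: 'r mat) * coev_mat C'"
proof (rule eq_matI)
  fix k j assume "k < dim_row ((kron (A * B) (1\<^sub>m (rk C')) :: 'r mat) * coev_mat C')"
    "j < dim_col ((kron (A * B) (1\<^sub>m (rk C')) :: 'r mat) * coev_mat C')"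
  then have j: "j = 0" and k: "k < rk C' * rk C'" using A by auto
  note b = div_mod_less_mult[OF k]
  have "(kron A (transpose_mat B) * coev_mat C) $$ (k, 0) =
    (\<Sum>a<rk C. A $$ (k div rk C', a) * B $$ (a, k mod rk C'))"
    using A B k b by (subst kron_coev_entry) (auto intro!: sum.cong)
  also have "\<dots> = (A * B) $$ (k div rk C', k mod rk C')"
    using A B k b by (subst mat_mult_entry) auto
  also have "\<dots> = (\<Sum>a<rk C'. if a = k mod rk C' then (A * B) $$ (k div rk C', a) else 0)"
    using b by simp
  also have "\<dots> = (kron (A * B) (1\<^sub>m (rk C')) * coev_mat C') $$ (k, 0)"
    using A B k b by (subst kron_coev_entry) (auto simp: mult_if simp del: index_mult_mat(1))
  finally show "(kron A (transpose_mat B) * coev_mat C) $$ (k, j) = (kron (A * B) (1\<^sub>m (rk C')) * coev_mat C') $$ (k, j)"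
    using j by simp
qed (use A B in auto)

lemma swap_natural:
  assumes A: "A \<in> carrier_mat (rk X') (rk X)" and B: "B \<in> carrier_mat (rk Y') (rk Y)"
  shows "swap_mat X' Y' * kron A B = kron B A * (swap_mat X Y :: 'r mat)"
proof (rule eq_matI)
  fix k l assume "k < dim_row (kron B A * swap_mat X Y)" "l < dim_col (kron B A * swap_mat X Y)"
  then have kl: "k < rk Y' * rk X'" "l < rk X * rk Y" using A B by auto
  show "(swap_mat X' Y' * kron A B) $$ (k, l) = (kron B A * swap_mat X Y) $$ (k, l)"
    using A B kl by (simp add: swap_kron_entry kron_swap_entry mult.commute del: index_mult_mat(1))
qed (use A B in auto)

end

section \<open>Base change of tensor products and dual complexes\<close>

lemma (in comm_ring_hom) hom_ksign: "hom (ksign a) = ksign a"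
  by (simp add: ksign_def hom_distribs)

lemma (in comm_ring_hom) base_change_tensor:
  assumes C: "is_cpx gr C" "is_cpx gr C'"
  shows "base_change hom (tensor_cpx C C') = tensor_cpx (base_change hom C) (base_change hom C')"
proof -
  note [simp] = is_cpx_dim[OF C(1)] is_cpx_dim[OF C(2)]
  have s: "map_mat hom (sign_mat C) = sign_mat (base_change hom C)"
    by (rule eq_matI) (auto simp: sign_mat_entry hom_ksign)
  have "map_mat hom (bd (tensor_cpx C C')) = bd (tensor_cpx (base_change hom C) (base_change hom C'))"
    unfolding bd_tensor base_change_simps s[symmetric] mat_hom_one[symmetric] map_mat_kron[symmetric]
    by (rule eq_matI) (auto simp: hom_distribs)
  then show ?thesis by (simp add: base_change_def tensor_cpx_def)
qed

lemma (in comm_ring_hom) base_change_dual: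
  assumes C: "is_cpx gr C"
  shows "base_change hom (dual_cpx C) = dual_cpx (base_change hom C)"
proof -
  have "map_mat hom (bd (dual_cpx C)) = bd (dual_cpx (base_change hom C))"
    using is_cpx_dim[OF C] by (intro eq_matI) (auto simp: bd_dual_entry hom_ksign hom_distribs)
  then show ?thesis by (simp add: base_change_def dual_cpx_def)
qed

lemma (in comm_ring_hom) base_change_rank1: "base_change hom (rank1 i q) = rank1 i q"
proof -
  have "map_mat hom (0\<^sub>m 1 1) = 0\<^sub>m 1 1" by (rule eq_matI) auto
  then show ?thesis by (simp add: base_change_def rank1_def)
qed

lemma (in comm_ring_hom) map_mat_swap:
  "map_mat hom (swap_mat C C') = swap_mat (base_change hom C) (base_change hom C')"
  by (rule eq_matI) (auto simp: swap_mat_def hom_ksign)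

lemma (in comm_ring_hom) map_mat_ev: "map_mat hom (ev_mat C) = ev_mat (base_change hom C)"
  by (rule eq_matI) (auto simp: ev_mat_def hom_ksign)

lemma (in comm_ring_hom) map_mat_coev: "map_mat hom (coev_mat C) = coev_mat (base_change hom C)"
  by (rule eq_matI) (auto simp: coev_mat_def)

section \<open>The coefficient rings\<close>

lemma graded_ring_triv: "graded_ring (gr_triv :: 'r::comm_ring_1 grading)"
  by unfold_locales (auto simp: gr_triv_def)

interpretation triv_int: graded_ring "gr_triv :: int grading"
  by (rule graded_ring_triv)

interpretation triv_bit: graded_ring2 "gr_triv :: bit grading"
  by (intro graded_ring2.intro graded_ring_triv) (simp add: graded_ring2_axioms_def)

interpretation poly_h: graded_ring gr_h
proof
  fix q r :: int and a b :: "bit poly"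
  show "gr_h q 0" by (simp add: gr_h_def)
  show "gr_h 0 1" unfolding gr_h_def by (intro disjI2 exI[of _ 0]) (simp add: one_poly_eq_simps)
  have neg: "- p = p" for p :: "bit poly" by (rule poly_eqI) simp
  have dbl: "p + p = 0" for p :: "bit poly" using neg[of p] by (metis add.right_inverse)
  show "gr_h q (a + b)" if "gr_h q a" "gr_h q b"
    using that by (auto simp: gr_h_def dbl)
  show "gr_h q (- a)" if "gr_h q a"
    using that by (simp only: neg)
  show "gr_h (q + r) (a * b)" if "gr_h q a" "gr_h r b"
    using that unfolding gr_h_def by (elim disjE exE) (auto simp: mult_monom intro!: exI[of _ "_ + _"])
qed

interpretation laurent: graded_ring2 gr_loc
proof
  fix q r :: int and a b :: laurent
  show "gr_loc q 0" by (simp add: gr_loc_def)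
  show "gr_loc 0 1" unfolding gr_loc_def by (intro disjI2 exI[of _ 0]) simp
  have neg: "- p = p" for p :: laurent by (rule poly_mapping_eqI) simp
  have dbl: "p + p = 0" for p :: laurent using neg[of p] by (metis add.right_inverse)
  show "1 + 1 = (0::laurent)" by (rule dbl)
  show "gr_loc q (a + b)" if "gr_loc q a" "gr_loc q b"
    using that by (auto simp: gr_loc_def dbl)
  show "gr_loc q (- a)" if "gr_loc q a"
    using that by (simp only: neg)
  show "gr_loc (q + r) (a * b)" if "gr_loc q a" "gr_loc r b"
    using that unfolding gr_loc_def by (elim disjE exE) (auto simp: mult_single intro!: exI[of _ "_ + _"])
qed

interpretation mod2: graded_hom gr_triv gr_triv mod2
  by unfold_locales (auto simp: mod2_def gr_triv_def)

interpretation at_h0: graded_hom gr_h gr_triv at_h0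
  by unfold_locales (auto simp: at_h0_def gr_triv_def gr_h_def coeff_mult_0 split: if_splits)

lemma lookup_to_loc: "Poly_Mapping.lookup (to_loc p) z = (if z \<ge> 0 then coeff p (nat z) else 0)"
proof -
  have "Poly_Mapping.lookup (to_loc p) z = (\<Sum>k\<le>degree p. if int k = z then coeff p k else 0)"
    unfolding to_loc_def by (simp add: lookup_sum lookup_single when_def)
  also have "\<dots> = (if z \<ge> 0 then coeff p (nat z) else 0)"
  proof (cases "z \<ge> 0")
    case True
    then have "(\<Sum>k\<le>degree p. if int k = z then coeff p k else 0) =
        (\<Sum>k\<le>degree p. if k = nat z then coeff p (nat z) else 0)"
      by (intro sum.cong) auto
    then show ?thesis using True by (auto simp: coeff_eq_0)
  qed auto
  finally show ?thesis .
qed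

lemma to_loc_add: "to_loc (p + q) = to_loc p + to_loc q"
  by (rule poly_mapping_eqI) (simp add: lookup_to_loc lookup_add)

lemma to_loc_monom: "to_loc (monom c k) = Poly_Mapping.single (int k) c"
  by (rule poly_mapping_eqI) (auto simp: lookup_to_loc lookup_single when_def)

lemma to_loc_mult: "to_loc (p * q) = to_loc p * to_loc q"
proof -
  have zero: "to_loc 0 = 0" by (rule poly_mapping_eqI) (simp add: lookup_to_loc)
  have sum: "to_loc (sum f A) = (\<Sum>x\<in>A. to_loc (f x))" for f :: "nat \<Rightarrow> bit poly" and A
    by (induction A rule: infinite_finite_induct) (auto simp: to_loc_add zero)
  have "p * q = (\<Sum>i\<le>degree p. monom (coeff p i) i) * (\<Sum>j\<le>degree q. monom (coeff q j) j)"
    by (simp add: poly_as_sum_of_monoms)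
  also have "\<dots> = (\<Sum>i\<le>degree p. \<Sum>j\<le>degree q. monom (coeff p i * coeff q j) (i + j))"
    by (simp add: sum_product mult_monom)
  finally have "to_loc (p * q) =
      (\<Sum>i\<le>degree p. \<Sum>j\<le>degree q. Poly_Mapping.single (int (i + j)) (coeff p i * coeff q j))"
    by (simp add: sum to_loc_monom)
  also have "\<dots> = to_loc p * to_loc q"
    by (simp add: to_loc_def sum_product mult_single)
  finally show ?thesis .
qed

interpretation to_loc: graded_hom gr_h gr_loc to_loc
proof unfold_locales
  show "to_loc 1 = 1"
    using to_loc_monom[of 1 0] unfolding monom_eq_1 by simp
  show "to_loc 0 = 0" by (rule poly_mapping_eqI) (simp add: lookup_to_loc)
  show "gr_loc q (to_loc a)" if "gr_h q a" for q a
    using that by (auto simp: gr_h_def gr_loc_def to_loc_monom simp flip: \<open>to_loc 0 = 0\<close>)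
qed (simp_all add: to_loc_add to_loc_mult)

text \<open>
  Setting $h = 1$ forgets only the grading: a homogeneous element of known degree is determined by its
  value there. So graded complexes over $F_2[h]$ become complexes over $F_2$ filtered by quantum degree.
\<close>

definition at_h1 :: "bit poly \<Rightarrow> bit" where
  "at_h1 p = poly p 1"

definition loc_h1 :: "(int \<Rightarrow>\<^sub>0 'r::comm_ring_1) \<Rightarrow> 'r" where
  "loc_h1 p = (\<Sum>k\<in>Poly_Mapping.keys p. Poly_Mapping.lookup p k)"

lemma loc_h1_superset: "finite A \<Longrightarrow> Poly_Mapping.keys p \<subseteq> A \<Longrightarrow> loc_h1 p = (\<Sum>k\<in>A. Poly_Mapping.lookup p k)"
  unfolding loc_h1_def by (rule sum.mono_neutral_left) (auto simp: in_keys_iff)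

lemma loc_h1_add: "loc_h1 (p + q) = loc_h1 p + loc_h1 q"
  for p q :: "int \<Rightarrow>\<^sub>0 'r::comm_ring_1"
proof -
  have "loc_h1 p = (\<Sum>k\<in>Poly_Mapping.keys p \<union> Poly_Mapping.keys q. Poly_Mapping.lookup p k)" "loc_h1 q = (\<Sum>k\<in>Poly_Mapping.keys p \<union> Poly_Mapping.keys q. Poly_Mapping.lookup q k)"
    "loc_h1 (p + q) = (\<Sum>k\<in>Poly_Mapping.keys p \<union> Poly_Mapping.keys q. Poly_Mapping.lookup (p + q) k)"
    by (rule loc_h1_superset; simp add: keys_add)+
  then show ?thesis by (simp add: lookup_add sum.distrib)
qed

lemma loc_h1_single [simp]: "loc_h1 (Poly_Mapping.single k c) = c"
  by (simp add: loc_h1_def)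

lemma laurent_sum_single: "p = (\<Sum>k\<in>Poly_Mapping.keys p. Poly_Mapping.single k (Poly_Mapping.lookup p k))"
  for p :: "int \<Rightarrow>\<^sub>0 'r::comm_ring_1"
proof (rule poly_mapping_eqI)
  fix z
  have "(\<Sum>k\<in>Poly_Mapping.keys p. if k = z then Poly_Mapping.lookup p k else 0) = Poly_Mapping.lookup p z"
    by (simp add: in_keys_iff)
  then show "Poly_Mapping.lookup p z = Poly_Mapping.lookup (\<Sum>k\<in>Poly_Mapping.keys p. Poly_Mapping.single k (Poly_Mapping.lookup p k)) z"
    by (simp add: lookup_sum lookup_single when_def)
qed

lemma comm_ring_hom_loc_h1: "comm_ring_hom (loc_h1 :: (int \<Rightarrow>\<^sub>0 'r::comm_ring_1) \<Rightarrow> 'r)"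
proof
  show zero: "loc_h1 0 = (0::'r)" and "loc_h1 1 = (1::'r)"
    using loc_h1_single[of 0 "1::'r"] by (simp_all add: loc_h1_def)
  show "loc_h1 (p + q) = loc_h1 p + loc_h1 q" for p q :: "int \<Rightarrow>\<^sub>0 'r" by (rule loc_h1_add)
  have sum: "loc_h1 (sum f A) = (\<Sum>x\<in>A. loc_h1 (f x))" for f :: "int \<Rightarrow> (int \<Rightarrow>\<^sub>0 'r)" and A
    using zero by (induction A rule: infinite_finite_induct) (auto simp: loc_h1_add)
  fix p q :: "int \<Rightarrow>\<^sub>0 'r"
  have "p * q = (\<Sum>k\<in>Poly_Mapping.keys p. \<Sum>l\<in>Poly_Mapping.keys q.
      Poly_Mapping.single (k + l) (Poly_Mapping.lookup p k * Poly_Mapping.lookup q l))"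
    by (subst laurent_sum_single[of p], subst laurent_sum_single[of q]) (simp add: sum_product mult_single)
  then have "loc_h1 (p * q) = (\<Sum>k\<in>Poly_Mapping.keys p. \<Sum>l\<in>Poly_Mapping.keys q.
      Poly_Mapping.lookup p k * Poly_Mapping.lookup q l)"
    by (simp only: sum loc_h1_single)
  then show "loc_h1 (p * q) = loc_h1 p * loc_h1 q"
    by (simp only: sum_product loc_h1_def)
qed

interpretation loc_h1: comm_ring_hom "loc_h1 :: laurent \<Rightarrow> bit"
  by (rule comm_ring_hom_loc_h1)

interpretation at_h1: comm_ring_hom at_h1
  by unfold_locales (auto simp: at_h1_def)

lemma loc_h1_to_loc: "loc_h1 (to_loc p) = at_h1 p"
proof -
  have sum: "loc_h1 (sum f A) = (\<Sum>x\<in>A. loc_h1 (f x))" for f :: "nat \<Rightarrow> laurent" and A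
    by (rule loc_h1.hom_sum)
  show ?thesis by (simp only: to_loc_def sum loc_h1_single at_h1_def poly_altdef power_one mult_1_right)
qed

text \<open>
  The Laurent ring is a graded field.
\<close>

lemma gr_loc_unit: "gr_loc q a \<Longrightarrow> a \<noteq> 0 \<Longrightarrow> \<exists>b. gr_loc (- q) b \<and> a * b = 1"
  unfolding gr_loc_def
  by (elim disjE exE) (auto simp: mult_single intro!: exI[of _ "Poly_Mapping.single (- k) 1" for k])

lemma gr_loc_even: "gr_loc q a \<Longrightarrow> a \<noteq> 0 \<Longrightarrow> even q"
  by (auto simp: gr_loc_def)

section \<open>Lifting and separating functionals\<close>

text \<open>
  A functional \<open>x\<close> on a lattice that is even on a subgroup \<open>K\<close> agrees modulo 2 with one that vanishes
  on \<open>K\<close>, provided that \<open>2 u \<in> K\<close> implies \<open>u \<in> K\<close>. The proof eliminates one coordinate at a time: a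
  vector \<open>v\<close> of \<open>K\<close> with an odd coordinate \<open>i\<close> reduces the claim to the vectors of \<open>K\<close> with coordinate
  \<open>i\<close> equal to 0. Scaling their functional by the odd number \<open>v i\<close> does not change it modulo 2 and
  makes room to choose the coefficient at \<open>i\<close> so that the result vanishes on \<open>v\<close>. If there is no such
  \<open>v\<close>, then \<open>K\<close> is closed under halving, hence zero.
\<close>

lemma integral_functional_lift:
  fixes K :: "('a \<Rightarrow> int) set" and x :: "'a \<Rightarrow> int"
  assumes "finite I"
    and "\<And>u i. u \<in> K \<Longrightarrow> i \<notin> I \<Longrightarrow> u i = 0"
    and "\<And>u v a b. u \<in> K \<Longrightarrow> v \<in> K \<Longrightarrow> (\<lambda>i. a * u i + b * v i) \<in> K"
    and "\<And>u. (\<lambda>i. 2 * u i) \<in> K \<Longrightarrow> u \<in> K"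
    and "\<And>u. u \<in> K \<Longrightarrow> even (\<Sum>i\<in>I. x i * u i)"
  shows "\<exists>y. (\<forall>i. even (y i - x i)) \<and> (\<forall>u\<in>K. (\<Sum>i\<in>I. y i * u i) = 0)"
  using assms
proof (induction I arbitrary: K rule: finite_psubset_induct)
  case (psubset I K)
  note fin = psubset.hyps and supp = psubset.prems(1) and comb = psubset.prems(2)
    and half = psubset.prems(3) and ev = psubset.prems(4)
  show ?case
  proof (cases "\<exists>v\<in>K. \<exists>i. odd (v i)")
    case True
    then obtain v i where v: "v \<in> K" "odd (v i)" by blast
    then have i: "i \<in> I" using supp by force
    let ?J = "I - {i}" and ?L = "{u \<in> K. u i = 0}"
    have split: "(\<Sum>j\<in>I. f j) = f i + (\<Sum>j\<in>?J. f j)" for f :: "'a \<Rightarrow> int"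
      using fin i by (simp add: sum.remove)
    have "\<exists>y. (\<forall>j. even (y j - x j)) \<and> (\<forall>u\<in>?L. (\<Sum>j\<in>?J. y j * u j) = 0)"
    proof (rule psubset.IH)
      show "?J \<subset> I" using i by blast
      show "u j = 0" if "u \<in> ?L" "j \<notin> ?J" for u j using that supp by (cases "j = i") auto
      show "(\<lambda>j. a * u j + b * w j) \<in> ?L" if "u \<in> ?L" "w \<in> ?L" for u w a b
        using that comb by auto
      show "u \<in> ?L" if "(\<lambda>j. 2 * u j) \<in> ?L" for u using that half by auto
      show "even (\<Sum>j\<in>?J. x j * u j)" if "u \<in> ?L" for u
        using that ev[of u] split[of "\<lambda>j. x j * u j"] by auto
    qed
    then obtain y where y: "\<And>j. even (y j - x j)" "\<And>u. u \<in> ?L \<Longrightarrow> (\<Sum>j\<in>?J. y j * u j) = 0"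
      by blast
    \<comment> \<open>The coefficient at \<open>i\<close> is forced by vanishing on \<open>v\<close> after scaling the others by \<open>v i\<close>.\<close>
    define z where "z = (\<lambda>j. if j = i then - (\<Sum>j\<in>?J. y j * v j) else v i * y j)"
    have "even (z j - x j)" for j
    proof (cases "j = i")
      case True
      have "(\<Sum>j\<in>?J. y j * v j) = (\<Sum>j\<in>?J. (y j - x j) * v j) + (\<Sum>j\<in>?J. x j * v j)"
        by (simp add: sum.distrib[symmetric] algebra_simps)
      moreover have "even (\<Sum>j\<in>?J. (y j - x j) * v j)"
        using y(1) by (intro dvd_sum) auto
      moreover have "even (x i * v i + (\<Sum>j\<in>?J. x j * v j))"
        using ev[OF v(1)] split[of "\<lambda>j. x j * v j"] by simp
      ultimately show ?thesis using v(2) True by (auto simp: z_def)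
    next
      case False
      have "v i * y j - x j = v i * (y j - x j) + (v i - 1) * x j" by (simp add: algebra_simps)
      then show ?thesis using y(1)[of j] v(2) False by (simp add: z_def)
    qed
    moreover have "(\<Sum>j\<in>I. z j * u j) = 0" if u: "u \<in> K" for u
    proof -
      have "(\<lambda>j. v i * u j + (- u i) * v j) \<in> ?L" using comb[OF u v(1), of "v i" "- u i"] by (simp add: mult.commute[of "v i" "u i"])
      from y(2)[OF this] have "0 = (\<Sum>j\<in>?J. y j * (v i * u j + (- u i) * v j))" by (rule sym)
      also have "\<dots> = (\<Sum>j\<in>?J. v i * y j * u j) - u i * (\<Sum>j\<in>?J. y j * v j)"
        by (simp add: algebra_simps sum_subtractf sum_distrib_left)
      also have "\<dots> = (\<Sum>j\<in>?J. z j * u j) + z i * u i"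
        by (simp add: z_def)
      finally show ?thesis by (simp add: split)
    qed
    ultimately show ?thesis by blast
  next
    case False
    have "u j = 0" if "u \<in> K" for u j
      using that
    proof (induction "nat \<bar>u j\<bar>" arbitrary: u rule: less_induct)
      case less
      have "even (u k)" for k using False less.prems by blast
      then have "(\<lambda>k. 2 * (u k div 2)) \<in> K" using less.prems by simp
      then have "(\<lambda>k. u k div 2) \<in> K" using half[of "\<lambda>k. u k div 2"] by simp
      moreover obtain w where w: "u j = 2 * w" using \<open>even (u j)\<close> by (elim evenE)
      ultimately have "u j \<noteq> 0 \<Longrightarrow> w = 0"
        using less.hyps[of "\<lambda>k. u k div 2"] by (simp add: abs_mult)
      then show ?case using w by auto
    qed
    then show ?thesis by (intro exI[of _ x] conjI allI ballI sum.neutral) simp_all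
  qed
qed

text \<open>
  A subspace of a finite-dimensional coordinate space is the common kernel of functionals. The proof
  eliminates a pivot coordinate of a nonzero vector of the subspace.
\<close>

lemma separating_functional:
  fixes S :: "('a \<Rightarrow> 'f::field) set"
  assumes "finite I"
    and "\<And>u i. u \<in> S \<Longrightarrow> i \<notin> I \<Longrightarrow> u i = 0"
    and "(\<lambda>_. 0) \<in> S"
    and "\<And>u v c. u \<in> S \<Longrightarrow> v \<in> S \<Longrightarrow> (\<lambda>i. u i + c * v i) \<in> S"
    and "\<And>i. i \<notin> I \<Longrightarrow> x i = 0"
    and "x \<notin> S"
  shows "\<exists>y. (\<forall>u\<in>S. (\<Sum>i\<in>I. y i * u i) = 0) \<and> (\<Sum>i\<in>I. y i * x i) = 1"
  using assms
proof (induction I arbitrary: S x rule: finite_psubset_induct)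
  case (psubset I S x)
  note fin = psubset.hyps and supp = psubset.prems(1) and zero = psubset.prems(2)
    and comb = psubset.prems(3) and suppx = psubset.prems(4) and x = psubset.prems(5)
  show ?case
  proof (cases "\<exists>s\<in>S. \<exists>i. s i \<noteq> 0")
    case True
    then obtain s i where s: "s \<in> S" "s i \<noteq> 0" by blast
    then have i: "i \<in> I" using supp by force
    let ?J = "I - {i}" and ?L = "{u \<in> S. u i = 0}"
    define r where "r = (\<lambda>u j. u j + (- (u i / s i)) * s j)"
    have split: "(\<Sum>j\<in>I. f j) = f i + (\<Sum>j\<in>?J. f j)" for f :: "'a \<Rightarrow> 'f"
      using fin i by (simp add: sum.remove)
    have ri: "r u i = 0" for u using s(2) by (simp add: r_def)
    have rL: "r u \<in> ?L" if "u \<in> S" for u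
      using comb[OF that s(1), of "- (u i / s i)"] ri[of u] by (simp add: r_def)
    have "\<exists>y. (\<forall>u\<in>?L. (\<Sum>j\<in>?J. y j * u j) = 0) \<and> (\<Sum>j\<in>?J. y j * r x j) = 1"
    proof (rule psubset.IH)
      show "?J \<subset> I" using i by blast
      show "u j = 0" if "u \<in> ?L" "j \<notin> ?J" for u j using that supp by (cases "j = i") auto
      show "(\<lambda>_. 0) \<in> ?L" using zero by simp
      show "(\<lambda>j. u j + c * w j) \<in> ?L" if "u \<in> ?L" "w \<in> ?L" for u w c
        using that comb by auto
      show "r x j = 0" if "j \<notin> ?J" for j
        using that suppx[of j] supp[OF s(1), of j] ri[of x] by (cases "j = i") (auto simp: r_def)
      show "r x \<notin> ?L"
      proof
        assume "r x \<in> ?L"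
        then have "(\<lambda>j. r x j + (x i / s i) * s j) \<in> S" using comb s(1) by blast
        moreover have "(\<lambda>j. r x j + (x i / s i) * s j) = x" by (simp add: r_def fun_eq_iff)
        ultimately show False using x by simp
      qed
    qed
    then obtain y where y: "\<And>u. u \<in> ?L \<Longrightarrow> (\<Sum>j\<in>?J. y j * u j) = 0" "(\<Sum>j\<in>?J. y j * r x j) = 1"
      by blast
    define z where "z = (\<lambda>j. if j = i then - (\<Sum>j\<in>?J. y j * s j) / s i else y j)"
    have z: "(\<Sum>j\<in>I. z j * u j) = (\<Sum>j\<in>?J. y j * r u j)" for u
    proof -
      have "(\<Sum>j\<in>?J. y j * r u j) = (\<Sum>j\<in>?J. y j * u j) - (u i / s i) * (\<Sum>j\<in>?J. y j * s j)"
        by (simp add: r_def algebra_simps sum_subtractf sum_distrib_left)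
      also have "\<dots> = (\<Sum>j\<in>?J. z j * u j) + z i * u i" by (simp add: z_def)
      finally show ?thesis by (simp add: split)
    qed
    show ?thesis
      using y rL by (intro exI[of _ z]) (simp add: z)
  next
    case False
    obtain i where i: "x i \<noteq> 0"
    proof (rule ccontr)
      assume "\<not> thesis"
      then have "x = (\<lambda>_. 0)" using that by (auto simp: fun_eq_iff)
      then show False using x zero by simp
    qed
    then have "i \<in> I" using suppx by blast
    then have "(\<Sum>j\<in>I. (if j = i then 1 / x i else 0) * x j) = 1"
      using i fin by (simp add: if_distrib[of "\<lambda>t. t * _"] cong: if_cong)
    then show ?thesis using False
      by (intro exI[of _ "\<lambda>j. if j = i then 1 / x i else 0"]) auto
  qed
qed

section \<open>Local maps\<close>

definition unit_at :: "int \<Rightarrow> leo" where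
  "unit_at q = \<lparr>Cz = rank1 0 q, Dh = rank1 0 q, fm = 1\<^sub>m 1\<rparr>"

lemma unit_leo_eq: "unit_leo = unit_at 0"
  by (simp add: unit_leo_def unit_at_def)

lemma leo_simps [simp]:
  "rk (C2 T) = rk (Cz T)" "rk (D0 T) = rk (Dh T)" "rk (Dloc T) = rk (Dh T)"
  by (simp_all add: C2_def D0_def Dloc_def)

lemma unit_at_simps [simp]:
  "Cz (unit_at q) = rank1 0 q" "Dh (unit_at q) = rank1 0 q" "fm (unit_at q) = 1\<^sub>m 1"
  "C2 (unit_at q) = rank1 0 q" "D0 (unit_at q) = rank1 0 q" "Dloc (unit_at q) = rank1 0 q"
  by (simp_all add: unit_at_def C2_def D0_def Dloc_def mod2.base_change_rank1 at_h0.base_change_rank1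
      to_loc.base_change_rank1)

text \<open>
  Homotopy inverse maps between the localized complex and a free module of rank one. The composite on
  the rank one module is equal to the identity, not only homotopic to it, since its differential
  vanishes.
\<close>

definition loc_splitting :: "leo \<Rightarrow> int \<Rightarrow> laurent mat \<Rightarrow> laurent mat \<Rightarrow> bool" where
  "loc_splitting T q M N \<longleftrightarrow> even q \<and> chain_map gr_loc (Dloc T) (rank1 0 q) M \<and>
     homotopy_inverse gr_loc (Dloc T) (rank1 0 q) M N \<and> M * N = 1\<^sub>m 1"

lemma leo_is_cpx:
  assumes "T \<in> leo_triples"
  shows "is_cpx gr_triv (Cz T)" "is_cpx gr_h (Dh T)" "is_cpx gr_triv (C2 T)"
    "is_cpx gr_triv (D0 T)" "is_cpx gr_loc (Dloc T)"
  using assms by (auto simp: leo_triples_def C2_def D0_def Dloc_def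
      mod2.is_cpx_base_change at_h0.is_cpx_base_change to_loc.is_cpx_base_change)

lemma leo_fm:
  assumes "T \<in> leo_triples"
  shows "homotopy_equivalence gr_triv (C2 T) (D0 T) (fm T)" "chain_map gr_triv (C2 T) (D0 T) (fm T)"
  using assms by (auto simp: leo_triples_def homotopy_equivalence_def)

lemma (in graded_ring) homotopic_rank1_eq:
  assumes "homotopic gr (rank1 i q) (rank1 i' q') A B"
    and "A \<in> carrier_mat 1 1" "B \<in> carrier_mat 1 1"
  shows "A = B"
proof -
  obtain H where "H \<in> bihom gr (- 1) 0 (rank1 i q) (rank1 i' q')"
      "A - B = 0\<^sub>m 1 1 * H + H * 0\<^sub>m 1 1"
    using assms by (auto simp: homotopic_def)
  then have "A - B = 0\<^sub>m 1 1" by (simp add: bihom_dim)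
  then have "(A - B) $$ (i, j) = 0" if "i < 1" "j < 1" for i j using that by simp
  then show ?thesis using assms(2,3) by (intro eq_matI) auto
qed

lemma loc_splitting_exists:
  assumes "T \<in> leo_triples"
  shows "\<exists>q M N. loc_splitting T q M N"
proof -
  obtain q M N where q: "even q" "chain_map gr_loc (Dloc T) (rank1 0 q) M"
      "homotopy_inverse gr_loc (Dloc T) (rank1 0 q) M N"
    using assms by (auto simp: leo_triples_def homotopy_equivalent_def homotopy_equivalence_def)
  then have "homotopic gr_loc (rank1 0 q) (rank1 0 q) (M * N) (1\<^sub>m 1)" "chain_map gr_loc (rank1 0 q) (Dloc T) N"
    by (auto simp: homotopy_inverse_def)
  then have "M * N = 1\<^sub>m 1"
    using q(2) by (intro laurent.homotopic_rank1_eq) (auto simp: chain_map_dim)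
  then show ?thesis using q unfolding loc_splitting_def by blast
qed

lemma loc_splittingD:
  assumes "loc_splitting T q M N"
  shows "even q" "chain_map gr_loc (Dloc T) (rank1 0 q) M" "chain_map gr_loc (rank1 0 q) (Dloc T) N"
    "M * N = 1\<^sub>m 1" "homotopic gr_loc (Dloc T) (Dloc T) (N * M) (1\<^sub>m (rk (Dh T)))"
    "dim_row M = 1" "dim_col M = rk (Dh T)" "dim_row N = rk (Dh T)" "dim_col N = 1"
  using assms by (auto simp: loc_splitting_def homotopy_inverse_def chain_map_dim)

lemma is_cpx_rank1_all [simp]: "is_cpx gr_triv (rank1 i q)" "is_cpx gr_h (rank1 i q)" "is_cpx gr_loc (rank1 i q)"
  by (auto intro!: is_cpx_rank1 graded_ring_triv poly_h.graded_ring_axioms laurent.graded_ring_axioms)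

lemma loc_splitting_unit_at: "even q \<Longrightarrow> loc_splitting (unit_at q) q (1\<^sub>m 1) (1\<^sub>m 1)"
  using laurent.chain_map_one[of "rank1 0 q"] laurent.homotopic_refl[of "rank1 0 q" "rank1 0 q" "1\<^sub>m 1"]
  by (simp add: loc_splitting_def homotopy_inverse_def)

lemma mult_1x1_eq_one:
  fixes A B :: "'r::comm_ring_1 mat"
  assumes "dim_row A = 1" "dim_col A = 1" "dim_row B = 1" "dim_col B = 1" "A $$ (0, 0) * B $$ (0, 0) = 1"
  shows "A * B = 1\<^sub>m 1"
  using assms by (intro eq_matI) (auto simp: mat_mult_entry simp del: index_mult_mat(1))

text \<open>
  After localization, a chain map between complexes of rank one up to homotopy is a single homogeneous
  Laurent polynomial, and nonzero ones are units. So the condition on the second component of a local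
  map is that one entry is nonzero.
\<close>

lemma loc_equivalence_iff:
  assumes T: "T \<in> leo_triples" "T' \<in> leo_triples"
    and s: "loc_splitting T q M N" and s': "loc_splitting T' q' M' N'"
    and B: "chain_map gr_loc (Dloc T) (Dloc T') B"
  shows "homotopy_equivalence gr_loc (Dloc T) (Dloc T') B \<longleftrightarrow> (M' * B * N) $$ (0, 0) \<noteq> 0"
proof -
  note c = leo_is_cpx(5)[OF T(1)] leo_is_cpx(5)[OF T(2)]
  note d [simp] = loc_splittingD(6-9)[OF s] loc_splittingD(6-9)[OF s'] chain_map_dim[OF B]
  have eM: "homotopy_equivalence gr_loc (Dloc T) (rank1 0 q) M"
    and eM': "homotopy_equivalence gr_loc (Dloc T') (rank1 0 q') M'"
    using s s' by (auto simp: loc_splitting_def homotopy_equivalence_def)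
  have eN: "homotopy_equivalence gr_loc (rank1 0 q) (Dloc T) N"
    and eN': "homotopy_equivalence gr_loc (rank1 0 q') (Dloc T') N'"
    using s s' loc_splittingD[OF s] loc_splittingD[OF s']
    unfolding loc_splitting_def homotopy_equivalence_def homotopy_inverse_def by auto
  have cP: "chain_map gr_loc (rank1 0 q) (rank1 0 q') (M' * B * N)"
    by (rule laurent.chain_map_comp[OF _ c(1) _ laurent.chain_map_comp[OF c(1,2)]])
      (use loc_splittingD[OF s] loc_splittingD[OF s'] B in auto)
  show ?thesis
  proof
    assume "homotopy_equivalence gr_loc (Dloc T) (Dloc T') B"
    then have "homotopy_equivalence gr_loc (rank1 0 q) (rank1 0 q') (M' * B * N)"
      using laurent.homotopy_equivalence_comp[OF _ c(1) _ eN laurent.homotopy_equivalence_comp[OF c(1,2) _ _ eM']]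
      by auto
    then obtain P where P: "chain_map gr_loc (rank1 0 q') (rank1 0 q) P"
        "homotopic gr_loc (rank1 0 q) (rank1 0 q) (P * (M' * B * N)) (1\<^sub>m 1)"
      by (auto simp: homotopy_equivalence_def homotopy_inverse_def)
    then have e: "P * (M' * B * N) = 1\<^sub>m 1"
      by (intro laurent.homotopic_rank1_eq) (auto simp: chain_map_dim)
    show "(M' * B * N) $$ (0, 0) \<noteq> 0"
    proof
      assume 0: "(M' * B * N) $$ (0, 0) = 0"
      have "(P * (M' * B * N)) $$ (0, 0) = 0"
        using 0 by (subst mat_mult_entry) (auto simp: chain_map_dim[OF P(1)])
      then show False unfolding e by simp
    qed
  next
    let ?c = "(M' * B * N) $$ (0, 0)"
    assume nz: "?c \<noteq> 0"
    have "gr_loc (q - q') ?c"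
      using bihom_qdeg[OF chain_map_bihom[OF cP], of 0 0] nz by simp
    then obtain b where b: "gr_loc (q' - q) b" "?c * b = 1" using gr_loc_unit nz by force
    let ?b = "mat 1 1 (\<lambda>_. b)"
    \<comment> \<open>The entry is a unit, so its rank one map is invertible and \<open>B\<close> is homotopic to \<open>N' \<circ> (M' B N) \<circ> M\<close>.\<close>
    have cb: "chain_map gr_loc (rank1 0 q') (rank1 0 q) ?b"
      unfolding chain_map_def using b by (auto intro!: bihomI)
    have "M' * B * N * ?b = 1\<^sub>m 1" "?b * (M' * B * N) = 1\<^sub>m 1"
      by (rule mult_1x1_eq_one; insert b; simp add: mult.commute del: index_mult_mat(1))+
    then have "homotopy_equivalence gr_loc (rank1 0 q) (rank1 0 q') (M' * B * N)"
      by (intro laurent.homotopy_equivalence_iso[OF _ _ cP cb]) auto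
    then have e: "homotopy_equivalence gr_loc (Dloc T) (Dloc T') (N' * ((M' * B * N) * M))"
      using laurent.homotopy_equivalence_comp[OF c(1) _ c(2) laurent.homotopy_equivalence_comp[OF c(1) _ _ eM] eN']
      by auto
    have "homotopic gr_loc (Dloc T) (Dloc T') (B * (N * M)) (B * 1\<^sub>m (rk (Dh T)))"
      by (rule laurent.homotopic_comp_left[OF c(1,1,2) _ _ _ _ B loc_splittingD(5)[OF s]]) auto
    moreover have "homotopic gr_loc (Dloc T) (Dloc T') ((N' * M') * (B * (N * M))) (1\<^sub>m (rk (Dh T')) * (B * (N * M)))"
      by (rule laurent.homotopic_comp_right[OF c(2,2,1) _ _ _ _ _ loc_splittingD(5)[OF s']])
        (auto intro!: laurent.chain_map_comp[OF c(1,1,2) B] laurent.chain_map_comp[OF c(1) _ c(1)]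
           loc_splittingD(2,3)[OF s])
    ultimately have "homotopic gr_loc (Dloc T) (Dloc T') (N' * M' * (B * (N * M))) B"
      using laurent.homotopic_trans[OF c, of "N' * M' * (B * (N * M))" "B * (N * M)" B] by simp
    then have "homotopic gr_loc (Dloc T) (Dloc T') (N' * ((M' * B * N) * M)) B"
      by (simp add: mat_mult_assoc_dim)
    from laurent.homotopy_equivalence_cong[OF c e B this]
    show "homotopy_equivalence gr_loc (Dloc T) (Dloc T') B" .
  qed
qed

lemma chain_map_to_loc:
  "T \<in> leo_triples \<Longrightarrow> T' \<in> leo_triples \<Longrightarrow> chain_map gr_h (Dh T) (Dh T') \<beta> \<Longrightarrow>
   chain_map gr_loc (Dloc T) (Dloc T') (map_mat to_loc \<beta>)"
  unfolding Dloc_def by (rule to_loc.chain_map_base_change) (auto dest: leo_is_cpx)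

lemma chain_map_at_h0:
  "T \<in> leo_triples \<Longrightarrow> T' \<in> leo_triples \<Longrightarrow> chain_map gr_h (Dh T) (Dh T') \<beta> \<Longrightarrow>
   chain_map gr_triv (D0 T) (D0 T') (map_mat at_h0 \<beta>)"
  unfolding D0_def by (rule at_h0.chain_map_base_change) (auto dest: leo_is_cpx)

lemma chain_map_mod2:
  "T \<in> leo_triples \<Longrightarrow> T' \<in> leo_triples \<Longrightarrow> chain_map gr_triv (Cz T) (Cz T') \<alpha> \<Longrightarrow>
   chain_map gr_triv (C2 T) (C2 T') (map_mat mod2 \<alpha>)"
  unfolding C2_def by (rule mod2.chain_map_base_change) (auto dest: leo_is_cpx)

lemma local_mapI:
  assumes "T \<in> leo_triples" "T' \<in> leo_triples"
    and "loc_splitting T q M N" "loc_splitting T' q' M' N'"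
    and "chain_map gr_triv (Cz T) (Cz T') \<alpha>" "chain_map gr_h (Dh T) (Dh T') \<beta>"
    and "(M' * map_mat to_loc \<beta> * N) $$ (0, 0) \<noteq> 0"
    and "homotopic gr_triv (C2 T) (D0 T') (fm T' * map_mat mod2 \<alpha>) (map_mat at_h0 \<beta> * fm T)"
  shows "local_map T T' \<alpha> \<beta>"
  unfolding local_map_def
  using assms loc_equivalence_iff[OF assms(1-4) chain_map_to_loc[OF assms(1,2,6)]] by blast

lemma local_map_id:
  assumes T: "T \<in> leo_triples"
  shows "local_map T T (1\<^sub>m (rk (Cz T))) (1\<^sub>m (rk (Dh T)))"
proof -
  note c = leo_is_cpx[OF T]
  have "homotopy_equivalence gr_loc (Dloc T) (Dloc T) (1\<^sub>m (rk (Dh T)))"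
    using laurent.homotopy_equivalence_iso[OF c(5,5) laurent.chain_map_one laurent.chain_map_one] c(5) by simp
  then show ?thesis
    unfolding local_map_def
    using triv_int.chain_map_one[OF c(1)] poly_h.chain_map_one[OF c(2)] chain_map_dim[OF leo_fm(2)[OF T]]
      triv_bit.homotopic_refl[OF c(3,4) leo_fm(2)[OF T]]
    by (simp add: mod2.mat_hom_one at_h0.mat_hom_one to_loc.mat_hom_one)
qed

lemma local_map_comp:
  assumes T: "T \<in> leo_triples" "T' \<in> leo_triples" "T'' \<in> leo_triples"
    and l: "local_map T T' \<alpha> \<beta>" and l': "local_map T' T'' \<alpha>' \<beta>'"
  shows "local_map T T'' (\<alpha>' * \<alpha>) (\<beta>' * \<beta>)"
proof -
  note c = leo_is_cpx[OF T(1)] and c' = leo_is_cpx[OF T(2)] and c'' = leo_is_cpx[OF T(3)]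
  have ch: "chain_map gr_triv (Cz T) (Cz T') \<alpha>" "chain_map gr_triv (Cz T') (Cz T'') \<alpha>'"
    "chain_map gr_h (Dh T) (Dh T') \<beta>" "chain_map gr_h (Dh T') (Dh T'') \<beta>'"
    using l l' by (auto simp: local_map_def)
  note chb = chain_map_mod2[OF T(1,2) ch(1)] chain_map_mod2[OF T(2,3) ch(2)]
    chain_map_at_h0[OF T(1,2) ch(3)] chain_map_at_h0[OF T(2,3) ch(4)]
  note d [simp] = chain_map_dim[OF ch(1)] chain_map_dim[OF ch(2)] chain_map_dim[OF ch(3)] chain_map_dim[OF ch(4)]
    chain_map_dim[OF leo_fm(2)[OF T(1)]] chain_map_dim[OF leo_fm(2)[OF T(2)]] chain_map_dim[OF leo_fm(2)[OF T(3)]]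
  have 1: "homotopic gr_triv (C2 T) (D0 T'') (fm T'' * map_mat mod2 \<alpha>' * map_mat mod2 \<alpha>)
      (map_mat at_h0 \<beta>' * fm T' * map_mat mod2 \<alpha>)"
    using l' by (intro triv_bit.homotopic_comp_right[OF c'(3) c''(4) c(3)] chb) (auto simp: local_map_def)
  have 2: "homotopic gr_triv (C2 T) (D0 T'') (map_mat at_h0 \<beta>' * (fm T' * map_mat mod2 \<alpha>))
      (map_mat at_h0 \<beta>' * (map_mat at_h0 \<beta> * fm T))"
    using l by (intro triv_bit.homotopic_comp_left[OF c(3) c'(4) c''(4)] chb) (auto simp: local_map_def)
  have "homotopic gr_triv (C2 T) (D0 T'') (fm T'' * map_mat mod2 \<alpha>' * map_mat mod2 \<alpha>)
      (map_mat at_h0 \<beta>' * (map_mat at_h0 \<beta> * fm T))"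
    using triv_bit.homotopic_trans[OF c(3) c''(4) _ _ _ _ _ _ 1, of "map_mat at_h0 \<beta>' * (map_mat at_h0 \<beta> * fm T)"] 2
    by (simp add: mat_mult_assoc_dim)
  moreover have "homotopy_equivalence gr_loc (Dloc T) (Dloc T'') (map_mat to_loc \<beta>' * map_mat to_loc \<beta>)"
    using l l' by (intro laurent.homotopy_equivalence_comp[OF c(5) c'(5) c''(5)]) (auto simp: local_map_def)
  ultimately show ?thesis
    unfolding local_map_def
    using triv_int.chain_map_comp[OF c(1) c'(1) c''(1) ch(2,1)] poly_h.chain_map_comp[OF c(2) c'(2) c''(2) ch(4,3)]
    by (simp add: mod2.map_mat_mult at_h0.map_mat_mult to_loc.map_mat_mult mat_mult_assoc_dim)
qed

text \<open>
  A preorder whose symmetric part is local equivalence.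
\<close>

definition local_le :: "leo \<Rightarrow> leo \<Rightarrow> bool" where
  "local_le T T' \<longleftrightarrow> (\<exists>\<alpha> \<beta>. local_map T T' \<alpha> \<beta>)"

lemma local_le_refl: "T \<in> leo_triples \<Longrightarrow> local_le T T"
  using local_map_id unfolding local_le_def by blast

lemma local_le_trans:
  "T \<in> leo_triples \<Longrightarrow> T' \<in> leo_triples \<Longrightarrow> T'' \<in> leo_triples \<Longrightarrow>
   local_le T T' \<Longrightarrow> local_le T' T'' \<Longrightarrow> local_le T T''"
  using local_map_comp unfolding local_le_def by blast

section \<open>Tensor products and duals of triples\<close>

lemma unit_at_leo:
  assumes "even q"
  shows "unit_at q \<in> leo_triples"
proof -
  have "homotopy_equivalence gr_triv (rank1 0 q) (rank1 0 q) (1\<^sub>m 1 :: bit mat)"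
    using triv_bit.homotopy_equivalence_iso[of "rank1 0 q" "rank1 0 q" "1\<^sub>m 1" "1\<^sub>m 1"]
      triv_bit.chain_map_one[of "rank1 0 q"] by simp
  moreover have "homotopy_equivalent gr_loc (rank1 0 q) (rank1 0 q)"
    using loc_splitting_unit_at[OF assms]
    unfolding homotopy_equivalent_def homotopy_equivalence_def loc_splitting_def by auto
  ultimately show ?thesis using assms unfolding leo_triples_def by auto
qed

lemma tensor_leo_simps [simp]:
  "Cz (tensor_leo T T') = tensor_cpx (Cz T) (Cz T')" "Dh (tensor_leo T T') = tensor_cpx (Dh T) (Dh T')"
  "fm (tensor_leo T T') = kron (fm T) (fm T')"
  by (simp_all add: tensor_leo_def)

lemma tensor_leo_base_change:
  assumes "T \<in> leo_triples" "T' \<in> leo_triples"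
  shows "C2 (tensor_leo T T') = tensor_cpx (C2 T) (C2 T')"
    "D0 (tensor_leo T T') = tensor_cpx (D0 T) (D0 T')"
    "Dloc (tensor_leo T T') = tensor_cpx (Dloc T) (Dloc T')"
  using leo_is_cpx[OF assms(1)] leo_is_cpx[OF assms(2)]
  by (simp_all add: C2_def D0_def Dloc_def mod2.base_change_tensor at_h0.base_change_tensor
      to_loc.base_change_tensor)

lemma loc_splitting_tensor:
  assumes T: "T \<in> leo_triples" "T' \<in> leo_triples"
    and s: "loc_splitting T q M N" and s': "loc_splitting T' q' M' N'"
  shows "loc_splitting (tensor_leo T T') (q + q') (kron M M') (kron N N')"
proof -
  note c = leo_is_cpx(5)[OF T(1)] leo_is_cpx(5)[OF T(2)]
  note d [simp] = loc_splittingD[OF s] loc_splittingD[OF s']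
  have "homotopy_inverse gr_loc (tensor_cpx (Dloc T) (Dloc T')) (tensor_cpx (rank1 0 q) (rank1 0 q')) (kron M M') (kron N N')"
    using s s' by (intro laurent.homotopy_inverse_kron[OF c]) (auto simp: loc_splitting_def)
  moreover have "chain_map gr_loc (tensor_cpx (Dloc T) (Dloc T')) (tensor_cpx (rank1 0 q) (rank1 0 q')) (kron M M')"
    by (rule laurent.chain_map_kron[OF c]) auto
  ultimately show ?thesis
    unfolding loc_splitting_def tensor_leo_base_change[OF T] tensor_rank1_rank1
    using kron_one[of 1 1, where 'r = laurent] by (simp add: kron_mult)
qed

lemma tensor_leo_closed:
  assumes T: "T \<in> leo_triples" "T' \<in> leo_triples"
  shows "tensor_leo T T' \<in> leo_triples"
proof -
  note c = leo_is_cpx[OF T(1)] and c' = leo_is_cpx[OF T(2)]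
  obtain q M N q' M' N' where "loc_splitting T q M N" "loc_splitting T' q' M' N'"
    using loc_splitting_exists T by metis
  from loc_splitting_tensor[OF T this] have "\<exists>q. even q \<and> homotopy_equivalent gr_loc (Dloc (tensor_leo T T')) (rank1 0 q)"
    unfolding loc_splitting_def homotopy_equivalent_def homotopy_equivalence_def by blast
  then show ?thesis
    unfolding leo_triples_def
    using triv_int.is_cpx_tensor[OF c(1) c'(1)] poly_h.is_cpx_tensor[OF c(2) c'(2)]
      triv_bit.homotopy_equivalence_kron[OF c(3) c'(3) c(4) c'(4) leo_fm(1)[OF T(1)] leo_fm(1)[OF T(2)]]
    by (simp add: tensor_leo_base_change[OF T])
qed

text \<open>
  Each condition on a local map is stable under tensor products, since homotopies and homotopy
  equivalences are.
\<close>

lemma local_map_tensor: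
  assumes T: "X \<in> leo_triples" "Y \<in> leo_triples" "X' \<in> leo_triples" "Y' \<in> leo_triples"
    and l: "local_map X X' \<alpha> \<beta>" and l': "local_map Y Y' \<alpha>' \<beta>'"
  shows "local_map (tensor_leo X Y) (tensor_leo X' Y') (kron \<alpha> \<alpha>') (kron \<beta> \<beta>')"
proof -
  note c = T[THEN leo_is_cpx(1)] T[THEN leo_is_cpx(2)] T[THEN leo_is_cpx(3)] T[THEN leo_is_cpx(4)]
    T[THEN leo_is_cpx(5)]
  have ch: "chain_map gr_triv (Cz X) (Cz X') \<alpha>" "chain_map gr_triv (Cz Y) (Cz Y') \<alpha>'"
    "chain_map gr_h (Dh X) (Dh X') \<beta>" "chain_map gr_h (Dh Y) (Dh Y') \<beta>'"
    using l l' by (auto simp: local_map_def)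
  note chb = chain_map_mod2[OF T(1,3) ch(1)] chain_map_mod2[OF T(2,4) ch(2)]
    chain_map_at_h0[OF T(1,3) ch(3)] chain_map_at_h0[OF T(2,4) ch(4)]
  note f = leo_fm(2)[OF T(1)] leo_fm(2)[OF T(2)] leo_fm(2)[OF T(3)] leo_fm(2)[OF T(4)]
  note d [simp] = chain_map_dim[OF ch(1)] chain_map_dim[OF ch(2)] chain_map_dim[OF ch(3)] chain_map_dim[OF ch(4)]
    chain_map_dim[OF f(1)] chain_map_dim[OF f(2)] chain_map_dim[OF f(3)] chain_map_dim[OF f(4)]
  have h: "homotopic gr_triv (C2 X) (D0 X') (fm X' * map_mat mod2 \<alpha>) (map_mat at_h0 \<beta> * fm X)"
    "homotopic gr_triv (C2 Y) (D0 Y') (fm Y' * map_mat mod2 \<alpha>') (map_mat at_h0 \<beta>' * fm Y)"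
    and e: "homotopy_equivalence gr_loc (Dloc X) (Dloc X') (map_mat to_loc \<beta>)"
    "homotopy_equivalence gr_loc (Dloc Y) (Dloc Y') (map_mat to_loc \<beta>')"
    using l l' by (auto simp: local_map_def)
  have "homotopic gr_triv (tensor_cpx (C2 X) (C2 Y)) (tensor_cpx (D0 X') (D0 Y'))
     (kron (fm X' * map_mat mod2 \<alpha>) (fm Y' * map_mat mod2 \<alpha>'))
     (kron (map_mat at_h0 \<beta> * fm X) (map_mat at_h0 \<beta>' * fm Y))"
    by (rule triv_bit.homotopic_kron[OF c(9,10,15,16) _ _ _ _ h])
      (rule triv_bit.chain_map_comp; use c f chb in blast)+
  then show ?thesis
    unfolding local_map_def tensor_leo_simps tensor_leo_base_change[OF T(1,2)] tensor_leo_base_change[OF T(3,4)]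
      mod2.map_mat_kron at_h0.map_mat_kron to_loc.map_mat_kron
    using triv_int.chain_map_kron[OF c(1-4) ch(1,2)] poly_h.chain_map_kron[OF c(5-8) ch(3,4)]
      laurent.homotopy_equivalence_kron[OF c(17-20) e]
    by (simp add: kron_mult)
qed

lemma local_le_tensor:
  "X \<in> leo_triples \<Longrightarrow> Y \<in> leo_triples \<Longrightarrow> X' \<in> leo_triples \<Longrightarrow> Y' \<in> leo_triples \<Longrightarrow>
   local_le X X' \<Longrightarrow> local_le Y Y' \<Longrightarrow> local_le (tensor_leo X Y) (tensor_leo X' Y')"
  using local_map_tensor unfolding local_le_def by blast

lemma tensor_leo_assoc:
  assumes "X \<in> leo_triples" "Y \<in> leo_triples" "Z \<in> leo_triples"
  shows "tensor_leo (tensor_leo X Y) Z = tensor_leo X (tensor_leo Y Z)"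
  using tensor_cpx_assoc[OF assms[THEN leo_is_cpx(1)]] tensor_cpx_assoc[OF assms[THEN leo_is_cpx(2)]]
  by (simp add: tensor_leo_def kron_assoc)

lemma tensor_leo_unit_left:
  assumes "T \<in> leo_triples"
  shows "tensor_leo unit_leo T = T"
  using tensor_rank1_left[OF leo_is_cpx(1)[OF assms]] tensor_rank1_left[OF leo_is_cpx(2)[OF assms]]
    kron_one1[of "fm T"]
  by (simp add: tensor_leo_def unit_leo_def)

lemma tensor_leo_unit_right:
  assumes "T \<in> leo_triples"
  shows "tensor_leo T unit_leo = T"
  using tensor_rank1_right[OF leo_is_cpx(1)[OF assms]] tensor_rank1_right[OF leo_is_cpx(2)[OF assms]]
    kron_one1_right[of "fm T"]
  by (simp add: tensor_leo_def unit_leo_def)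

text \<open>
  In characteristic two the swap is natural without signs, so it commutes with the comparison maps
  strictly. It is an isomorphism by \<open>swap_swap\<close>.
\<close>

lemma local_le_swap:
  assumes T: "X \<in> leo_triples" "Y \<in> leo_triples"
  shows "local_le (tensor_leo X Y) (tensor_leo Y X)"
proof -
  note c = T[THEN leo_is_cpx(1)] T[THEN leo_is_cpx(2)] T[THEN leo_is_cpx(3)] T[THEN leo_is_cpx(4)]
    T[THEN leo_is_cpx(5)]
  note f = leo_fm(2)[OF T(1)] leo_fm(2)[OF T(2)]
  have sw: "map_mat mod2 (swap_mat (Cz X) (Cz Y)) = swap_mat (C2 X) (C2 Y)"
    "map_mat at_h0 (swap_mat (Dh X) (Dh Y)) = swap_mat (D0 X) (D0 Y)"
    "map_mat to_loc (swap_mat (Dh X) (Dh Y)) = swap_mat (Dloc X) (Dloc Y)"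
    by (simp_all add: mod2.map_mat_swap at_h0.map_mat_swap to_loc.map_mat_swap C2_def D0_def Dloc_def)
  have "swap_mat (Dloc Y) (Dloc X) * swap_mat (Dloc X) (Dloc Y) = 1\<^sub>m (rk (tensor_cpx (Dloc X) (Dloc Y)))"
    "swap_mat (Dloc X) (Dloc Y) * swap_mat (Dloc Y) (Dloc X) = 1\<^sub>m (rk (tensor_cpx (Dloc Y) (Dloc X)))"
    by (simp_all only: swap_swap rk_tensor)
  then have "homotopy_equivalence gr_loc (tensor_cpx (Dloc X) (Dloc Y)) (tensor_cpx (Dloc Y) (Dloc X))
      (swap_mat (Dloc X) (Dloc Y))"
    by (rule laurent.homotopy_equivalence_iso[OF laurent.is_cpx_tensor[OF c(9,10)] laurent.is_cpx_tensor[OF c(10,9)]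
          laurent.chain_map_swap[OF c(9,10)] laurent.chain_map_swap[OF c(10,9)]])
  moreover have "swap_mat (D0 X) (D0 Y) * kron (fm X) (fm Y) = kron (fm Y) (fm X) * swap_mat (C2 X) (C2 Y)"
    by (rule triv_bit.swap_natural[OF bihom_carrier[OF chain_map_bihom[OF f(1)]] bihom_carrier[OF chain_map_bihom[OF f(2)]]])
  moreover have "homotopic gr_triv (tensor_cpx (C2 X) (C2 Y)) (tensor_cpx (D0 Y) (D0 X))
      (kron (fm Y) (fm X) * swap_mat (C2 X) (C2 Y)) (kron (fm Y) (fm X) * swap_mat (C2 X) (C2 Y))"
  proof -
    note t = triv_bit.is_cpx_tensor[OF c(5,6)] triv_bit.is_cpx_tensor[OF c(6,5)] triv_bit.is_cpx_tensor[OF c(8,7)]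
    show ?thesis
      by (rule triv_bit.homotopic_refl[OF t(1,3) triv_bit.chain_map_comp[OF t
            triv_bit.chain_map_kron[OF c(6,5,8,7) f(2,1)] triv_bit.chain_map_swap[OF c(5,6)]]])
  qed
  ultimately have "local_map (tensor_leo X Y) (tensor_leo Y X) (swap_mat (Cz X) (Cz Y)) (swap_mat (Dh X) (Dh Y))"
    unfolding local_map_def tensor_leo_simps tensor_leo_base_change[OF T] tensor_leo_base_change[OF T(2,1)] sw
    using triv_int.chain_map_swap[OF c(1,2)] poly_h.chain_map_swap[OF c(3,4)] by simp
  then show ?thesis unfolding local_le_def by blast
qed

lemma dual_leo_simps [simp]:
  "Cz (dual_leo T g) = dual_cpx (Cz T)" "Dh (dual_leo T g) = dual_cpx (Dh T)" "fm (dual_leo T g) = transpose_mat g"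
  by (simp_all add: dual_leo_def)

lemma dual_leo_base_change:
  assumes "T \<in> leo_triples"
  shows "C2 (dual_leo T g) = dual_cpx (C2 T)" "D0 (dual_leo T g) = dual_cpx (D0 T)"
    "Dloc (dual_leo T g) = dual_cpx (Dloc T)"
  using leo_is_cpx[OF assms]
  by (simp_all add: C2_def D0_def Dloc_def mod2.base_change_dual at_h0.base_change_dual
      to_loc.base_change_dual)

lemma loc_splitting_dual:
  assumes T: "T \<in> leo_triples" and s: "loc_splitting T q M N"
  shows "loc_splitting (dual_leo T g) (- q) (transpose_mat N) (transpose_mat M)"
proof -
  note c = leo_is_cpx(5)[OF T]
  note d [simp] = loc_splittingD[OF s]
  have "M \<in> carrier_mat 1 (rk (Dh T))" "N \<in> carrier_mat (rk (Dh T)) 1" by auto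
  then have "transpose_mat N * transpose_mat M = 1\<^sub>m 1"
    by (metis d(4) transpose_mult transpose_one)
  moreover have "homotopy_inverse gr_loc (dual_cpx (Dloc T)) (dual_cpx (rank1 0 q)) (transpose_mat N) (transpose_mat M)"
    using s by (intro laurent.homotopy_inverse_transpose[OF c]) (auto simp: loc_splitting_def)
  moreover have "chain_map gr_loc (dual_cpx (Dloc T)) (dual_cpx (rank1 0 q)) (transpose_mat N)"
    by (rule laurent.chain_map_transpose[OF _ c]) auto
  ultimately show ?thesis
    unfolding loc_splitting_def dual_leo_base_change[OF T] dual_rank1 by simp
qed

lemma dual_leo_closed:
  assumes T: "T \<in> leo_triples" and g: "homotopy_inverse gr_triv (C2 T) (D0 T) (fm T) g"
  shows "dual_leo T g \<in> leo_triples"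
proof -
  note c = leo_is_cpx[OF T]
  have cg: "chain_map gr_triv (D0 T) (C2 T) g" using g by (simp add: homotopy_inverse_def)
  obtain q M N where "loc_splitting T q M N" using loc_splitting_exists[OF T] by metis
  from loc_splitting_dual[OF T this] have "\<exists>q. even q \<and> homotopy_equivalent gr_loc (Dloc (dual_leo T g)) (rank1 0 q)"
    unfolding loc_splitting_def homotopy_equivalent_def homotopy_equivalence_def by blast
  moreover have "homotopy_equivalence gr_triv (dual_cpx (C2 T)) (dual_cpx (D0 T)) (transpose_mat g)"
    unfolding homotopy_equivalence_def
    using triv_bit.homotopy_inverse_transpose[OF c(3,4) leo_fm(2)[OF T] g]
      triv_bit.chain_map_transpose[OF c(4,3) cg] by blast
  ultimately show ?thesis
    unfolding leo_triples_def
    using triv_int.is_cpx_dual[OF c(1)] poly_h.is_cpx_dual[OF c(2)]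
    by (simp add: dual_leo_base_change[OF T])
qed

text \<open>
  By dinaturality, evaluation composed with $f \otimes g^T$ is evaluation composed with
  $g f \otimes 1$, which is homotopic to evaluation as \<open>g\<close> is a homotopy inverse of \<open>f\<close>. The same
  identity for the splitting of the localization evaluates the relevant entry to 1.
\<close>

lemma local_le_ev:
  assumes T: "T \<in> leo_triples" and g: "homotopy_inverse gr_triv (C2 T) (D0 T) (fm T) g"
  shows "local_le (tensor_leo T (dual_leo T g)) unit_leo"
proof -
  note c = leo_is_cpx[OF T] and T' = dual_leo_closed[OF T g]
  note TT = tensor_leo_closed[OF T T']
  have cg: "chain_map gr_triv (D0 T) (C2 T) g" and hg: "homotopic gr_triv (C2 T) (C2 T) (g * fm T) (1\<^sub>m (rk (Cz T)))"
    using g by (auto simp: homotopy_inverse_def)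
  note f = leo_fm(2)[OF T]
  obtain q M N where s: "loc_splitting T q M N" using loc_splitting_exists[OF T] by metis
  note d [simp] = loc_splittingD(6-9)[OF s] chain_map_dim[OF cg] chain_map_dim[OF f]
  have s2: "loc_splitting (tensor_leo T (dual_leo T g)) 0 (kron M (transpose_mat N)) (kron N (transpose_mat M))"
    using loc_splitting_tensor[OF T T' s loc_splitting_dual[OF T s]] by simp
  have ev: "map_mat mod2 (ev_mat (Cz T)) = ev_mat (C2 T)" "map_mat at_h0 (ev_mat (Dh T)) = ev_mat (D0 T)"
    "map_mat to_loc (ev_mat (Dh T)) = ev_mat (Dloc T)"
    by (simp_all add: mod2.map_mat_ev at_h0.map_mat_ev to_loc.map_mat_ev C2_def D0_def Dloc_def)
  have cM: "M \<in> carrier_mat (rk (rank1 0 q)) (rk (Dloc T))" and cN: "N \<in> carrier_mat (rk (Dloc T)) (rk (rank1 0 q))"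
    by (rule carrier_matI; simp)+
  have "ev_mat (Dloc T) * kron N (transpose_mat M) = ev_mat (rank1 0 q) * kron (M * N) (1\<^sub>m 1)"
    using laurent.ev_dinatural[OF cN cM] unfolding rank1_simps .
  also have "\<dots> = ev_mat (rank1 0 q)"
    unfolding loc_splittingD(4)[OF s] kron_one1 by (rule right_mult_one_mat') simp
  finally have "map_mat to_loc (ev_mat (Dh T)) * kron N (transpose_mat M) = ev_mat (rank1 0 q)"
    unfolding ev .
  moreover have "1\<^sub>m 1 * map_mat to_loc (ev_mat (Dh T)) = map_mat to_loc (ev_mat (Dh T))"
    by (rule left_mult_one_mat') simp
  moreover have "ev_mat (rank1 0 q) $$ (0, 0) = (1::laurent)" by (simp add: ev_mat_def)
  ultimately have e: "(1\<^sub>m 1 * map_mat to_loc (ev_mat (Dh T)) * kron N (transpose_mat M)) $$ (0, 0) \<noteq> 0"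
    by (simp only: one_neq_zero not_False_eq_True)
  note d3 = triv_bit.is_cpx_dual[OF c(3)]
  note t3 = triv_bit.is_cpx_tensor[OF c(3) d3]
  have "homotopic gr_triv (tensor_cpx (C2 T) (dual_cpx (C2 T))) (tensor_cpx (C2 T) (dual_cpx (C2 T)))
    (kron (g * fm T) (1\<^sub>m (rk (Cz T)))) (kron (1\<^sub>m (rk (Cz T))) (1\<^sub>m (rk (Cz T))))"
    using triv_bit.chain_map_one[OF d3]
    by (intro triv_bit.homotopic_kron_left[OF c(3) d3 c(3) d3 _ _ _ _ _ hg]) simp_all
  then have "homotopic gr_triv (tensor_cpx (C2 T) (dual_cpx (C2 T))) (rank1 0 0)
    (ev_mat (C2 T) * kron (g * fm T) (1\<^sub>m (rk (Cz T)))) (ev_mat (C2 T) * kron (1\<^sub>m (rk (Cz T))) (1\<^sub>m (rk (Cz T))))"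
    by (intro triv_bit.homotopic_comp_left[OF t3 t3 is_cpx_rank1_all(1) _ _ _ _ triv_bit.chain_map_ev[OF c(3)]]) simp_all
  moreover have "ev_mat (D0 T) * kron (fm T) (transpose_mat g) = ev_mat (C2 T) * kron (g * fm T) (1\<^sub>m (rk (Cz T)))"
    by (rule triv_bit.ev_dinatural[of "fm T" "D0 T" "C2 T" g, unfolded leo_simps]; rule carrier_matI; simp)
  ultimately have h: "homotopic gr_triv (tensor_cpx (C2 T) (dual_cpx (C2 T))) (rank1 0 0)
      (ev_mat (C2 T)) (ev_mat (D0 T) * kron (fm T) (transpose_mat g))"
    by - (rule triv_bit.homotopic_sym[OF t3 is_cpx_rank1_all(1)]; simp add: kron_one)
  have "local_map (tensor_leo T (dual_leo T g)) (unit_at 0) (ev_mat (Cz T)) (ev_mat (Dh T))"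
    using h triv_int.chain_map_ev[OF c(1)] poly_h.chain_map_ev[OF c(2)]
    by (intro local_mapI[OF TT unit_at_leo s2 loc_splitting_unit_at _ _ e])
      (simp_all add: tensor_leo_base_change[OF T T'] dual_leo_base_change[OF T] ev)
  then show ?thesis unfolding local_le_def unit_leo_eq by blast
qed

text \<open>
  The argument of \<open>local_le_ev\<close> with \<open>f g\<close> in place of \<open>g f\<close>.
\<close>

lemma local_le_coev:
  assumes T: "T \<in> leo_triples" and g: "homotopy_inverse gr_triv (C2 T) (D0 T) (fm T) g"
  shows "local_le unit_leo (tensor_leo T (dual_leo T g))"
proof -
  note c = leo_is_cpx[OF T] and T' = dual_leo_closed[OF T g]
  note TT = tensor_leo_closed[OF T T']
  have cg: "chain_map gr_triv (D0 T) (C2 T) g" and hg: "homotopic gr_triv (D0 T) (D0 T) (fm T * g) (1\<^sub>m (rk (Dh T)))"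
    using g by (auto simp: homotopy_inverse_def)
  note f = leo_fm(2)[OF T]
  obtain q M N where s: "loc_splitting T q M N" using loc_splitting_exists[OF T] by metis
  note d [simp] = loc_splittingD(6-9)[OF s] chain_map_dim[OF cg] chain_map_dim[OF f]
  have s2: "loc_splitting (tensor_leo T (dual_leo T g)) 0 (kron M (transpose_mat N)) (kron N (transpose_mat M))"
    using loc_splitting_tensor[OF T T' s loc_splitting_dual[OF T s]] by simp
  have coev: "map_mat mod2 (coev_mat (Cz T)) = coev_mat (C2 T)" "map_mat at_h0 (coev_mat (Dh T)) = coev_mat (D0 T)"
    "map_mat to_loc (coev_mat (Dh T)) = coev_mat (Dloc T)"
    by (simp_all add: mod2.map_mat_coev at_h0.map_mat_coev to_loc.map_mat_coev C2_def D0_def Dloc_def)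
  have cM: "M \<in> carrier_mat (rk (rank1 0 q)) (rk (Dloc T))" and cN: "N \<in> carrier_mat (rk (Dloc T)) (rk (rank1 0 q))"
    by (rule carrier_matI; simp)+
  have "kron M (transpose_mat N) * coev_mat (Dloc T) = kron (M * N) (1\<^sub>m 1) * coev_mat (rank1 0 q)"
    using laurent.coev_dinatural[OF cM cN] unfolding rank1_simps .
  also have "\<dots> = coev_mat (rank1 0 q)"
    unfolding loc_splittingD(4)[OF s] kron_one1 by (rule left_mult_one_mat') simp
  finally have "kron M (transpose_mat N) * map_mat to_loc (coev_mat (Dh T)) = coev_mat (rank1 0 q)"
    unfolding coev .
  moreover have "coev_mat (rank1 0 q) * 1\<^sub>m 1 = (coev_mat (rank1 0 q) :: laurent mat)"
    by (rule right_mult_one_mat') simp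
  moreover have "coev_mat (rank1 0 q) $$ (0, 0) = (1::laurent)" by (simp add: coev_mat_def)
  ultimately have e: "(kron M (transpose_mat N) * map_mat to_loc (coev_mat (Dh T)) * 1\<^sub>m 1) $$ (0, 0) \<noteq> 0"
    by (simp only: one_neq_zero not_False_eq_True)
  note d4 = triv_bit.is_cpx_dual[OF c(4)]
  note t4 = triv_bit.is_cpx_tensor[OF c(4) d4]
  have "homotopic gr_triv (tensor_cpx (D0 T) (dual_cpx (D0 T))) (tensor_cpx (D0 T) (dual_cpx (D0 T)))
    (kron (fm T * g) (1\<^sub>m (rk (Dh T)))) (kron (1\<^sub>m (rk (Dh T))) (1\<^sub>m (rk (Dh T))))"
    using triv_bit.chain_map_one[OF d4]
    by (intro triv_bit.homotopic_kron_left[OF c(4) d4 c(4) d4 _ _ _ _ _ hg]) simp_all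
  then have "homotopic gr_triv (rank1 0 0) (tensor_cpx (D0 T) (dual_cpx (D0 T)))
    (kron (fm T * g) (1\<^sub>m (rk (Dh T))) * coev_mat (D0 T)) (kron (1\<^sub>m (rk (Dh T))) (1\<^sub>m (rk (Dh T))) * coev_mat (D0 T))"
    by (intro triv_bit.homotopic_comp_right[OF t4 t4 is_cpx_rank1_all(1) _ _ _ _ triv_bit.chain_map_coev[OF c(4)]]) simp_all
  moreover have "kron (fm T) (transpose_mat g) * coev_mat (C2 T) = kron (fm T * g) (1\<^sub>m (rk (Dh T))) * coev_mat (D0 T)"
    by (rule triv_bit.coev_dinatural[of "fm T" "D0 T" "C2 T" g, unfolded leo_simps]; rule carrier_matI; simp)
  ultimately have h: "homotopic gr_triv (rank1 0 0) (tensor_cpx (D0 T) (dual_cpx (D0 T)))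
      (kron (fm T) (transpose_mat g) * coev_mat (C2 T)) (coev_mat (D0 T))"
    by (simp add: kron_one)
  have "local_map (unit_at 0) (tensor_leo T (dual_leo T g)) (coev_mat (Cz T)) (coev_mat (Dh T))"
    using h triv_int.chain_map_coev[OF c(1)] poly_h.chain_map_coev[OF c(2)]
    by (intro local_mapI[OF unit_at_leo TT loc_splitting_unit_at s2 _ _ e])
      (simp_all add: tensor_leo_base_change[OF T T'] dual_leo_base_change[OF T] coev)
  then show ?thesis unfolding local_le_def unit_leo_eq by blast
qed

section \<open>Cohomology classes as local maps\<close>

text \<open>
  Vectors as maps from a module of rank one: cocycles of degree \<open>q\<close> become chain maps from a generator
  in degree \<open>q\<close>, and cohomologous cocycles become homotopic maps.
\<close>

definition col_mat :: "'r vec \<Rightarrow> 'r mat" where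
  "col_mat v = mat (dim_vec v) 1 (\<lambda>(k, _). v $ k)"

lemma col_mat_dim [simp]: "dim_row (col_mat v) = dim_vec v" "dim_col (col_mat v) = 1"
  by (simp_all add: col_mat_def)

lemma col_mat_entry [simp]: "k < dim_vec v \<Longrightarrow> col_mat v $$ (k, 0) = v $ k"
  by (simp add: col_mat_def)

lemma col_mat_inject: "col_mat v = col_mat w \<longleftrightarrow> v = w"
proof
  assume e: "col_mat v = col_mat w"
  have "dim_row (col_mat v) = dim_row (col_mat w)" unfolding e ..
  moreover have "col_mat v $$ (k, 0) = col_mat w $$ (k, 0)" for k unfolding e ..
  ultimately show "v = w" by (intro eq_vecI) (metis col_mat_dim(1) col_mat_entry)+
qed simp

lemma col_mat_col: "A \<in> carrier_mat n 1 \<Longrightarrow> A = col_mat (col A 0)"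
  by (rule eq_matI) (auto simp: col_mat_def)

lemma mult_col_mat: "dim_vec v = dim_col A \<Longrightarrow> A * col_mat v = col_mat (A *\<^sub>v v)"
proof (rule eq_matI)
  have "col (col_mat v) 0 = v" by (rule eq_vecI) auto
  then show "(A * col_mat v) $$ (i, j) = col_mat (A *\<^sub>v v) $$ (i, j)"
    if "i < dim_row (col_mat (A *\<^sub>v v))" "j < dim_col (col_mat (A *\<^sub>v v))" for i j
    using that by simp
qed auto

lemma map_col_mat: "map_mat f (col_mat v) = col_mat (map_vec f v)"
  by (rule eq_matI) (auto simp: col_mat_def)

lemma minus_col_mat: "dim_vec v = dim_vec w \<Longrightarrow> col_mat v - col_mat w = col_mat (v - w)"
  by (rule eq_matI) (auto simp: col_mat_def)

lemma col_mat_bihom_iff: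
  "col_mat v \<in> bihom gr a 0 (rank1 0 q) C \<longleftrightarrow> v \<in> elements gr C a q"
proof -
  have "col_mat v \<in> carrier_mat (rk C) 1 \<longleftrightarrow> v \<in> carrier_vec (rk C)"
    using carrier_matD(1)[of "col_mat v" "rk C" 1] by (metis carrier_matI carrier_vecD carrier_vecI col_mat_dim)
  then show ?thesis
    by (auto simp: bihom_def elements_def)
qed

lemma chain_map_col_mat_iff:
  assumes "is_cpx gr C"
  shows "chain_map gr (rank1 0 q) C (col_mat v) \<longleftrightarrow> v \<in> cocycles gr C 0 q"
proof (cases "v \<in> elements gr C 0 q")
  case True
  then have v: "dim_vec v = rk C" by (auto simp: elements_def)
  have "bd C * col_mat v = col_mat (bd C *\<^sub>v v)"
    using v is_cpx_dim[OF assms] by (simp add: mult_col_mat)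
  moreover have "col_mat v * bd (rank1 0 q) = col_mat (0\<^sub>v (rk C))"
    using v by (intro eq_matI) (auto simp: col_mat_def)
  ultimately show ?thesis
    using True by (simp add: chain_map_def cocycles_def col_mat_bihom_iff col_mat_inject)
next
  case False
  then show ?thesis by (simp add: chain_map_def cocycles_def col_mat_bihom_iff)
qed

lemma chain_map_rank1_col_mat:
  assumes "chain_map gr (rank1 0 q) C A"
  shows "\<exists>v. A = col_mat v"
proof -
  have "A \<in> carrier_mat (rk C) 1" using bihom_carrier[OF chain_map_bihom[OF assms]] by simp
  from col_mat_col[OF this] show ?thesis by blast
qed

lemma cocycles_carrier: "v \<in> cocycles gr C i q \<Longrightarrow> v \<in> carrier_vec (rk C)"
  by (simp add: cocycles_def elements_def)

lemma homotopic_col_mat_iff: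
  assumes "is_cpx gr C" and z: "z \<in> carrier_vec (rk C)" "z' \<in> carrier_vec (rk C)"
  shows "homotopic gr (rank1 0 q) C (col_mat z) (col_mat z') \<longleftrightarrow> z - z' \<in> coboundaries gr C 0 q"
proof -
  have e: "col_mat z - col_mat z' = bd C * col_mat w + col_mat w * bd (rank1 0 q) \<longleftrightarrow> z - z' = bd C *\<^sub>v w"
    if "dim_vec w = rk C" for w
  proof -
    have "bd C * col_mat w + col_mat w * bd (rank1 0 q) = col_mat (bd C *\<^sub>v w)"
      using that is_cpx_dim[OF assms(1)] by (simp add: mult_col_mat) (intro eq_matI; simp)
    then show ?thesis using z by (simp add: minus_col_mat col_mat_inject)
  qed
  show ?thesis
  proof
    assume "homotopic gr (rank1 0 q) C (col_mat z) (col_mat z')"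
    then obtain H where H: "H \<in> bihom gr (- 1) 0 (rank1 0 q) C"
      "col_mat z - col_mat z' = bd C * H + H * bd (rank1 0 q)" unfolding homotopic_def by blast
    then have "H \<in> carrier_mat (rk C) 1" using bihom_carrier[OF H(1)] by simp
    then have "H = col_mat (col H 0)" by (rule col_mat_col)
    then obtain w where w: "H = col_mat w" by blast
    then have "w \<in> elements gr C (- 1) q" using H(1) by (simp add: col_mat_bihom_iff)
    moreover from this have "dim_vec w = rk C" by (auto simp: elements_def)
    ultimately show "z - z' \<in> coboundaries gr C 0 q"
      using e[of w] H(2) w by (auto simp: coboundaries_def)
  next
    assume "z - z' \<in> coboundaries gr C 0 q"
    then obtain w where w: "w \<in> elements gr C (- 1) q" "z - z' = bd C *\<^sub>v w"
      by (auto simp: coboundaries_def)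
    then have "dim_vec w = rk C" by (auto simp: elements_def)
    then show "homotopic gr (rank1 0 q) C (col_mat z) (col_mat z')"
      using e[of w] w unfolding homotopic_def by (metis col_mat_bihom_iff)
  qed
qed

lemma (in graded_ring) coboundaries_closed:
  assumes C: "is_cpx gr C"
  shows "0\<^sub>v (rk C) \<in> coboundaries gr C 0 q"
    and "b \<in> coboundaries gr C 0 q \<Longrightarrow> b' \<in> coboundaries gr C 0 q \<Longrightarrow> b + b' \<in> coboundaries gr C 0 q"
    and "b \<in> coboundaries gr C 0 q \<Longrightarrow> - b \<in> coboundaries gr C 0 q"
    and "b \<in> coboundaries gr C 0 q \<Longrightarrow> b \<in> carrier_vec (rk C)"
proof -
  note d = is_cpx_dim[OF C]
  have bd: "bd C \<in> carrier_mat (rk C) (rk C)" using d by auto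
  show "0\<^sub>v (rk C) \<in> coboundaries gr C 0 q"
    unfolding coboundaries_def
  proof (rule image_eqI[of _ _ "0\<^sub>v (rk C)"])
    show "0\<^sub>v (rk C) = bd C *\<^sub>v 0\<^sub>v (rk C)"
      using d by (intro eq_vecI) (auto simp: scalar_prod_right_zero[OF row_carrier_vec[OF _ bd]])
  qed (auto simp: elements_def)
  show car: "b \<in> coboundaries gr C 0 q \<Longrightarrow> b \<in> carrier_vec (rk C)" for b
    using d by (auto simp: coboundaries_def intro!: carrier_vecI)
  show "b + b' \<in> coboundaries gr C 0 q" if bb: "b \<in> coboundaries gr C 0 q" "b' \<in> coboundaries gr C 0 q"
  proof -
    obtain w w' where w: "w \<in> elements gr C (- 1) q" "b = bd C *\<^sub>v w" "w' \<in> elements gr C (- 1) q" "b' = bd C *\<^sub>v w'"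
      using bb by (auto simp: coboundaries_def)
    have g: "gr q' (w $ k)" if "k < rk C" "q' = q - qdeg C k" for k q'
      using that w(1) by (cases "w $ k = 0") (auto simp: elements_def)
    have g': "gr q' (w' $ k)" if "k < rk C" "q' = q - qdeg C k" for k q'
      using that w(3) by (cases "w' $ k = 0") (auto simp: elements_def)
    have "hdeg C k = - 1" if "k < rk C" "w $ k + w' $ k \<noteq> 0" for k
      using that w(1,3) by (cases "w $ k = 0") (auto simp: elements_def)
    then have "w + w' \<in> elements gr C (- 1) q"
      using w(1,3) g g' by (auto simp: elements_def intro!: gr_add)
    moreover have "w \<in> carrier_vec (rk C)" "w' \<in> carrier_vec (rk C)"
      using w by (simp_all add: elements_def)
    then have "b + b' = bd C *\<^sub>v (w + w')"
      unfolding w by (rule mult_add_distrib_mat_vec[OF bd, symmetric])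
    ultimately show ?thesis unfolding coboundaries_def by simp
  qed
  show "- b \<in> coboundaries gr C 0 q" if b: "b \<in> coboundaries gr C 0 q"
  proof -
    obtain w where w: "w \<in> elements gr C (- 1) q" "b = bd C *\<^sub>v w"
      using b by (auto simp: coboundaries_def)
    have "- w \<in> elements gr C (- 1) q"
      using w(1) by (auto simp: elements_def gr_uminus)
    moreover have "w \<in> carrier_vec (rk C)"
      using w by (simp add: elements_def)
    then have "- b = bd C *\<^sub>v (- w)"
      unfolding w using d by (intro eq_vecI) simp_all
    ultimately show ?thesis unfolding coboundaries_def by simp
  qed
qed

lemma (in graded_ring) coh_class_eq_iff:
  assumes C: "is_cpx gr C" and z: "z \<in> carrier_vec (rk C)" "z' \<in> carrier_vec (rk C)"
  shows "coh_class gr C 0 q z = coh_class gr C 0 q z' \<longleftrightarrow> homotopic gr (rank1 0 q) C (col_mat z) (col_mat z')"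
proof -
  note cl = coboundaries_closed[OF C, where q = q]
  have "coh_class gr C 0 q z = coh_class gr C 0 q z' \<longleftrightarrow> z - z' \<in> coboundaries gr C 0 q"
  proof
    assume e: "coh_class gr C 0 q z = coh_class gr C 0 q z'"
    have "z = z + 0\<^sub>v (rk C)" using z by auto
    then have "z \<in> coh_class gr C 0 q z" using cl(1) unfolding coh_class_def by blast
    then obtain b where b: "b \<in> coboundaries gr C 0 q" "z = z' + b"
      unfolding e unfolding coh_class_def by blast
    then have "z - z' = b" using z cl(4)[OF b(1)] by (intro eq_vecI) auto
    then show "z - z' \<in> coboundaries gr C 0 q" using b(1) by simp
  next
    have sub: "coh_class gr C 0 q x \<subseteq> coh_class gr C 0 q y"
      if "x - y \<in> coboundaries gr C 0 q" "x \<in> carrier_vec (rk C)" "y \<in> carrier_vec (rk C)" for x y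
    proof
      fix t assume "t \<in> coh_class gr C 0 q x"
      then obtain b where b: "b \<in> coboundaries gr C 0 q" "t = x + b" by (auto simp: coh_class_def)
      then have "t = y + ((x - y) + b)" using that cl(4)[OF b(1)] by (intro eq_vecI) auto
      then show "t \<in> coh_class gr C 0 q y"
        using cl(2)[OF that(1) b(1)] unfolding coh_class_def by blast
    qed
    assume h: "z - z' \<in> coboundaries gr C 0 q"
    moreover have "- (z - z') = z' - z" using z by (intro eq_vecI) auto
    ultimately have "z' - z \<in> coboundaries gr C 0 q" using cl(3)[OF h] by simp
    then show "coh_class gr C 0 q z = coh_class gr C 0 q z'" using sub h z by blast
  qed
  then show ?thesis using homotopic_col_mat_iff[OF C z] by simp
qed

text \<open>
  A map on cochains that preserves homotopy of chain maps from rank one modules is well defined on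
  cohomology classes.
\<close>

lemma coh_map_class:
  assumes gr: "graded_ring gr" "graded_ring gr'" and C: "is_cpx gr C" "is_cpx gr' C'"
    and z: "z \<in> carrier_vec (rk C)"
    and car: "\<And>z. z \<in> carrier_vec (rk C) \<Longrightarrow> \<phi> z \<in> carrier_vec (rk C')"
    and h: "\<And>y. y \<in> carrier_vec (rk C) \<Longrightarrow> homotopic gr (rank1 0 q) C (col_mat y) (col_mat z) \<Longrightarrow>
      homotopic gr' (rank1 0 q) C' (col_mat (\<phi> y)) (col_mat (\<phi> z))"
  shows "coh_map gr' C' 0 q \<phi> (coh_class gr C 0 q z) = coh_class gr' C' 0 q (\<phi> z)"
proof -
  interpret s: graded_ring gr by (rule gr(1))
  interpret t: graded_ring gr' by (rule gr(2))
  have "coh_class gr' C' 0 q (\<phi> y) = coh_class gr' C' 0 q (\<phi> z)" if y: "y \<in> coh_class gr C 0 q z" for y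
  proof -
    obtain b where b: "b \<in> coboundaries gr C 0 q" "y = z + b" using y by (auto simp: coh_class_def)
    have bc: "b \<in> carrier_vec (rk C)" using s.coboundaries_closed(4)[OF C(1) b(1)] .
    have "y - z = b" using b z bc by (intro eq_vecI) auto
    then have "homotopic gr (rank1 0 q) C (col_mat y) (col_mat z)"
      using homotopic_col_mat_iff[OF C(1) _ z, of y] b z bc by auto
    then show ?thesis using h t.coh_class_eq_iff[OF C(2)] car z b bc by auto
  qed
  moreover have "z \<in> coh_class gr C 0 q z"
  proof -
    have "z = z + 0\<^sub>v (rk C)" using z by auto
    then show ?thesis using s.coboundaries_closed(1)[OF C(1), of q] unfolding coh_class_def by blast
  qed
  ultimately show ?thesis unfolding coh_map_def by blast
qed

lemma (in graded_hom) homotopic_base_change: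
  assumes C: "is_cpx gr C" "is_cpx gr C'" and M: "dim_row M = rk C'" "dim_col M = rk C"
    and N: "dim_row N = rk C'" "dim_col N = rk C" and h: "homotopic gr C C' M N"
  shows "homotopic gr' (base_change hom C) (base_change hom C') (map_mat hom M) (map_mat hom N)"
proof -
  obtain H where H: "H \<in> bihom gr (- 1) 0 C C'" "M - N = bd C' * H + H * bd C"
    using h unfolding homotopic_def by blast
  note [simp] = is_cpx_dim[OF C(1)] is_cpx_dim[OF C(2)] M N bihom_dim[OF H(1)]
  have "map_mat hom M - map_mat hom N = map_mat hom (M - N)"
    by (rule eq_matI) (auto simp: hom_distribs)
  also have "\<dots> = map_mat hom (bd C') * map_mat hom H + map_mat hom H * map_mat hom (bd C)"
    unfolding H(2) by (simp add: map_mat_add map_mat_mult)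
  finally show ?thesis
    unfolding homotopic_def using bihom_base_change[OF H(1)] by auto
qed

text \<open>
  Since $N M$ is homotopic to the identity, a localized cocycle is determined up to coboundaries by its
  coordinate in the rank one model.
\<close>

lemma loc_nonzero_iff:
  assumes T: "T \<in> leo_triples" and s: "loc_splitting T q M N"
    and W: "chain_map gr_loc (rank1 0 r) (Dloc T) W"
  shows "homotopic gr_loc (rank1 0 r) (Dloc T) W (0\<^sub>m (rk (Dh T)) 1) \<longleftrightarrow> (M * W * 1\<^sub>m 1) $$ (0, 0) = 0"
proof
  note c = leo_is_cpx(5)[OF T]
  note [simp] = loc_splittingD(6-9)[OF s] chain_map_dim[OF W]
  have MW: "M * W * 1\<^sub>m 1 = M * W" by (rule right_mult_one_mat') simp
  {
    assume "homotopic gr_loc (rank1 0 r) (Dloc T) W (0\<^sub>m (rk (Dh T)) 1)"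
    then have "homotopic gr_loc (rank1 0 r) (rank1 0 q) (M * W) (M * 0\<^sub>m (rk (Dh T)) 1)"
      by (intro laurent.homotopic_comp_left[OF is_cpx_rank1_all(3) c is_cpx_rank1_all(3) _ _ _ _ loc_splittingD(2)[OF s]]) simp_all
    then have "M * W = M * 0\<^sub>m (rk (Dh T)) 1"
      by (rule laurent.homotopic_rank1_eq) (auto intro!: carrier_matI)
    then have "M * W = 0\<^sub>m 1 1" by simp
    then show "(M * W * 1\<^sub>m 1) $$ (0, 0) = 0" unfolding MW by simp
  next
    assume "(M * W * 1\<^sub>m 1) $$ (0, 0) = 0"
    then have "M * W = 0\<^sub>m 1 1" unfolding MW by (intro eq_matI) (auto simp del: index_mult_mat(1))
    then have "N * M * W = 0\<^sub>m (rk (Dh T)) 1" by (simp add: mat_mult_assoc_dim)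
    moreover have "homotopic gr_loc (rank1 0 r) (Dloc T) (N * M * W) (1\<^sub>m (rk (Dh T)) * W)"
      by (rule laurent.homotopic_comp_right[OF c c is_cpx_rank1_all(3) _ _ _ _ W loc_splittingD(5)[OF s]]) simp_all
    ultimately have "homotopic gr_loc (rank1 0 r) (Dloc T) (0\<^sub>m (rk (Dh T)) 1) W" by simp
    then show "homotopic gr_loc (rank1 0 r) (Dloc T) W (0\<^sub>m (rk (Dh T)) 1)"
      by (rule laurent.homotopic_sym[OF is_cpx_rank1_all(3) c, rotated -1]) simp_all
  }
qed

text \<open>
  A pair of cocycles is a pair of chain maps from rank one modules. Equality of the two classes modulo
  $h$ is the homotopy that a local map requires, and nonvanishing of the localized class is the
  equivalence after localization.
\<close>

lemma oddly_reduced_full_iff: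
  assumes T: "T \<in> leo_triples"
  shows "oddly_reduced_full T q \<longleftrightarrow> even q \<and> local_le (unit_at q) T"
proof -
  note c = leo_is_cpx[OF T]
  note f = leo_fm(2)[OF T]
  note dimf [simp] = chain_map_dim[OF f]
  obtain r M N where s: "loc_splitting T r M N" using loc_splitting_exists[OF T] by metis
  let ?P = "\<lambda>v w. homotopic gr_triv (rank1 0 q) (D0 T) (fm T * map_mat mod2 (col_mat v)) (map_mat at_h0 (col_mat w))
    \<and> \<not> homotopic gr_loc (rank1 0 q) (Dloc T) (map_mat to_loc (col_mat w)) (0\<^sub>m (rk (Dh T)) 1)"
  have eqP: "(coh_map gr_triv (D0 T) 0 q (\<lambda>v. fm T *\<^sub>v v)
            (coh_map gr_triv (C2 T) 0 q (map_vec mod2) (coh_class gr_triv (Cz T) 0 q v))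
          = coh_map gr_triv (D0 T) 0 q (map_vec at_h0) (coh_class gr_h (Dh T) 0 q w) \<and>
        coh_map gr_loc (Dloc T) 0 q (map_vec to_loc) (coh_class gr_h (Dh T) 0 q w) \<noteq> coh_zero gr_loc (Dloc T) 0 q)
      \<longleftrightarrow> ?P v w" if v: "v \<in> carrier_vec (rk (Cz T))" and w: "w \<in> carrier_vec (rk (Dh T))" for v w
  proof -
    have 1: "coh_map gr_triv (C2 T) 0 q (map_vec mod2) (coh_class gr_triv (Cz T) 0 q v)
      = coh_class gr_triv (C2 T) 0 q (map_vec mod2 v)"
    proof (rule coh_map_class[OF triv_int.graded_ring_axioms triv_bit.graded_ring_axioms c(1,3) v])
      fix y assume "y \<in> carrier_vec (rk (Cz T))" "homotopic gr_triv (rank1 0 q) (Cz T) (col_mat y) (col_mat v)"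
      then show "homotopic gr_triv (rank1 0 q) (C2 T) (col_mat (map_vec mod2 y)) (col_mat (map_vec mod2 v))"
        using mod2.homotopic_base_change[OF is_cpx_rank1_all(1) c(1), of "col_mat y" 0 q "col_mat v"] v
        by (simp add: mod2.base_change_rank1 C2_def[symmetric] map_col_mat)
    qed simp
    have 2: "coh_map gr_triv (D0 T) 0 q (\<lambda>v. fm T *\<^sub>v v) (coh_class gr_triv (C2 T) 0 q (map_vec mod2 v))
      = coh_class gr_triv (D0 T) 0 q (fm T *\<^sub>v map_vec mod2 v)"
    proof (rule coh_map_class[OF triv_bit.graded_ring_axioms triv_bit.graded_ring_axioms c(3,4)])
      fix y assume y: "y \<in> carrier_vec (rk (C2 T))"
        and h: "homotopic gr_triv (rank1 0 q) (C2 T) (col_mat y) (col_mat (map_vec mod2 v))"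
      have "homotopic gr_triv (rank1 0 q) (D0 T) (fm T * col_mat y) (fm T * col_mat (map_vec mod2 v))"
        by (rule triv_bit.homotopic_comp_left[OF is_cpx_rank1_all(1) c(3,4) _ _ _ _ f h]) (use y v in simp_all)
      then show "homotopic gr_triv (rank1 0 q) (D0 T) (col_mat (fm T *\<^sub>v y)) (col_mat (fm T *\<^sub>v map_vec mod2 v))"
        using y v by (simp add: mult_col_mat)
    qed (use v in \<open>auto intro!: carrier_vecI\<close>)
    have 3: "coh_map gr_triv (D0 T) 0 q (map_vec at_h0) (coh_class gr_h (Dh T) 0 q w)
      = coh_class gr_triv (D0 T) 0 q (map_vec at_h0 w)"
    proof (rule coh_map_class[OF poly_h.graded_ring_axioms triv_bit.graded_ring_axioms c(2,4) w])
      fix y assume "y \<in> carrier_vec (rk (Dh T))" "homotopic gr_h (rank1 0 q) (Dh T) (col_mat y) (col_mat w)"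
      then show "homotopic gr_triv (rank1 0 q) (D0 T) (col_mat (map_vec at_h0 y)) (col_mat (map_vec at_h0 w))"
        using at_h0.homotopic_base_change[OF is_cpx_rank1_all(2) c(2), of "col_mat y" 0 q "col_mat w"] w
        by (simp add: at_h0.base_change_rank1 D0_def[symmetric] map_col_mat)
    qed simp
    have 4: "coh_map gr_loc (Dloc T) 0 q (map_vec to_loc) (coh_class gr_h (Dh T) 0 q w)
      = coh_class gr_loc (Dloc T) 0 q (map_vec to_loc w)"
    proof (rule coh_map_class[OF poly_h.graded_ring_axioms laurent.graded_ring_axioms c(2,5) w])
      fix y assume "y \<in> carrier_vec (rk (Dh T))" "homotopic gr_h (rank1 0 q) (Dh T) (col_mat y) (col_mat w)"
      then show "homotopic gr_loc (rank1 0 q) (Dloc T) (col_mat (map_vec to_loc y)) (col_mat (map_vec to_loc w))"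
        using to_loc.homotopic_base_change[OF is_cpx_rank1_all(2) c(2), of "col_mat y" 0 q "col_mat w"] w
        by (simp add: to_loc.base_change_rank1 Dloc_def[symmetric] map_col_mat)
    qed simp
    have z: "col_mat (0\<^sub>v (rk (Dh T))) = (0\<^sub>m (rk (Dh T)) 1 :: laurent mat)"
      by (rule eq_matI) (auto simp: col_mat_def)
    have "coh_class gr_loc (Dloc T) 0 q (map_vec to_loc w) = coh_zero gr_loc (Dloc T) 0 q \<longleftrightarrow>
      homotopic gr_loc (rank1 0 q) (Dloc T) (map_mat to_loc (col_mat w)) (0\<^sub>m (rk (Dh T)) 1)"
      unfolding coh_zero_def
      using laurent.coh_class_eq_iff[OF c(5), of "map_vec to_loc w" "0\<^sub>v (rk (Dh T))" q] w
      by (simp add: z map_col_mat)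
    moreover have "coh_class gr_triv (D0 T) 0 q (fm T *\<^sub>v map_vec mod2 v) = coh_class gr_triv (D0 T) 0 q (map_vec at_h0 w)
      \<longleftrightarrow> homotopic gr_triv (rank1 0 q) (D0 T) (fm T * map_mat mod2 (col_mat v)) (map_mat at_h0 (col_mat w))"
      using triv_bit.coh_class_eq_iff[OF c(4), of "fm T *\<^sub>v map_vec mod2 v" "map_vec at_h0 w" q]
        carrier_vecI[of "fm T *\<^sub>v map_vec mod2 v" "rk (Dh T)"] v w
      by (simp add: map_col_mat mult_col_mat)
    ultimately show ?thesis unfolding 1 2 3 4 by blast
  qed
  have "oddly_reduced_full T q \<longleftrightarrow> even q \<and>
    (\<exists>v \<in> cocycles gr_triv (Cz T) 0 q. \<exists>w \<in> cocycles gr_h (Dh T) 0 q. ?P v w)"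
    unfolding oddly_reduced_full_def cohomology_def bex_simps(7)
    by (intro conj_cong refl bex_cong eqP cocycles_carrier)
  also have "\<dots> \<longleftrightarrow> even q \<and> local_le (unit_at q) T"
  proof (rule conj_cong[OF refl])
    assume q: "even q"
    note U = unit_at_leo[OF q]
    have L: "local_map (unit_at q) T (col_mat v) (col_mat w) \<longleftrightarrow>
        v \<in> cocycles gr_triv (Cz T) 0 q \<and> w \<in> cocycles gr_h (Dh T) 0 q \<and> ?P v w" for v w
    proof (cases "chain_map gr_triv (rank1 0 q) (Cz T) (col_mat v) \<and> chain_map gr_h (rank1 0 q) (Dh T) (col_mat w)")
      case True
      have W: "chain_map gr_loc (rank1 0 q) (Dloc T) (map_mat to_loc (col_mat w))"
        using chain_map_to_loc[OF U T, of "col_mat w"] True by simp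
      have "map_mat at_h0 (col_mat w) * 1\<^sub>m 1 = map_mat at_h0 (col_mat w)"
        by (rule right_mult_one_mat') simp
      then show ?thesis
        using loc_equivalence_iff[OF U T loc_splitting_unit_at[OF q] s, of "map_mat to_loc (col_mat w)"]
          loc_nonzero_iff[OF T s W] True W
        by (simp add: local_map_def chain_map_col_mat_iff[OF c(1)] chain_map_col_mat_iff[OF c(2)] conj_commute
            del: One_nat_def)
    next
      case False
      then show ?thesis
        by (auto simp: local_map_def chain_map_col_mat_iff[OF c(1)] chain_map_col_mat_iff[OF c(2)])
    qed
    have "local_le (unit_at q) T \<longleftrightarrow> (\<exists>v w. local_map (unit_at q) T (col_mat v) (col_mat w))"
      unfolding local_le_def
    proof
      assume "\<exists>\<alpha> \<beta>. local_map (unit_at q) T \<alpha> \<beta>"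
      then obtain \<alpha> \<beta> where l: "local_map (unit_at q) T \<alpha> \<beta>" by blast
      then have "chain_map gr_triv (rank1 0 q) (Cz T) \<alpha>" "chain_map gr_h (rank1 0 q) (Dh T) \<beta>"
        by (simp_all add: local_map_def)
      from this[THEN chain_map_rank1_col_mat] l
      show "\<exists>v w. local_map (unit_at q) T (col_mat v) (col_mat w)" by auto
    qed blast
    then show "(\<exists>v \<in> cocycles gr_triv (Cz T) 0 q. \<exists>w \<in> cocycles gr_h (Dh T) 0 q. ?P v w) \<longleftrightarrow> local_le (unit_at q) T"
      unfolding L by blast
  qed
  finally show ?thesis .
qed

section \<open>The dichotomy between maps from and to the unit\<close>

text \<open>
  These rules turn ring expressions over $F_2$ into Boolean conditions, which hides the linear algebra.
\<close>

declare add_bit_eq_xor [simp del] mult_bit_eq_and [simp del]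

text \<open>
  This is \<open>separating_functional\<close> for the sum of three subspaces: the span of the columns of \<open>D\<close>, the
  image of \<open>J\<close> under \<open>A\<close>, and the span of the basis vectors with index in \<open>B\<close>.
\<close>

lemma separating_alternative:
  fixes D A :: "nat \<Rightarrow> nat \<Rightarrow> 'f::field" and J :: "(nat \<Rightarrow> 'f) set" and x :: "nat \<Rightarrow> 'f"
  assumes J0: "(\<lambda>_. 0) \<in> J" and Jc: "\<And>u v c. u \<in> J \<Longrightarrow> v \<in> J \<Longrightarrow> (\<lambda>i. u i + c * v i) \<in> J"
  obtains (inside) y v z where "v \<in> J" "\<And>i. z i \<noteq> 0 \<Longrightarrow> i \<in> B"
      "\<And>i. i < m \<Longrightarrow> x i = (\<Sum>j<m. D i j * y j) + (\<Sum>j<n. A i j * v j) + z i"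
  | (separated) \<psi> where "\<And>j. j < m \<Longrightarrow> (\<Sum>i<m. \<psi> i * D i j) = 0"
      "\<And>v. v \<in> J \<Longrightarrow> (\<Sum>i<m. \<psi> i * (\<Sum>j<n. A i j * v j)) = 0"
      "\<And>i. i < m \<Longrightarrow> i \<in> B \<Longrightarrow> \<psi> i = 0" "(\<Sum>i<m. \<psi> i * x i) = 1"
proof -
  define F where "F = (\<lambda>y v z i. if i < m then (\<Sum>j<m. D i j * y j) + (\<Sum>j<n. A i j * v j) + z i else 0)"
  define S where "S = {F y v z | y v z. v \<in> J \<and> (\<forall>i. z i \<noteq> 0 \<longrightarrow> i \<in> B)}"
  define x' where "x' = (\<lambda>i. if i < m then x i else 0)"
  have memS: "F y v z \<in> S" if "v \<in> J" "\<And>i. z i \<noteq> 0 \<Longrightarrow> i \<in> B" for y v z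
    using that unfolding S_def by blast
  show thesis
  proof (cases "x' \<in> S")
    case True
    then obtain y v z where "v \<in> J" "\<And>i. z i \<noteq> 0 \<Longrightarrow> i \<in> B" and e: "x' = F y v z"
      unfolding S_def by blast
    moreover have "x i = (\<Sum>j<m. D i j * y j) + (\<Sum>j<n. A i j * v j) + z i" if "i < m" for i
      using fun_cong[OF e, of i] that by (simp add: x'_def F_def)
    ultimately show thesis using inside by blast
  next
    case False
    have "\<exists>\<psi>. (\<forall>u\<in>S. (\<Sum>i<m. \<psi> i * u i) = 0) \<and> (\<Sum>i<m. \<psi> i * x' i) = 1"
    proof (rule separating_functional[OF _ _ _ _ _ False])
      show "u i = 0" if "u \<in> S" "i \<notin> {..<m}" for u i
        using that by (auto simp: S_def F_def)
      have "F (\<lambda>_. 0) (\<lambda>_. 0) (\<lambda>_. 0) = (\<lambda>_. 0)" by (simp add: F_def fun_eq_iff)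
      then show "(\<lambda>_. 0) \<in> S" using memS[OF J0, of "\<lambda>_. 0" "\<lambda>_. 0"] by simp
      show "(\<lambda>i. u i + c * w i) \<in> S" if u: "u \<in> S" and w: "w \<in> S" for u w c
      proof -
        obtain y v z where 1: "v \<in> J" "\<And>i. z i \<noteq> 0 \<Longrightarrow> i \<in> B" "u = F y v z"
          using u unfolding S_def by blast
        obtain y' v' z' where 2: "v' \<in> J" "\<And>i. z' i \<noteq> 0 \<Longrightarrow> i \<in> B" "w = F y' v' z'"
          using w unfolding S_def by blast
        have "F (\<lambda>i. y i + c * y' i) (\<lambda>i. v i + c * v' i) (\<lambda>i. z i + c * z' i) \<in> S"
          using 1 2 Jc by (intro memS) (auto, metis add_0 mult_zero_right)
        moreover have "F (\<lambda>i. y i + c * y' i) (\<lambda>i. v i + c * v' i) (\<lambda>i. z i + c * z' i) = (\<lambda>i. u i + c * w i)"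
          unfolding 1 2 F_def by (auto simp: fun_eq_iff algebra_simps sum.distrib sum_distrib_left)
        ultimately show ?thesis by simp
      qed
    qed (auto simp: x'_def)
    then obtain \<psi> where \<psi>: "\<And>u. u \<in> S \<Longrightarrow> (\<Sum>i<m. \<psi> i * u i) = 0" "(\<Sum>i<m. \<psi> i * x' i) = 1" by blast
    show thesis
    proof (rule separated)
      show "(\<Sum>i<m. \<psi> i * D i j) = 0" if "j < m" for j
        using \<psi>(1)[OF memS[OF J0, of "\<lambda>_. 0" "\<lambda>k. if k = j then 1 else 0"]] that
        by (simp add: F_def mult_if)
      show "(\<Sum>i<m. \<psi> i * (\<Sum>j<n. A i j * v j)) = 0" if "v \<in> J" for v
        using \<psi>(1)[OF memS[OF that, of "\<lambda>_. 0" "\<lambda>_. 0"]] by (simp add: F_def)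
      show "\<psi> i = 0" if "i < m" "i \<in> B" for i
      proof -
        have "k \<in> B" if "(if k = i then 1 else (0::'f)) \<noteq> 0" for k
          using that \<open>i \<in> B\<close> by (simp split: if_splits)
        from \<psi>(1)[OF memS[of "\<lambda>_. 0" "\<lambda>k. if k = i then 1 else 0" "\<lambda>_. 0", OF J0 this]] that(1)
        show ?thesis by (simp add: F_def mult_if)
      qed
      show "(\<Sum>i<m. \<psi> i * x i) = 1" using \<psi>(2) by (simp add: x'_def)
    qed
  qed
qed

text \<open>
  The homogeneous element of degree \<open>q\<close> whose value at $h = 1$ is \<open>c\<close>. Only its part of degree 0
  survives modulo $h$.
\<close>

lemma lift_bit:
  assumes "c \<noteq> 0 \<Longrightarrow> even q \<and> q \<le> 0"
  shows "gr_h q (monom c (nat (- q div 2)))" "at_h1 (monom c (nat (- q div 2))) = c"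
    "at_h0 (monom c (nat (- q div 2))) = (if q = 0 then c else 0)"
proof -
  show "gr_h q (monom c (nat (- q div 2)))"
  proof (cases "c = 0")
    case False
    then have "c = 1" "q = - 2 * int (nat (- q div 2))" using assms by auto
    then show ?thesis unfolding gr_h_def by blast
  qed (simp add: gr_h_def)
  show "at_h1 (monom c (nat (- q div 2))) = c" by (simp add: at_h1_def poly_monom)
  show "at_h0 (monom c (nat (- q div 2))) = (if q = 0 then c else 0)"
    using assms by (cases "c = 0") (auto simp: at_h0_def elim!: evenE)
qed

lemma gr_h_even: "gr_h q a \<Longrightarrow> a \<noteq> 0 \<Longrightarrow> even q"
  by (auto simp: gr_h_def)

lemma gr_h_eqI: "gr_h q a \<Longrightarrow> gr_h q b \<Longrightarrow> at_h1 a = at_h1 b \<Longrightarrow> a = b"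
  by (auto simp: gr_h_def at_h1_def poly_monom)

lemma at_h1_mult_entry:
  assumes "i < dim_row A" "j < dim_col B" "dim_col A = dim_row B"
  shows "at_h1 ((A * B) $$ (i, j)) = (\<Sum>k<dim_row B. at_h1 (A $$ (i, k)) * at_h1 (B $$ (k, j)))"
  by (simp only: mat_mult_entry[OF assms] at_h1.hom_sum at_h1.hom_mult)

text \<open>
  A chain map between the complexes at $h = 1$ that preserves the parity of the quantum degree and does
  not lower the filtration comes from a graded chain map over $F_2[h]$, whose reduction modulo $h$ is
  the associated graded map.
\<close>

lemma filtered_chain_map_lift:
  assumes C: "is_cpx gr_h C" "is_cpx gr_h C'"
    and supp: "\<And>i j. i < rk C' \<Longrightarrow> j < rk C \<Longrightarrow> X i j \<noteq> 0 \<Longrightarrow>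
      hdeg C' i = hdeg C j \<and> even (qdeg C j - qdeg C' i) \<and> qdeg C j \<le> qdeg C' i"
    and comm: "\<And>i j. i < rk C' \<Longrightarrow> j < rk C \<Longrightarrow>
      (\<Sum>k<rk C'. at_h1 (bd C' $$ (i, k)) * X k j) = (\<Sum>k<rk C. X i k * at_h1 (bd C $$ (k, j)))"
  obtains \<beta> where "chain_map gr_h C C' \<beta>"
    "\<And>i j. i < rk C' \<Longrightarrow> j < rk C \<Longrightarrow> at_h1 (\<beta> $$ (i, j)) = X i j"
    "\<And>i j. i < rk C' \<Longrightarrow> j < rk C \<Longrightarrow>
      at_h0 (\<beta> $$ (i, j)) = (if qdeg C j = qdeg C' i then X i j else 0)"
proof -
  note [simp] = is_cpx_dim[OF C(1)] is_cpx_dim[OF C(2)]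
  define \<beta> where "\<beta> = mat (rk C') (rk C) (\<lambda>(i, j). monom (X i j) (nat (- (qdeg C j - qdeg C' i) div 2)))"
  have [simp]: "dim_row \<beta> = rk C'" "dim_col \<beta> = rk C" by (simp_all add: \<beta>_def)
  have e: "\<beta> $$ (i, j) = monom (X i j) (nat (- (qdeg C j - qdeg C' i) div 2))"
    if "i < rk C'" "j < rk C" for i j
    using that by (simp add: \<beta>_def)
  have pre: "X i j \<noteq> 0 \<Longrightarrow> even (qdeg C j - qdeg C' i) \<and> qdeg C j - qdeg C' i \<le> 0"
    if "i < rk C'" "j < rk C" for i j
    using supp[OF that] by simp
  have h1: "at_h1 (\<beta> $$ (i, j)) = X i j" if "i < rk C'" "j < rk C" for i j
    unfolding e[OF that] by (rule lift_bit(2)[OF pre[OF that]])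
  have h0: "at_h0 (\<beta> $$ (i, j)) = (if qdeg C j = qdeg C' i then X i j else 0)"
    if "i < rk C'" "j < rk C" for i j
    unfolding e[OF that] by (subst lift_bit(3)[OF pre[OF that]]) auto
  have b: "\<beta> \<in> bihom gr_h 0 0 C C'"
  proof (rule bihomI)
    fix i j assume ij: "i < rk C'" "j < rk C" and nz: "\<beta> $$ (i, j) \<noteq> 0"
    then have "X i j \<noteq> 0" using e[OF ij] by auto
    then show "hdeg C' i = hdeg C j + 0 \<and> gr_h (qdeg C j + 0 - qdeg C' i) (\<beta> $$ (i, j))"
      unfolding e[OF ij] using supp[OF ij] lift_bit(1)[OF pre[OF ij]] by simp
  qed (auto intro!: carrier_matI)
  note bb = poly_h.bihom_mult00(1)[OF is_cpx_bihom[OF C(2)] b] poly_h.bihom_mult00(2)[OF b is_cpx_bihom[OF C(1)]]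
  have "bd C' * \<beta> = \<beta> * bd C"
  proof (rule eq_matI)
    fix i j assume "i < dim_row (\<beta> * bd C)" "j < dim_col (\<beta> * bd C)"
    then have ij: "i < rk C'" "j < rk C" by auto
    have "at_h1 ((bd C' * \<beta>) $$ (i, j)) = at_h1 ((\<beta> * bd C) $$ (i, j))"
      using ij comm[OF ij] by (simp add: at_h1_mult_entry h1 del: index_mult_mat(1))
    then show "(bd C' * \<beta>) $$ (i, j) = (\<beta> * bd C) $$ (i, j)"
      by (rule gr_h_eqI[OF poly_h.bihom_qdeg'[OF bb(1) ij] poly_h.bihom_qdeg'[OF bb(2) ij]])
  qed auto
  then show thesis using that b h1 h0 unfolding chain_map_def by blast
qed

lemma loc_h1_mult_entry:
  assumes "i < dim_row A" "j < dim_col B" "dim_col A = dim_row B"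
  shows "loc_h1 ((A * B) $$ (i, j)) = (\<Sum>k<dim_row B. loc_h1 (A $$ (i, k)) * (loc_h1 (B $$ (k, j)) :: bit))"
  by (simp only: mat_mult_entry[OF assms] loc_h1.hom_sum loc_h1.hom_mult)

text \<open>
  At $h = 1$ the splitting becomes a cocycle, a functional that vanishes on coboundaries, and the
  statement that the functional takes the value 1 on the cocycle.
\<close>

lemma loc_splitting_h1:
  assumes T: "T \<in> leo_triples" and s: "loc_splitting T q M N"
  shows "(\<Sum>k<rk (Dh T). loc_h1 (M $$ (0, k)) * loc_h1 (N $$ (k, 0))) = (1::bit)"
    and "\<And>i. i < rk (Dh T) \<Longrightarrow> (\<Sum>k<rk (Dh T). at_h1 (bd (Dh T) $$ (i, k)) * loc_h1 (N $$ (k, 0))) = 0"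
    and "\<And>j. j < rk (Dh T) \<Longrightarrow> (\<Sum>k<rk (Dh T). loc_h1 (M $$ (0, k)) * at_h1 (bd (Dh T) $$ (k, j))) = 0"
    and "\<And>k. k < rk (Dh T) \<Longrightarrow> loc_h1 (N $$ (k, 0)) \<noteq> (0::bit) \<Longrightarrow> hdeg (Dh T) k = 0 \<and> even (qdeg (Dh T) k)"
proof -
  note d [simp] = loc_splittingD(6-9)[OF s] is_cpx_dim[OF leo_is_cpx(2)[OF T]] 
  have b: "bd (Dloc T) = map_mat to_loc (bd (Dh T))" by (simp add: Dloc_def)
  show "(\<Sum>k<rk (Dh T). loc_h1 (M $$ (0, k)) * loc_h1 (N $$ (k, 0))) = (1::bit)"
    using loc_h1_mult_entry[of 0 M 0 N] by (simp add: loc_splittingD(4)[OF s] loc_h1.hom_one)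
  show "(\<Sum>k<rk (Dh T). at_h1 (bd (Dh T) $$ (i, k)) * loc_h1 (N $$ (k, 0))) = 0" if "i < rk (Dh T)" for i
  proof -
    have "bd (Dloc T) * N = 0\<^sub>m (rk (Dh T)) 1" using chain_map_comm[OF loc_splittingD(3)[OF s]] by simp
    then have "loc_h1 ((bd (Dloc T) * N) $$ (i, 0)) = (0::bit)" using that by simp
    then show ?thesis using loc_h1_mult_entry[of i "bd (Dloc T)" 0 N] that unfolding b by (simp add: loc_h1_to_loc)
  qed
  show "(\<Sum>k<rk (Dh T). loc_h1 (M $$ (0, k)) * at_h1 (bd (Dh T) $$ (k, j))) = 0" if "j < rk (Dh T)" for j
  proof -
    have "M * bd (Dloc T) = 0\<^sub>m 1 (rk (Dh T))" using chain_map_comm[OF loc_splittingD(2)[OF s], symmetric] by simp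
    then have "loc_h1 ((M * bd (Dloc T)) $$ (0, j)) = (0::bit)" using that by simp
    then show ?thesis using loc_h1_mult_entry[of 0 M j "bd (Dloc T)"] that unfolding b by (simp add: loc_h1_to_loc)
  qed
  fix k assume k: "k < rk (Dh T)" and "loc_h1 (N $$ (k, 0)) \<noteq> (0::bit)"
  then have nz: "N $$ (k, 0) \<noteq> 0" by auto
  note bN = chain_map_bihom[OF loc_splittingD(3)[OF s]]
  show "hdeg (Dh T) k = 0 \<and> even (qdeg (Dh T) k)"
    using bihom_hdeg[OF bN _ _ nz] gr_loc_even[OF bihom_qdeg[OF bN _ _ nz] nz] k loc_splittingD(1)[OF s]
    by (simp add: Dloc_def)
qed

text \<open>
  The way to build maps from a shifted unit: the cocycle \<open>x\<close> at $h = 1$ lifts to degree \<open>q\<close> because of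
  its filtration. As the image of the integral cocycle is the leading part of \<open>x\<close>, the square of
  comparison maps commutes strictly.
\<close>

lemma local_map_from_unit_at:
  assumes T: "T \<in> leo_triples" and q: "even q" and s: "loc_splitting T r M N"
    and supp: "\<And>k. k < rk (Dh T) \<Longrightarrow> x k \<noteq> 0 \<Longrightarrow>
      hdeg (Dh T) k = 0 \<and> even (qdeg (Dh T) k) \<and> q \<le> qdeg (Dh T) k"
    and cocycle: "\<And>i. i < rk (Dh T) \<Longrightarrow> (\<Sum>k<rk (Dh T). at_h1 (bd (Dh T) $$ (i, k)) * x k) = 0"
    and nonzero: "(\<Sum>k<rk (Dh T). loc_h1 (M $$ (0, k)) * x k) \<noteq> (0::bit)"
    and \<alpha>: "chain_map gr_triv (rank1 0 q) (Cz T) \<alpha>"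
    and f: "\<And>i. i < rk (Dh T) \<Longrightarrow>
      (fm T * map_mat mod2 \<alpha>) $$ (i, 0) = (if qdeg (Dh T) i = q then x i else 0)"
  shows "local_le (unit_at q) T"
proof -
  note c = leo_is_cpx[OF T] and U = unit_at_leo[OF q]
  let ?D = "Dh T"
  note [simp] = loc_splittingD(6-9)[OF s] is_cpx_dim[OF c(2)] chain_map_dim[OF \<alpha>] chain_map_dim[OF leo_fm(2)[OF T]]
  obtain \<beta> where c\<beta>: "chain_map gr_h (rank1 0 q) ?D \<beta>"
    and \<beta>: "\<And>k. k < rk ?D \<Longrightarrow> at_h1 (\<beta> $$ (k, 0)) = x k"
      "\<And>k. k < rk ?D \<Longrightarrow> at_h0 (\<beta> $$ (k, 0)) = (if q = qdeg ?D k then x k else 0)"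
    by (rule filtered_chain_map_lift[OF is_cpx_rank1_all(2)[of 0 q] c(2), where X = "\<lambda>k _. x k"])
      (use supp cocycle q in auto)
  note [simp] = chain_map_dim[OF c\<beta>]
  have "loc_h1 ((M * map_mat to_loc \<beta>) $$ (0, 0)) = (\<Sum>k<rk ?D. loc_h1 (M $$ (0, k)) * (x k :: bit))"
    by (subst loc_h1_mult_entry) (simp_all add: loc_h1_to_loc \<beta>(1))
  then have "(M * map_mat to_loc \<beta>) $$ (0, 0) \<noteq> 0"
    using nonzero by (metis loc_h1.hom_zero)
  moreover have "M * map_mat to_loc \<beta> * 1\<^sub>m 1 = M * map_mat to_loc \<beta>"
    by (rule right_mult_one_mat') simp
  ultimately have nz: "(M * map_mat to_loc \<beta> * 1\<^sub>m 1) $$ (0, 0) \<noteq> 0" by simp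
  have "fm T * map_mat mod2 \<alpha> = map_mat at_h0 \<beta>"
  proof (rule eq_matI)
    fix i j assume "i < dim_row (map_mat at_h0 \<beta>)" "j < dim_col (map_mat at_h0 \<beta>)"
    then have ij: "i < rk ?D" "j = 0" by auto
    show "(fm T * map_mat mod2 \<alpha>) $$ (i, j) = map_mat at_h0 \<beta> $$ (i, j)"
      using f[OF ij(1)] \<beta>(2)[OF ij(1)] ij by (auto simp del: index_mult_mat(1))
  qed simp_all
  moreover have "map_mat at_h0 \<beta> * 1\<^sub>m 1 = map_mat at_h0 \<beta>" by (rule right_mult_one_mat') simp
  moreover have "homotopic gr_triv (rank1 0 q) (D0 T) (map_mat at_h0 \<beta>) (map_mat at_h0 \<beta>)"
    using triv_bit.homotopic_refl[OF is_cpx_rank1_all(1) c(4)] chain_map_at_h0[OF U T, of \<beta>] c\<beta> by simp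
  ultimately have "local_map (unit_at q) T \<alpha> \<beta>"
    using \<alpha> c\<beta> by (intro local_mapI[OF U T loc_splitting_unit_at[OF q] s _ _ nz]) (simp_all del: One_nat_def)
  then show ?thesis unfolding local_le_def by blast
qed

text \<open>
  The dual construction. Again the square of comparison maps commutes strictly, because the integral
  functional reduces to the pullback of the leading part of \<open>\<psi>\<close>.
\<close>

lemma local_map_to_unit:
  assumes T: "T \<in> leo_triples" and s: "loc_splitting T r M N"
    and supp: "\<And>k. k < rk (Dh T) \<Longrightarrow> \<psi> k \<noteq> 0 \<Longrightarrow>
      hdeg (Dh T) k = 0 \<and> even (qdeg (Dh T) k) \<and> qdeg (Dh T) k \<le> 0"
    and cocycle: "\<And>j. j < rk (Dh T) \<Longrightarrow> (\<Sum>k<rk (Dh T). \<psi> k * at_h1 (bd (Dh T) $$ (k, j))) = 0"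
    and nonzero: "(\<Sum>k<rk (Dh T). \<psi> k * loc_h1 (N $$ (k, 0))) \<noteq> (0::bit)"
    and \<alpha>: "chain_map gr_triv (Cz T) (rank1 0 0) \<alpha>"
    and f: "\<And>j. j < rk (Cz T) \<Longrightarrow> mod2 (\<alpha> $$ (0, j)) =
      (\<Sum>i<rk (Dh T). (if qdeg (Dh T) i = 0 then \<psi> i else 0) * fm T $$ (i, j))"
  shows "local_le T unit_leo"
proof -
  note c = leo_is_cpx[OF T] and U = unit_at_leo[of 0, simplified]
  let ?D = "Dh T"
  note [simp] = loc_splittingD(6-9)[OF s] is_cpx_dim[OF c(2)] chain_map_dim[OF \<alpha>] chain_map_dim[OF leo_fm(2)[OF T]]
  obtain \<beta> where c\<beta>: "chain_map gr_h ?D (rank1 0 0) \<beta>"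
    and \<beta>: "\<And>k. k < rk ?D \<Longrightarrow> at_h1 (\<beta> $$ (0, k)) = \<psi> k"
      "\<And>k. k < rk ?D \<Longrightarrow> at_h0 (\<beta> $$ (0, k)) = (if qdeg ?D k = 0 then \<psi> k else 0)"
    by (rule filtered_chain_map_lift[OF c(2) is_cpx_rank1_all(2)[of 0 0], where X = "\<lambda>_ k. \<psi> k"])
      (use supp cocycle in auto)
  note [simp] = chain_map_dim[OF c\<beta>]
  have "loc_h1 ((map_mat to_loc \<beta> * N) $$ (0, 0)) = (\<Sum>k<rk ?D. \<psi> k * (loc_h1 (N $$ (k, 0)) :: bit))"
    by (subst loc_h1_mult_entry) (simp_all add: loc_h1_to_loc \<beta>(1))
  then have "(map_mat to_loc \<beta> * N) $$ (0, 0) \<noteq> 0"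
    using nonzero by (metis loc_h1.hom_zero)
  moreover have "1\<^sub>m 1 * map_mat to_loc \<beta> = map_mat to_loc \<beta>"
    by (rule left_mult_one_mat') simp
  ultimately have nz: "(1\<^sub>m 1 * map_mat to_loc \<beta> * N) $$ (0, 0) \<noteq> 0" by simp
  have "1\<^sub>m 1 * map_mat mod2 \<alpha> = map_mat mod2 \<alpha>" by (rule left_mult_one_mat') simp
  moreover have "map_mat mod2 \<alpha> = map_mat at_h0 \<beta> * fm T"
  proof (rule eq_matI)
    fix i j assume "i < dim_row (map_mat at_h0 \<beta> * fm T)" "j < dim_col (map_mat at_h0 \<beta> * fm T)"
    then have ij: "i = 0" "j < rk (Cz T)" by auto
    have "(map_mat at_h0 \<beta> * fm T) $$ (0, j) =
        (\<Sum>i<rk ?D. (if qdeg ?D i = 0 then \<psi> i else 0) * fm T $$ (i, j))"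
      using ij by (subst mat_mult_entry) (simp_all add: \<beta>(2))
    then show "map_mat mod2 \<alpha> $$ (i, j) = (map_mat at_h0 \<beta> * fm T) $$ (i, j)"
      using f[OF ij(2)] ij by (simp del: index_mult_mat(1))
  qed simp_all
  moreover have "homotopic gr_triv (C2 T) (rank1 0 0) (map_mat mod2 \<alpha>) (map_mat mod2 \<alpha>)"
    using triv_bit.homotopic_refl[OF c(3) is_cpx_rank1_all(1)] chain_map_mod2[OF T U, of \<alpha>] \<alpha> by simp
  ultimately have "local_map T (unit_at 0) \<alpha> \<beta>"
    using \<alpha> c\<beta> by (intro local_mapI[OF T U s loc_splitting_unit_at _ _ nz]) (simp_all del: One_nat_def)
  then show ?thesis unfolding local_le_def unit_leo_eq by blast
qed

text \<open>
  The cocycle \<open>x\<close> that generates the localized homology either lies in the subspace of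
  \<open>separating_alternative\<close>, with \<open>J\<close> the reductions of integral cocycles of bidegree (0,0) and \<open>B\<close> the
  generators that a map to the unit must annihilate, or is separated from it. The two cases produce a
  map from the unit and a map to the unit.
\<close>

theorem local_dichotomy:
  assumes T: "T \<in> leo_triples"
  shows "local_le unit_leo T \<or> local_le T unit_leo"
proof -
  note c = leo_is_cpx[OF T]
  obtain r M N where s: "loc_splitting T r M N" using loc_splitting_exists[OF T] by metis
  note h1 = loc_splitting_h1[OF T s]
  note dims [simp] = is_cpx_dim[OF c(1)] is_cpx_dim[OF c(2)] chain_map_dim[OF leo_fm(2)[OF T]]
  let ?m = "rk (Dh T)" and ?n = "rk (Cz T)"
  let ?hd = "hdeg (Dh T)" and ?qd = "qdeg (Dh T)" and ?hc = "hdeg (Cz T)" and ?qc = "qdeg (Cz T)"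
  define D where "D = (\<lambda>i j. at_h1 (bd (Dh T) $$ (i, j)))"
  define A where "A = (\<lambda>i j. fm T $$ (i, j))"
  define x where "x = (\<lambda>k. loc_h1 (N $$ (k, 0)) :: bit)"
  define l where "l = (\<lambda>k. loc_h1 (M $$ (0, k)) :: bit)"
  define K where "K = {v :: nat \<Rightarrow> int. (\<forall>j. v j \<noteq> 0 \<longrightarrow> j < ?n \<and> ?hc j = 0 \<and> ?qc j = 0) \<and>
    (\<forall>i<?n. (\<Sum>j<?n. bd (Cz T) $$ (i, j) * v j) = 0)}"
  define J where "J = {\<lambda>j. mod2 (v j) | v. v \<in> K}"
  define B where "B = {i. ?hd i \<noteq> 0 \<or> ?qd i > 0 \<or> odd (?qd i)}"
  have Kc: "(\<lambda>j. a * u j + b * v j) \<in> K" if "u \<in> K" "v \<in> K" for u v a b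
  proof -
    have "(\<Sum>j<?n. bd (Cz T) $$ (i, j) * (a * u j + b * v j)) =
        a * (\<Sum>j<?n. bd (Cz T) $$ (i, j) * u j) + b * (\<Sum>j<?n. bd (Cz T) $$ (i, j) * v j)" for i
      by (simp add: algebra_simps sum.distrib sum_distrib_left)
    then show ?thesis using that unfolding K_def by (auto, (metis add_0 mult_zero_right)+)
  qed
  have Dnz: "?hd i = ?hd j + 1 \<and> even (?qd j - ?qd i)" if "i < ?m" "j < ?m" "D i j \<noteq> 0" for i j
  proof -
    note b = is_cpx_bihom[OF c(2)]
    have nz: "bd (Dh T) $$ (i, j) \<noteq> 0" using that(3) unfolding D_def by auto
    show ?thesis using bihom_hdeg[OF b that(1,2) nz] gr_h_even[OF bihom_qdeg[OF b that(1,2) nz] nz]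
      by simp
  qed
  have Anz: "?hd i = ?hc j \<and> ?qd i = ?qc j" if "i < ?m" "j < ?n" "A i j \<noteq> 0" for i j
  proof -
    note b = chain_map_bihom[OF leo_fm(2)[OF T]]
    have nz: "fm T $$ (i, j) \<noteq> 0" using that(3) unfolding A_def by auto
    have ij: "i < rk (D0 T)" "j < rk (C2 T)" using that by simp_all
    show ?thesis using bihom_hdeg[OF b ij nz] bihom_qdeg[OF b ij nz] nz
      by (auto simp: gr_triv_def C2_def D0_def)
  qed
  have Dsq: "(\<Sum>k<?m. D i k * D k j) = 0" if "i < ?m" "j < ?m" for i j
    using at_h1_mult_entry[of i "bd (Dh T)" j "bd (Dh T)"] that by (simp add: D_def is_cpx_sq[OF c(2)])
  have Av: "(\<Sum>j<?n. A i j * mod2 (v j)) = 0" if "v \<in> K" "i < ?m" "?hd i \<noteq> 0 \<or> ?qd i \<noteq> 0" for v i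
  proof (rule sum.neutral, rule ballI)
    fix j assume "j \<in> {..<?n}"
    then have j: "j < ?n" by simp
    show "A i j * mod2 (v j) = 0"
    proof (rule ccontr)
      assume "A i j * mod2 (v j) \<noteq> 0"
      then have "A i j \<noteq> 0" "mod2 (v j) \<noteq> 0" by auto
      then have "A i j \<noteq> 0" "v j \<noteq> 0" by auto
      then show False using Anz[OF that(2) j] that(1,3) by (auto simp: K_def)
    qed
  qed
  have J0: "(\<lambda>_. 0) \<in> J"
    unfolding J_def by (rule CollectI, rule exI[of _ "\<lambda>_. 0"]) (simp add: K_def)
  have Jc: "(\<lambda>i. u i + a * v i) \<in> J" if u: "u \<in> J" and v: "v \<in> J" for u v a
  proof -
    obtain u' v' where uv: "u' \<in> K" "v' \<in> K" "u = (\<lambda>j. mod2 (u' j))" "v = (\<lambda>j. mod2 (v' j))"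
      using u v unfolding J_def by blast
    obtain a' where a': "mod2 a' = a"
      by (cases a) (use mod2.hom_zero mod2.hom_one in blast)+
    have "(\<lambda>i. u i + a * v i) = (\<lambda>i. mod2 (1 * u' i + a' * v' i))"
      unfolding uv a'[symmetric] by (simp only: mod2.hom_add mod2.hom_mult mult_1)
    then show ?thesis
      unfolding J_def by (intro CollectI exI[of _ "\<lambda>i. 1 * u' i + a' * v' i"] conjI Kc[OF uv(1,2)])
  qed
  show ?thesis
  proof (rule separating_alternative[OF J0 Jc, where D = D and A = A and B = B and m = ?m and n = ?n and x = x])
    fix y w z
    assume inside: "w \<in> J" "\<And>i. z i \<noteq> 0 \<Longrightarrow> i \<in> B"
      "\<And>i. i < ?m \<Longrightarrow> x i = (\<Sum>j<?m. D i j * y j) + (\<Sum>j<?n. A i j * w j) + z i"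
    from inside(1) obtain v where v: "v \<in> K" "w = (\<lambda>j. mod2 (v j))" unfolding J_def by blast
    \<comment> \<open>Only the part of \<open>y\<close> whose coboundary has the homological degree and quantum parity of \<open>x\<close> is subtracted.\<close>
    define y' where "y' = (\<lambda>j. if ?hd j = - 1 \<and> even (?qd j) then y j else 0)"
    define u where "u = (\<lambda>i. x i - (\<Sum>j<?m. D i j * y' j))"
    have xP: "?hd i = 0 \<and> even (?qd i)" if "i < ?m" "x i \<noteq> 0" for i
      using h1(4)[OF that(1)] that(2) by (simp add: x_def)
    have uP: "u i = (\<Sum>j<?n. A i j * mod2 (v j)) + z i" if "i < ?m" "?hd i = 0" "even (?qd i)" for i
    proof -
      have "(\<Sum>j<?m. D i j * y' j) = (\<Sum>j<?m. D i j * y j)"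
      proof (rule sum.cong[OF refl])
        fix j assume "j \<in> {..<?m}"
        then show "D i j * y' j = D i j * y j"
          using Dnz[OF that(1), of j] that by (cases "D i j = 0") (auto simp: y'_def)
      qed
      then show ?thesis
        unfolding u_def inside(3)[OF that(1)] v(2) by (simp add: algebra_simps)
    qed
    have u0: "u i = 0" if "i < ?m" "?hd i \<noteq> 0 \<or> odd (?qd i)" for i
    proof -
      have "(\<Sum>j<?m. D i j * y' j) = 0"
      proof (rule sum.neutral, rule ballI)
        fix j assume "j \<in> {..<?m}"
        then show "D i j * y' j = 0"
          using Dnz[OF that(1), of j] that by (cases "D i j = 0") (auto simp: y'_def)
      qed
      moreover have "x i = 0" using xP[OF that(1)] that(2) by blast
      ultimately show ?thesis unfolding u_def by simp
    qed
    let ?\<alpha> = "mat ?n 1 (\<lambda>(j, _). v j)"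
    have \<alpha>: "chain_map gr_triv (rank1 0 0) (Cz T) ?\<alpha>"
      unfolding chain_map_def
    proof
      show "?\<alpha> \<in> bihom gr_triv 0 0 (rank1 0 0) (Cz T)"
        using v(1) by (intro bihomI) (auto simp: K_def gr_triv_def)
      show "bd (Cz T) * ?\<alpha> = ?\<alpha> * bd (rank1 0 0)"
        using v(1) by (intro eq_matI) (auto simp: mat_mult_entry K_def simp del: index_mult_mat(1))
    qed
    have fa: "(fm T * map_mat mod2 ?\<alpha>) $$ (i, 0) = (\<Sum>j<?n. A i j * mod2 (v j))" if "i < ?m" for i
      using that by (subst mat_mult_entry) (simp_all add: A_def)
    have "local_le (unit_at 0) T"
    proof (rule local_map_from_unit_at[OF T _ s _ _ _ \<alpha>])
      fix i assume i: "i < ?m"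
      show "?hd i = 0 \<and> even (?qd i) \<and> 0 \<le> ?qd i" if "u i \<noteq> 0"
      proof -
        have P: "?hd i = 0" "even (?qd i)" using u0[OF i] that by auto
        have "?qd i \<ge> 0"
        proof (rule ccontr)
          assume neg: "\<not> ?qd i \<ge> 0"
          then have "i \<notin> B" using P by (simp add: B_def)
          then have "z i = 0" using inside(2) by blast
          moreover have "(\<Sum>j<?n. A i j * mod2 (v j)) = 0" using Av[OF v(1) i] neg by simp
          ultimately show False using uP[OF i P] that by simp
        qed
        then show ?thesis using P by simp
      qed
      show "(\<Sum>k<?m. at_h1 (bd (Dh T) $$ (i, k)) * u k) = 0"
      proof -
        have "(\<Sum>k<?m. D i k * (\<Sum>j<?m. D k j * y' j)) = (\<Sum>j<?m. (\<Sum>k<?m. D i k * D k j) * y' j)"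
          by (simp only: sum_distrib_left sum_distrib_right mult.assoc) (rule sum.swap)
        also have "\<dots> = 0" using Dsq[OF i] by simp
        finally have "(\<Sum>k<?m. D i k * u k) = (\<Sum>k<?m. D i k * x k)"
          unfolding u_def by (simp only: right_diff_distrib sum_subtractf diff_zero)
        then show ?thesis using h1(2)[OF i] by (simp add: D_def x_def)
      qed
      show "(fm T * map_mat mod2 ?\<alpha>) $$ (i, 0) = (if ?qd i = 0 then u i else 0)"
        unfolding fa[OF i]
      proof (cases "?qd i = 0 \<and> ?hd i = 0")
        case True
        then have "i \<notin> B" by (simp add: B_def)
        then have "z i = 0" using inside(2) by blast
        then show "(\<Sum>j<?n. A i j * mod2 (v j)) = (if ?qd i = 0 then u i else 0)"
          using True uP[OF i] by simp
      next
        case False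
        then show "(\<Sum>j<?n. A i j * mod2 (v j)) = (if ?qd i = 0 then u i else 0)"
          using Av[OF v(1) i] u0[OF i] by auto
      qed
    next
      have "(\<Sum>k<?m. l k * (\<Sum>j<?m. D k j * y' j)) = (\<Sum>j<?m. (\<Sum>k<?m. l k * D k j) * y' j)"
        by (simp only: sum_distrib_left sum_distrib_right mult.assoc) (rule sum.swap)
      also have "\<dots> = 0" using h1(3) by (simp add: l_def D_def)
      finally have "(\<Sum>k<?m. l k * u k) = (\<Sum>k<?m. l k * x k)"
        unfolding u_def by (simp only: right_diff_distrib sum_subtractf diff_zero)
      then show "(\<Sum>k<?m. loc_h1 (M $$ (0, k)) * u k) \<noteq> 0"
        using h1(1) by (simp add: l_def x_def)
    qed simp
    then show ?thesis by (simp add: unit_leo_eq)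
  next
    fix \<psi>
    assume separated: "\<And>j. j < ?m \<Longrightarrow> (\<Sum>i<?m. \<psi> i * D i j) = 0"
      "\<And>v. v \<in> J \<Longrightarrow> (\<Sum>i<?m. \<psi> i * (\<Sum>j<?n. A i j * v j)) = 0"
      "\<And>i. i < ?m \<Longrightarrow> i \<in> B \<Longrightarrow> \<psi> i = 0" "(\<Sum>i<?m. \<psi> i * x i) = 1"
    define g where "g = (\<lambda>j. \<Sum>i<?m. (if ?qd i = 0 then \<psi> i else 0) * A i j)"
    define I where "I = {j. j < ?n \<and> ?hc j = 0 \<and> ?qc j = 0}"
    have \<psi>P: "?hd i = 0 \<and> even (?qd i) \<and> ?qd i \<le> 0" if "i < ?m" "\<psi> i \<noteq> 0" for i
    proof -
      have "i \<notin> B" using separated(3)[OF that(1)] that(2) by blast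
      then show ?thesis by (auto simp: B_def)
    qed
    have g0: "g j = 0" if "j < ?n" "j \<notin> I" for j
      unfolding g_def
    proof (rule sum.neutral, rule ballI)
      fix i assume "i \<in> {..<?m}"
      then show "(if ?qd i = 0 then \<psi> i else 0) * A i j = 0"
        using \<psi>P[of i] Anz[of i j] that by (cases "A i j = 0"; cases "\<psi> i = 0") (auto simp: I_def)
    qed
    define t where "t = (\<lambda>j. if g j = 0 then 0 else 1 :: int)"
    have t: "mod2 (t j) = g j" for j by (cases "g j") (auto simp: t_def)
    have even_iff: "even k \<longleftrightarrow> mod2 k = 0" for k
      unfolding mod2_def by (cases "even k") (auto elim!: evenE oddE)
    have "\<exists>y. (\<forall>j. even (y j - t j)) \<and> (\<forall>u\<in>K. (\<Sum>j\<in>I. y j * u j) = 0)"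
    proof (rule integral_functional_lift)
      show "finite I" by (simp add: I_def)
      show "u j = 0" if "u \<in> K" "j \<notin> I" for u j using that by (auto simp: K_def I_def)
      show "(\<lambda>j. a * u j + b * v j) \<in> K" if "u \<in> K" "v \<in> K" for u v a b by (rule Kc[OF that])
      show "u \<in> K" if "(\<lambda>j. 2 * u j) \<in> K" for u
      proof -
        have "(\<Sum>j<?n. bd (Cz T) $$ (i, j) * (2 * u j)) = 2 * (\<Sum>j<?n. bd (Cz T) $$ (i, j) * u j)" for i
          by (simp add: sum_distrib_left mult.left_commute)
        then show ?thesis using that by (simp add: K_def)
      qed
      show "even (\<Sum>j\<in>I. t j * u j)" if u: "u \<in> K" for u
      proof -
        have "mod2 (\<Sum>j\<in>I. t j * u j) = (\<Sum>j\<in>I. g j * mod2 (u j))"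
          by (simp only: mod2.hom_sum mod2.hom_mult t)
        also have "\<dots> = (\<Sum>j<?n. g j * mod2 (u j))"
          by (rule sum.mono_neutral_left) (auto simp: I_def g0)
        also have "\<dots> = (\<Sum>j<?n. \<Sum>i<?m. (if ?qd i = 0 then \<psi> i else 0) * A i j * mod2 (u j))"
          by (simp only: g_def sum_distrib_right)
        also have "\<dots> = (\<Sum>i<?m. (if ?qd i = 0 then \<psi> i else 0) * (\<Sum>j<?n. A i j * mod2 (u j)))"
          by (simp only: sum_distrib_left mult.assoc) (rule sum.swap)
        also have "\<dots> = (\<Sum>i<?m. \<psi> i * (\<Sum>j<?n. A i j * mod2 (u j)))"
          using Av[OF u] by (intro sum.cong) auto
        also have "\<dots> = 0"
          using separated(2)[of "\<lambda>j. mod2 (u j)"] u by (auto simp: J_def)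
        finally show ?thesis by (simp add: even_iff)
      qed
    qed
    then obtain y where y: "\<And>j. even (y j - t j)" "\<And>u. u \<in> K \<Longrightarrow> (\<Sum>j\<in>I. y j * u j) = 0" by blast
    let ?\<alpha> = "mat 1 ?n (\<lambda>(_, j). if j \<in> I then y j else 0)"
    \<comment> \<open>A column of the differential that meets \<open>I\<close> is itself an integral cocycle of bidegree (0,0).\<close>
    have ker: "(\<Sum>j<?n. (if j \<in> I then y j else 0) * bd (Cz T) $$ (j, k)) = 0" if k: "k < ?n" for k
    proof (cases "\<exists>j\<in>I. bd (Cz T) $$ (j, k) \<noteq> 0")
      case True
      then obtain j where j: "j \<in> I" "bd (Cz T) $$ (j, k) \<noteq> 0" by blast
      note b = is_cpx_bihom[OF c(1)]
      have nz: "?hc i = ?hc k + 1 \<and> ?qc i = ?qc k" if "i < ?n" "bd (Cz T) $$ (i, k) \<noteq> 0" for i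
        using bihom_hdeg[OF b that(1) k that(2)] bihom_qdeg[OF b that(1) k that(2)] that(2)
        by (auto simp: gr_triv_def)
      then have hk: "?hc k = - 1" "?qc k = 0" using nz[of j] j by (auto simp: I_def)
      let ?v = "\<lambda>i. if i < ?n then bd (Cz T) $$ (i, k) else 0"
      have "(\<Sum>j<?n. bd (Cz T) $$ (i, j) * ?v j) = (bd (Cz T) * bd (Cz T)) $$ (i, k)" if "i < ?n" for i
        using that k by (subst mat_mult_entry) (auto intro!: sum.cong)
      then have "?v \<in> K" using nz hk k by (auto simp: K_def is_cpx_sq[OF c(1)] split: if_splits)
      from y(2)[OF this] have "(\<Sum>j\<in>I. y j * ?v j) = 0" .
      moreover have "(\<Sum>j\<in>I. y j * ?v j) = (\<Sum>j\<in>I. (if j \<in> I then y j else 0) * bd (Cz T) $$ (j, k))"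
        by (rule sum.cong) (auto simp: I_def)
      ultimately have "0 = (\<Sum>j\<in>I. (if j \<in> I then y j else 0) * bd (Cz T) $$ (j, k))" by simp
      also have "\<dots> = (\<Sum>j<?n. (if j \<in> I then y j else 0) * bd (Cz T) $$ (j, k))"
        by (rule sum.mono_neutral_left) (auto simp: I_def)
      finally show ?thesis ..
    qed (auto intro!: sum.neutral)
    have \<alpha>: "chain_map gr_triv (Cz T) (rank1 0 0) ?\<alpha>"
      unfolding chain_map_def
    proof
      show "?\<alpha> \<in> bihom gr_triv 0 0 (Cz T) (rank1 0 0)"
        by (intro bihomI) (auto simp: I_def gr_triv_def split: if_splits)
      show "bd (rank1 0 0) * ?\<alpha> = ?\<alpha> * bd (Cz T)"
        using ker by (intro eq_matI) (auto simp: mat_mult_entry simp del: index_mult_mat(1))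
    qed
    have "local_le T unit_leo"
    proof (rule local_map_to_unit[OF T s \<psi>P _ _ \<alpha>])
      show "(\<Sum>k<?m. \<psi> k * at_h1 (bd (Dh T) $$ (k, j))) = 0" if "j < ?m" for j
        using separated(1)[OF that] by (simp add: D_def)
      show "(\<Sum>k<?m. \<psi> k * loc_h1 (N $$ (k, 0))) \<noteq> 0"
        using separated(4) by (simp add: x_def)
      show "mod2 (?\<alpha> $$ (0, j)) = (\<Sum>i<?m. (if ?qd i = 0 then \<psi> i else 0) * fm T $$ (i, j))"
        if j: "j < ?n" for j
      proof -
        have "mod2 (y j) = g j"
        proof -
          have "mod2 (y j - t j) = 0" using y(1)[of j] by (simp add: even_iff)
          then have "mod2 (y j) = mod2 (t j)" by (simp add: mod2.hom_minus eq_iff_diff_eq_0[of "mod2 (y j)"])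
          then show ?thesis by (simp add: t)
        qed
        then have "mod2 (?\<alpha> $$ (0, j)) = g j" using j g0[OF j] by (simp add: mod2.hom_zero)
        then show ?thesis by (simp add: g_def A_def)
      qed
    qed
    then show ?thesis ..
  qed
qed

section \<open>The invariant\<close>

text \<open>
  The map is a power of $h$ on the second component. If the power is positive, it vanishes modulo $h$,
  and the integral component is 0.
\<close>

lemma unit_at_mono:
  assumes q: "even q" "even q'" "q' \<le> q"
  shows "local_le (unit_at q') (unit_at q)"
proof (rule local_map_from_unit_at[OF unit_at_leo[OF q(1)] q(2) loc_splitting_unit_at[OF q(1)],
      where x = "\<lambda>_. 1" and \<alpha> = "mat 1 1 (\<lambda>_. if q = q' then 1 else 0)"])
  let ?\<alpha> = "mat 1 1 (\<lambda>_. if q = q' then 1 else 0) :: int mat"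
  show "chain_map gr_triv (rank1 0 q') (Cz (unit_at q)) ?\<alpha>"
    unfolding chain_map_def by (auto intro!: bihomI simp: gr_triv_def split: if_splits)
  show "(fm (unit_at q) * map_mat mod2 ?\<alpha>) $$ (i, 0) = (if qdeg (Dh (unit_at q)) i = q' then 1 else 0)"
    if "i < rk (Dh (unit_at q))" for i
    using that by (simp add: mod2.hom_zero mod2.hom_one)
qed (use q in \<open>auto simp: at_h1.hom_zero loc_h1.hom_one\<close>)

text \<open>
  A nonzero entry of degree \<open>q\<close> over $F_2[h]$ requires a generator of quantum degree at least \<open>q\<close>.
\<close>

lemma local_le_unit_at_bound:
  assumes T: "T \<in> leo_triples" and q: "even q" and le: "local_le (unit_at q) T"
  shows "q \<le> (\<Sum>k<rk (Dh T). \<bar>qdeg (Dh T) k\<bar>)"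
proof -
  obtain \<alpha> \<beta> where l: "local_map (unit_at q) T \<alpha> \<beta>" using le unfolding local_le_def by blast
  then have \<beta>: "chain_map gr_h (rank1 0 q) (Dh T) \<beta>"
    and e: "homotopy_equivalence gr_loc (Dloc (unit_at q)) (Dloc T) (map_mat to_loc \<beta>)"
    by (auto simp: local_map_def)
  obtain r M N where s: "loc_splitting T r M N" using loc_splitting_exists[OF T] by metis
  note [simp] = loc_splittingD(6-9)[OF s] chain_map_dim[OF \<beta>]
  have "(M * map_mat to_loc \<beta> * 1\<^sub>m 1) $$ (0, 0) \<noteq> 0"
    using e loc_equivalence_iff[OF unit_at_leo[OF q] T loc_splitting_unit_at[OF q] s]
    unfolding homotopy_equivalence_def by blast
  moreover have "M * map_mat to_loc \<beta> * 1\<^sub>m 1 = M * map_mat to_loc \<beta>" by (rule right_mult_one_mat') simp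
  ultimately have "(\<Sum>k<rk (Dh T). M $$ (0, k) * to_loc (\<beta> $$ (k, 0))) \<noteq> 0"
    by (simp add: mat_mult_entry del: index_mult_mat(1))
  then obtain k where k: "k < rk (Dh T)" "M $$ (0, k) * to_loc (\<beta> $$ (k, 0)) \<noteq> 0"
    by (metis (no_types, lifting) lessThan_iff sum.not_neutral_contains_not_neutral)
  then have nz: "\<beta> $$ (k, 0) \<noteq> 0" by auto
  from bihom_qdeg[OF chain_map_bihom[OF \<beta>] k(1) _ nz] nz
  have "q \<le> qdeg (Dh T) k" by (auto simp: gr_h_def)
  also have "\<dots> \<le> \<bar>qdeg (Dh T) k\<bar>" by simp
  also have "\<dots> \<le> (\<Sum>k<rk (Dh T). \<bar>qdeg (Dh T) k\<bar>)"
    using k(1) by (intro member_le_sum) auto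
  finally show ?thesis .
qed

text \<open>
  Far below all generators, the localized generator lifts to a multiple of $h$, which is compatible
  with the integral cocycle 0.
\<close>

lemma local_le_unit_at_exists:
  assumes T: "T \<in> leo_triples"
  shows "\<exists>q. even q \<and> local_le (unit_at q) T"
proof -
  obtain r M N where s: "loc_splitting T r M N" using loc_splitting_exists[OF T] by metis
  note h1 = loc_splitting_h1[OF T s]
  define b where "b = (\<Sum>k<rk (Dh T). \<bar>qdeg (Dh T) k\<bar>)"
  \<comment> \<open>An even degree strictly below that of every generator.\<close>
  define q where "q = - 2 * (b + 1)"
  have q: "q < qdeg (Dh T) k" if "k < rk (Dh T)" for k
  proof -
    have "\<bar>qdeg (Dh T) k\<bar> \<le> b"
      unfolding b_def using that by (intro member_le_sum) auto
    then have "qdeg (Dh T) k \<le> b" "- qdeg (Dh T) k \<le> b" by (simp_all add: abs_le_iff)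
    then show ?thesis unfolding q_def by presburger
  qed
  have "even q" by (simp add: q_def)
  moreover have "local_le (unit_at q) T"
  proof (rule local_map_from_unit_at[OF T \<open>even q\<close> s, where x = "\<lambda>k. loc_h1 (N $$ (k, 0))" and \<alpha> = "0\<^sub>m (rk (Cz T)) 1"])
    show "chain_map gr_triv (rank1 0 q) (Cz T) (0\<^sub>m (rk (Cz T)) 1)"
      unfolding chain_map_def
      using triv_int.bihom_zero[of "Cz T" "rank1 0 q"] is_cpx_dim[OF leo_is_cpx(1)[OF T]] by simp
    show "(fm T * map_mat mod2 (0\<^sub>m (rk (Cz T)) 1)) $$ (i, 0) =
        (if qdeg (Dh T) i = q then loc_h1 (N $$ (i, 0)) else 0)" if "i < rk (Dh T)" for i
      using that q[OF that] chain_map_dim[OF leo_fm(2)[OF T]] by (simp add: mod2.map_mat_zero)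
  qed (use h1 q in \<open>auto simp: less_imp_le\<close>)
  ultimately show ?thesis by blast
qed

lemma s_o_greatest:
  assumes T: "T \<in> leo_triples"
  shows "oddly_reduced_full T (s_o T)" "oddly_reduced_full T q \<Longrightarrow> q \<le> s_o T"
proof -
  obtain p where p: "oddly_reduced_full T p"
    using local_le_unit_at_exists[OF T] oddly_reduced_full_iff[OF T] by blast
  let ?b = "\<Sum>k<rk (Dh T). \<bar>qdeg (Dh T) k\<bar>"
  define S where "S = {q. oddly_reduced_full T q \<and> p \<le> q}"
  have b: "q \<le> ?b" if "oddly_reduced_full T q" for q
    using that local_le_unit_at_bound[OF T] oddly_reduced_full_iff[OF T] by blast
  have "S \<subseteq> {p..?b}" using b by (auto simp: S_def)
  then have fin: "finite S" by (rule finite_subset) simp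
  have ne: "S \<noteq> {}" using p by (auto simp: S_def)
  have "Max S \<in> S" by (rule Max_in[OF fin ne])
  moreover have le: "q \<le> Max S" if "oddly_reduced_full T q" for q
  proof (cases "p \<le> q")
    case True
    then show ?thesis using that fin by (intro Max_ge) (auto simp: S_def)
  next
    case False
    then show ?thesis using \<open>Max S \<in> S\<close> by (auto simp: S_def)
  qed
  ultimately have "s_o T = Max S" "oddly_reduced_full T (Max S)"
    unfolding s_o_def by (auto intro!: Greatest_equality simp: S_def)
  then show "oddly_reduced_full T (s_o T)" "oddly_reduced_full T q \<Longrightarrow> q \<le> s_o T"
    using le by auto
qed

lemma s_o_nonneg_iff:
  assumes T: "T \<in> leo_triples"
  shows "s_o T \<ge> 0 \<longleftrightarrow> local_le unit_leo T"
proof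
  assume "s_o T \<ge> 0"
  moreover have "even (s_o T)" "local_le (unit_at (s_o T)) T"
    using s_o_greatest(1)[OF T] oddly_reduced_full_iff[OF T] by auto
  ultimately show "local_le unit_leo T"
    using local_le_trans[OF unit_at_leo unit_at_leo T unit_at_mono] unfolding unit_leo_eq by auto
next
  assume "local_le unit_leo T"
  then show "s_o T \<ge> 0"
    using s_o_greatest(2)[OF T, of 0] oddly_reduced_full_iff[OF T, of 0] by (simp add: unit_leo_eq)
qed

lemma s_o_cong:
  assumes T: "T \<in> leo_triples" "T' \<in> leo_triples" and le: "local_le T T'" "local_le T' T"
  shows "s_o T = s_o T'"
proof -
  have "oddly_reduced_full T q \<longleftrightarrow> oddly_reduced_full T' q" for q
    using oddly_reduced_full_iff[OF T(1), of q] oddly_reduced_full_iff[OF T(2), of q]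
      local_le_trans[OF unit_at_leo T(1,2) _ le(1), of q] local_le_trans[OF unit_at_leo T(2,1) _ le(2), of q]
    by blast
  then show ?thesis by (simp add: s_o_def)
qed

lemma unit_leo_closed: "unit_leo \<in> leo_triples"
  by (simp add: unit_leo_eq unit_at_leo)

lemma s_o_unit: "s_o unit_leo = 0"
proof (rule antisym)
  note U = unit_leo_closed
  have "s_o unit_leo \<le> (\<Sum>k<rk (Dh unit_leo). \<bar>qdeg (Dh unit_leo) k\<bar>)"
    using s_o_greatest(1)[OF U] oddly_reduced_full_iff[OF U] local_le_unit_at_bound[OF U] by blast
  then show "s_o unit_leo \<le> 0" by (simp add: unit_leo_eq)
  show "0 \<le> s_o unit_leo" using s_o_nonneg_iff[OF U] local_le_refl[OF U] by simp
qed

section \<open>The ordered group\<close>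

text \<open>
  A submonoid \<open>P\<close> of an abelian group such that each element or its inverse lies in \<open>P\<close>, and both do
  only for the identity, is the positive cone of a translation-invariant total order.
\<close>

lemma (in comm_group) positive_cone_order:
  assumes one: "P \<one>"
    and mult: "\<And>x y. x \<in> carrier G \<Longrightarrow> y \<in> carrier G \<Longrightarrow> P x \<Longrightarrow> P y \<Longrightarrow> P (x \<otimes> y)"
    and total: "\<And>x. x \<in> carrier G \<Longrightarrow> P x \<or> P (inv x)"
    and pointed: "\<And>x. x \<in> carrier G \<Longrightarrow> P x \<Longrightarrow> P (inv x) \<Longrightarrow> x = \<one>"
    and R: "R = {(x, y). x \<in> carrier G \<and> y \<in> carrier G \<and> P (y \<otimes> inv x)}"
  shows "linear_order_on (carrier G) R"
    and "\<And>x y z. z \<in> carrier G \<Longrightarrow> (x, y) \<in> R \<Longrightarrow> (x \<otimes> z, y \<otimes> z) \<in> R"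
proof -
  have inv_diff: "inv (y \<otimes> inv x) = x \<otimes> inv y" if "x \<in> carrier G" "y \<in> carrier G" for x y
    using that by (simp add: inv_mult_group)
  have add_diff: "(z \<otimes> inv y) \<otimes> (y \<otimes> inv x) = z \<otimes> inv x"
    if "x \<in> carrier G" "y \<in> carrier G" "z \<in> carrier G" for x y z
    using that by (simp add: m_assoc) (simp add: m_assoc[symmetric])
  show "linear_order_on (carrier G) R"
    unfolding linear_order_on_def partial_order_on_def preorder_on_def
  proof (intro conjI)
    show "R \<subseteq> carrier G \<times> carrier G" by (auto simp: R)
    show "refl_on (carrier G) R" by (rule refl_onI) (auto simp: R one)
    show "trans R"
    proof (rule transI)
      fix x y z assume "(x, y) \<in> R" "(y, z) \<in> R"
      then show "(x, z) \<in> R"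
        using mult[of "z \<otimes> inv y" "y \<otimes> inv x"] by (auto simp: R add_diff)
    qed
    show "antisym R"
    proof (rule antisymI)
      fix x y assume xy: "(x, y) \<in> R" "(y, x) \<in> R"
      then have c: "x \<in> carrier G" "y \<in> carrier G" by (auto simp: R)
      then have "y \<otimes> inv x = \<one>"
        using xy by (intro pointed) (auto simp: R inv_diff)
      then have "inv (inv x) = y" using c by (intro inv_equality) auto
      then show "x = y" using c by simp
    qed
    show "total_on (carrier G) R"
    proof (rule total_onI)
      fix x y assume c: "x \<in> carrier G" "y \<in> carrier G"
      then show "(x, y) \<in> R \<or> (y, x) \<in> R"
        using total[of "y \<otimes> inv x"] by (auto simp: R inv_diff)
    qed
  qed
  fix x y z assume z: "z \<in> carrier G" and xy: "(x, y) \<in> R"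
  then have c: "x \<in> carrier G" "y \<in> carrier G" by (auto simp: R)
  have "(y \<otimes> z) \<otimes> inv (x \<otimes> z) = y \<otimes> inv x"
    using c z by (simp add: inv_mult_group m_assoc) (simp add: m_assoc[symmetric])
  then show "(x \<otimes> z, y \<otimes> z) \<in> R" using xy z by (auto simp: R)
qed

lemma local_equiv_iff:
  "(T, T') \<in> local_equiv \<longleftrightarrow> T \<in> leo_triples \<and> T' \<in> leo_triples \<and> local_le T T' \<and> local_le T' T"
  by (simp add: local_equiv_def local_le_def)

lemma equiv_local_equiv: "equiv leo_triples local_equiv"
proof (rule equivI)
  show "local_equiv \<subseteq> leo_triples \<times> leo_triples" by (auto simp: local_equiv_iff)
  show "refl_on leo_triples local_equiv" by (rule refl_onI) (auto simp: local_equiv_iff local_le_refl)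
  show "sym local_equiv" by (rule symI) (auto simp: local_equiv_iff)
  show "trans local_equiv" by (rule transI) (auto simp: local_equiv_iff intro: local_le_trans)
qed

lemma leo_class_eq_iff:
  "T \<in> leo_triples \<Longrightarrow> T' \<in> leo_triples \<Longrightarrow> leo_class T = leo_class T' \<longleftrightarrow> local_le T T' \<and> local_le T' T"
  unfolding leo_class_def using eq_equiv_class_iff[OF equiv_local_equiv, of T T'] by (simp add: local_equiv_iff)

lemma carrier_LEO: "X \<in> carrier LEO_group \<longleftrightarrow> (\<exists>T \<in> leo_triples. X = leo_class T)"
proof -
  have "carrier LEO_group = leo_triples // local_equiv" by (simp add: LEO_group_def)
  then show ?thesis unfolding quotient_def leo_class_def by blast
qed

lemma leo_class_self: "T \<in> leo_triples \<Longrightarrow> T \<in> leo_class T"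
  by (simp add: leo_class_def local_equiv_iff local_le_refl)

lemma mult_LEO:
  assumes T: "T \<in> leo_triples" "T' \<in> leo_triples"
  shows "leo_class T \<otimes>\<^bsub>LEO_group\<^esub> leo_class T' = leo_class (tensor_leo T T')"
proof -
  have "leo_class (tensor_leo S S') = leo_class (tensor_leo T T')"
    if "S \<in> leo_class T" "S' \<in> leo_class T'" for S S'
  proof -
    have "S \<in> leo_triples" "local_le T S" "local_le S T" "S' \<in> leo_triples" "local_le T' S'" "local_le S' T'"
      using that by (auto simp: leo_class_def local_equiv_iff)
    then show ?thesis
      using T by (simp add: leo_class_eq_iff tensor_leo_closed local_le_tensor)
  qed
  moreover have "leo_class T \<otimes>\<^bsub>LEO_group\<^esub> leo_class T' =
      (\<Union>S\<in>leo_class T. \<Union>S'\<in>leo_class T'. leo_class (tensor_leo S S'))"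
    by (simp add: LEO_group_def)
  ultimately show ?thesis
    using leo_class_self[OF T(1)] leo_class_self[OF T(2)] by blast
qed

lemma one_LEO: "\<one>\<^bsub>LEO_group\<^esub> = leo_class unit_leo"
  by (simp add: LEO_group_def)

lemma leo_has_dual:
  assumes "T \<in> leo_triples"
  obtains g where "homotopy_inverse gr_triv (C2 T) (D0 T) (fm T) g"
  using leo_fm(1)[OF assms] unfolding homotopy_equivalence_def by blast

lemma tensor_dual_class:
  assumes T: "T \<in> leo_triples" and g: "homotopy_inverse gr_triv (C2 T) (D0 T) (fm T) g"
  shows "leo_class T \<otimes>\<^bsub>LEO_group\<^esub> leo_class (dual_leo T g) = \<one>\<^bsub>LEO_group\<^esub>"
  using T dual_leo_closed[OF T g] local_le_ev[OF T g] local_le_coev[OF T g]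
  by (simp add: mult_LEO one_LEO leo_class_eq_iff tensor_leo_closed unit_leo_closed)

lemma comm_group_LEO: "comm_group LEO_group"
proof (rule comm_groupI)
  have sym: "leo_class (tensor_leo T T') = leo_class (tensor_leo T' T)"
    if "T \<in> leo_triples" "T' \<in> leo_triples" for T T'
    using that by (simp add: leo_class_eq_iff tensor_leo_closed local_le_swap)
  have comm: "X \<otimes>\<^bsub>LEO_group\<^esub> Y = Y \<otimes>\<^bsub>LEO_group\<^esub> X" if "X \<in> carrier LEO_group" "Y \<in> carrier LEO_group" for X Y
    using that unfolding carrier_LEO
    by (elim bexE) (simp add: mult_LEO sym)
  fix X Y Z assume X: "X \<in> carrier LEO_group"
  show "\<one>\<^bsub>LEO_group\<^esub> \<otimes>\<^bsub>LEO_group\<^esub> X = X"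
    using X unfolding carrier_LEO one_LEO by (elim bexE) (simp add: mult_LEO unit_leo_closed tensor_leo_unit_left)
  show "\<exists>Y\<in>carrier LEO_group. Y \<otimes>\<^bsub>LEO_group\<^esub> X = \<one>\<^bsub>LEO_group\<^esub>"
  proof -
    obtain T where T: "T \<in> leo_triples" "X = leo_class T" using X unfolding carrier_LEO by blast
    obtain g where g: "homotopy_inverse gr_triv (C2 T) (D0 T) (fm T) g" using leo_has_dual[OF T(1)] .
    have c: "leo_class (dual_leo T g) \<in> carrier LEO_group"
      unfolding carrier_LEO using dual_leo_closed[OF T(1) g] by blast
    then show ?thesis using tensor_dual_class[OF T(1) g] comm[OF X c] unfolding T(2) by metis
  qed
  show "X \<otimes>\<^bsub>LEO_group\<^esub> Y = Y \<otimes>\<^bsub>LEO_group\<^esub> X" if "Y \<in> carrier LEO_group"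
    using comm X that .
  show "X \<otimes>\<^bsub>LEO_group\<^esub> Y \<in> carrier LEO_group" if "Y \<in> carrier LEO_group"
    using X that unfolding carrier_LEO by (auto simp: mult_LEO intro!: tensor_leo_closed)
  show "X \<otimes>\<^bsub>LEO_group\<^esub> Y \<otimes>\<^bsub>LEO_group\<^esub> Z = X \<otimes>\<^bsub>LEO_group\<^esub> (Y \<otimes>\<^bsub>LEO_group\<^esub> Z)"
    if "Y \<in> carrier LEO_group" "Z \<in> carrier LEO_group"
    using X that unfolding carrier_LEO by (elim bexE) (simp add: mult_LEO tensor_leo_closed tensor_leo_assoc)
next
  show "\<one>\<^bsub>LEO_group\<^esub> \<in> carrier LEO_group" unfolding carrier_LEO one_LEO using unit_leo_closed by blast
qed

lemma inv_LEO:
  assumes T: "T \<in> leo_triples" and g: "homotopy_inverse gr_triv (C2 T) (D0 T) (fm T) g"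
  shows "inv\<^bsub>LEO_group\<^esub> leo_class T = leo_class (dual_leo T g)"
proof -
  interpret comm_group LEO_group by (rule comm_group_LEO)
  have c: "leo_class T \<in> carrier LEO_group" "leo_class (dual_leo T g) \<in> carrier LEO_group"
    unfolding carrier_LEO using T dual_leo_closed[OF T g] by blast+
  show ?thesis using inv_equality[OF _ c] tensor_dual_class[OF T g] m_comm[OF c] by simp
qed

lemma LEO_nonneg_iff:
  assumes T: "T \<in> leo_triples"
  shows "LEO_nonneg (leo_class T) \<longleftrightarrow> local_le unit_leo T"
proof -
  have "s_o S = s_o T" if "S \<in> leo_class T" for S
    using that s_o_cong by (auto simp: leo_class_def local_equiv_iff)
  then have "LEO_nonneg (leo_class T) \<longleftrightarrow> s_o T \<ge> 0"
    unfolding LEO_nonneg_def using leo_class_self[OF T] by metis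
  then show ?thesis using s_o_nonneg_iff[OF T] by simp
qed

text \<open>
  Tensoring the map from the unit to the dual with \<open>T\<close> and evaluating gives a map from \<open>T\<close> to the unit.
\<close>

lemma trivial_if_nonneg:
  assumes T: "T \<in> leo_triples" and g: "homotopy_inverse gr_triv (C2 T) (D0 T) (fm T) g"
    and le: "local_le unit_leo T" "local_le unit_leo (dual_leo T g)"
  shows "leo_class T = \<one>\<^bsub>LEO_group\<^esub>"
proof -
  note T' = dual_leo_closed[OF T g]
  have "local_le (tensor_leo T unit_leo) (tensor_leo T (dual_leo T g))"
    by (rule local_le_tensor[OF T unit_leo_closed T T' local_le_refl[OF T] le(2)])
  then have "local_le T unit_leo"
    using local_le_trans[OF T tensor_leo_closed[OF T T'] unit_leo_closed _ local_le_ev[OF T g]]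
    by (simp add: tensor_leo_unit_right[OF T])
  then show ?thesis using le(1) T unit_leo_closed by (simp add: one_LEO leo_class_eq_iff)
qed

text \<open>
  A map from \<open>T\<close> to the unit, tensored with the dual and composed with coevaluation, is a map from the
  unit to the dual.
\<close>

lemma unit_or_dual:
  assumes T: "T \<in> leo_triples" and g: "homotopy_inverse gr_triv (C2 T) (D0 T) (fm T) g"
  shows "local_le unit_leo T \<or> local_le unit_leo (dual_leo T g)"
proof -
  note T' = dual_leo_closed[OF T g]
  have "local_le unit_leo (dual_leo T g)" if "local_le T unit_leo"
  proof -
    have "local_le (tensor_leo T (dual_leo T g)) (tensor_leo unit_leo (dual_leo T g))"
      by (rule local_le_tensor[OF T T' unit_leo_closed T' that local_le_refl[OF T']])
    then show ?thesis
      using local_le_trans[OF unit_leo_closed tensor_leo_closed[OF T T'] T' local_le_coev[OF T g]]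
      by (simp add: tensor_leo_unit_left[OF T'])
  qed
  then show ?thesis using local_dichotomy[OF T] by blast
qed

lemma LEO_order:
  shows "linear_order_on (carrier LEO_group) LEO_le"
    and "\<And>X Y Z. Z \<in> carrier LEO_group \<Longrightarrow> (X, Y) \<in> LEO_le \<Longrightarrow>
      (X \<otimes>\<^bsub>LEO_group\<^esub> Z, Y \<otimes>\<^bsub>LEO_group\<^esub> Z) \<in> LEO_le"
proof -
  have one: "LEO_nonneg \<one>\<^bsub>LEO_group\<^esub>"
    by (simp add: one_LEO LEO_nonneg_iff unit_leo_closed local_le_refl)
  have mult: "LEO_nonneg (X \<otimes>\<^bsub>LEO_group\<^esub> Y)"
    if XY: "X \<in> carrier LEO_group" "Y \<in> carrier LEO_group" "LEO_nonneg X" "LEO_nonneg Y" for X Y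
  proof -
    obtain T T' where T: "T \<in> leo_triples" "X = leo_class T" "T' \<in> leo_triples" "Y = leo_class T'"
      using XY(1,2) unfolding carrier_LEO by blast
    have "local_le (tensor_leo unit_leo unit_leo) (tensor_leo T T')"
      using XY(3,4) T by (intro local_le_tensor) (auto simp: unit_leo_closed LEO_nonneg_iff)
    then show ?thesis
      using T by (simp add: mult_LEO LEO_nonneg_iff tensor_leo_closed tensor_leo_unit_left unit_leo_closed)
  qed
  have total: "LEO_nonneg X \<or> LEO_nonneg (inv\<^bsub>LEO_group\<^esub> X)"
    and pointed: "LEO_nonneg X \<Longrightarrow> LEO_nonneg (inv\<^bsub>LEO_group\<^esub> X) \<Longrightarrow> X = \<one>\<^bsub>LEO_group\<^esub>"
    if X: "X \<in> carrier LEO_group" for X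
  proof -
    obtain T where T: "T \<in> leo_triples" "X = leo_class T" using X unfolding carrier_LEO by blast
    obtain g where g: "homotopy_inverse gr_triv (C2 T) (D0 T) (fm T) g" using leo_has_dual[OF T(1)] .
    have "LEO_nonneg X \<longleftrightarrow> local_le unit_leo T"
      "LEO_nonneg (inv\<^bsub>LEO_group\<^esub> X) \<longleftrightarrow> local_le unit_leo (dual_leo T g)"
      unfolding T(2) inv_LEO[OF T(1) g] using LEO_nonneg_iff T(1) dual_leo_closed[OF T(1) g] by blast+
    then show "LEO_nonneg X \<or> LEO_nonneg (inv\<^bsub>LEO_group\<^esub> X)"
      "LEO_nonneg X \<Longrightarrow> LEO_nonneg (inv\<^bsub>LEO_group\<^esub> X) \<Longrightarrow> X = \<one>\<^bsub>LEO_group\<^esub>"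
      using unit_or_dual[OF T(1) g] trivial_if_nonneg[OF T(1) g] T(2) by auto
  qed
  show "linear_order_on (carrier LEO_group) LEO_le"
    by (rule comm_group.positive_cone_order(1)[OF comm_group_LEO one _ _ _ LEO_le_def])
      (use mult total pointed in blast)+
  show "(X \<otimes>\<^bsub>LEO_group\<^esub> Z, Y \<otimes>\<^bsub>LEO_group\<^esub> Z) \<in> LEO_le"
    if "Z \<in> carrier LEO_group" "(X, Y) \<in> LEO_le" for X Y Z
    by (rule comm_group.positive_cone_order(2)[OF comm_group_LEO one _ _ _ LEO_le_def that])
      (use mult total pointed in blast)+
qed

lemma trivial_iff_s_o:
  assumes T: "T \<in> leo_triples" and g: "homotopy_inverse gr_triv (C2 T) (D0 T) (fm T) g"
  shows "leo_class T = \<one>\<^bsub>LEO_group\<^esub> \<longleftrightarrow> s_o T = 0 \<and> s_o (dual_leo T g) = 0"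
proof
  note T' = dual_leo_closed[OF T g]
  interpret comm_group LEO_group by (rule comm_group_LEO)
  have s0: "s_o S = 0" if "S \<in> leo_triples" "leo_class S = \<one>\<^bsub>LEO_group\<^esub>" for S
    using that s_o_cong[OF that(1) unit_leo_closed] s_o_unit
    by (simp add: one_LEO leo_class_eq_iff unit_leo_closed)
  {
    assume 1: "leo_class T = \<one>\<^bsub>LEO_group\<^esub>"
    then have "leo_class (dual_leo T g) = \<one>\<^bsub>LEO_group\<^esub>" using inv_LEO[OF T g] inv_one by simp
    then show "s_o T = 0 \<and> s_o (dual_leo T g) = 0" using 1 s0 T T' by blast
  next
    assume "s_o T = 0 \<and> s_o (dual_leo T g) = 0"
    then show "leo_class T = \<one>\<^bsub>LEO_group\<^esub>"
      using trivial_if_nonneg[OF T g] s_o_nonneg_iff[OF T] s_o_nonneg_iff[OF T'] by simp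
  }
qed

theorem theorem1p2:
  shows
    "(\<forall>T \<in> leo_triples. oddly_reduced_full T (s_o T) \<and>
        (\<forall>q. oddly_reduced_full T q \<longrightarrow> q \<le> s_o T)) \<and>
     (\<forall>T \<in> leo_triples. \<forall>T' \<in> leo_triples. leo_class T = leo_class T' \<longrightarrow> s_o T = s_o T') \<and>
     comm_group LEO_group \<and>
     (\<forall>T \<in> leo_triples. \<forall>g. homotopy_inverse gr_triv (C2 T) (D0 T) (fm T) g \<longrightarrow>
        dual_leo T g \<in> leo_triples \<and>
        leo_class (dual_leo T g) = inv\<^bsub>LEO_group\<^esub> (leo_class T) \<and>
        (leo_class T = \<one>\<^bsub>LEO_group\<^esub> \<longleftrightarrow> s_o T = 0 \<and> s_o (dual_leo T g) = 0)) \<and>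
     (\<forall>T \<in> leo_triples. LEO_nonneg (leo_class T) \<longleftrightarrow> s_o T \<ge> 0) \<and>
     linear_order_on (carrier LEO_group) LEO_le \<and>
     (\<forall>X \<in> carrier LEO_group. \<forall>Y \<in> carrier LEO_group. \<forall>Z \<in> carrier LEO_group.
        (X, Y) \<in> LEO_le \<longrightarrow> (X \<otimes>\<^bsub>LEO_group\<^esub> Z, Y \<otimes>\<^bsub>LEO_group\<^esub> Z) \<in> LEO_le)"
proof (intro conjI ballI allI impI)
  fix T assume T: "T \<in> leo_triples"
  show "oddly_reduced_full T (s_o T)" by (rule s_o_greatest(1)[OF T])
  show "q \<le> s_o T" if "oddly_reduced_full T q" for q by (rule s_o_greatest(2)[OF T that])
  show "s_o T = s_o T'" if T': "T' \<in> leo_triples" and e: "leo_class T = leo_class T'" for T'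
    using leo_class_eq_iff[OF T T'] e s_o_cong[OF T T'] by blast
  show "LEO_nonneg (leo_class T) \<longleftrightarrow> s_o T \<ge> 0"
    using LEO_nonneg_iff[OF T] s_o_nonneg_iff[OF T] by simp
  fix g assume g: "homotopy_inverse gr_triv (C2 T) (D0 T) (fm T) g"
  show "dual_leo T g \<in> leo_triples" by (rule dual_leo_closed[OF T g])
  show "leo_class (dual_leo T g) = inv\<^bsub>LEO_group\<^esub> (leo_class T)" by (rule inv_LEO[OF T g, symmetric])
  show "leo_class T = \<one>\<^bsub>LEO_group\<^esub> \<longleftrightarrow> s_o T = 0 \<and> s_o (dual_leo T g) = 0"
    by (rule trivial_iff_s_o[OF T g])
next
  show "comm_group LEO_group" by (rule comm_group_LEO)
  show "linear_order_on (carrier LEO_group) LEO_le" by (rule LEO_order(1))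
  show "(X \<otimes>\<^bsub>LEO_group\<^esub> Z, Y \<otimes>\<^bsub>LEO_group\<^esub> Z) \<in> LEO_le"
    if "Z \<in> carrier LEO_group" "(X, Y) \<in> LEO_le" for X Y Z
    by (rule LEO_order(2)[OF that])
qed

end
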